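(* Let $\phi$ be admissible and satisfy $\sum_{\nu=-\infty}^\infty\hat\phi(2^{-\nu}\xi)=1$ for all $\xi\ne0$, let $f\in\mathcal S'(\mathbb{R}^n)$ be of temperate order $d$, and let $m\ge-1$ be an integer. Then the polynomials $$P_{m,N}(x)=\sum_{|\alpha|\le m}c_{\alpha,N}x^\alpha,\qquad c_{\alpha,N}=\frac1{\alpha!}\partial^\alpha\big(2^{-nN}\Phi(2^{-N}\cdot)*f\big)(0),$$ satisfy, for $N\in\mathbb{N}$, $$f=\sum_{\nu=-N}^\infty\phi_\nu*f+P_{m,N}+\mathcal O(2^{-N(n+m+1-d)})\quad\text{in }\mathcal S'.$$ Moreover, any polynomials $\widetilde P_{m,N}(x)=\sum_{|\alpha|\le m}\tilde c_{\alpha,N}x^\alpha$, $N\in\mathbb{N}$, fulfil this formula with an $o(1)$-error, that is, $$f=\sum_{\nu=-N}^\infty\phi_\nu*f+\widetilde P_{m,N}+o(1)\quad\text{in }\mathcal S'\text{ for }N\to\infty,$$ if and only if their coefficients satisfy, for all $|\alpha|\le m$ and $N\to\infty$, $$\tilde c_{\alpha,N}=\frac1{\alpha!}\partial^\alpha\big(2^{-nN}\Phi(2^{-N}\cdot)*f\big)(0)+o(1).$$ Here the leading term (the first term on the right-hand side, i.e. $c_{\alpha,N}$) is also given by $$c_{\alpha,N}=\frac1{(2\pi)^n}\Big\langle\hat f,\ \frac{(i\xi)^\alpha}{\alpha!}\Big(1-\sum_{\nu=-N}^\infty\hat\phi_\nu\Big)\Big\rangle,$$ where $\langle\cdot,\cdot\rangle$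 denotes the bilinear pairing of $\mathcal S'$ and $\mathcal S$.
   Context: Fourier transform: $\hat f(\xi)=\int e^{-i x\cdot\xi}f(x)\,dx$. $\mathcal S$, $\mathcal S'$ are the Schwartz functions and tempered distributions on $\mathbb{R}^n$, and $D^\alpha=(-i)^{|\alpha|}\partial^\alpha$. Admissibility: fix constants $0<K_0<K_1<1<K^1<K^0$ with $2K_1<K^1$ and $K^0<\pi$. A function $\phi\in\mathcal S$ is admissible if $\operatorname{supp}\hat\phi\subset\{\xi: K_0\le|\xi|\le K^0\}$ and, for some $c>0$, $|\hat\phi(\xi)|\ge c$ for $K_1\le|\xi|\le K^1$. $\phi_\nu(x)=2^{\nu n}\phi(2^\nu x)$ for $\nu\in\mathbb{Z}$, so $\hat\phi_\nu(\xi)=\hat\phi(2^{-\nu}\xi)$. $\Phi\in\mathcal S$ is defined by $\hat\Phi(\xi)=1-\sum_{\nu=0}^\infty\hat\phi(2^{-\nu}\xi)$. $f\in\mathcal S'$ has temperate order (or $\mathcal S'$-order) $d$ if $d\ge0$ is the smallest integer such that, for some $c$, $|\langle f,\psi\rangle|\le c\sup_{|\alpha|\le d}\|(1+|x|)^dD^\alpha\psi\|_\infty$ for all $\psi\in\mathcal S$. An $N$-dependent tempered distribution is $\mathcal O(2^{-Nr})$ (respectively $o(1)$) in $\mathcal S'$ for $N\to\infty$ if its pairing with each fixed $\psi\in\mathcal S$ is $\mathcal O(2^{-Nr})$ (respectively $o(1)$). For $m=-1$ the polynomials of degree $m$ are understood to be $0$.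
   Formalization: The "if" half of the o(1)-equivalence is stated only for n+m+1-d ≥ 0, since it fails otherwise (e.g. f = 1, m = -1: every φ_ν*f = 0 and the coefficient condition is vacuous); the "only if" half is stated for all m ≥ -1. *)

theory Defs
  imports "HOL-Analysis.Analysis" "HOL-Library.Landau_Symbols"
begin

type_synonym 'n multi_index = "'n \<Rightarrow> nat"

definition mi_size :: "'n::finite multi_index \<Rightarrow> nat" where
  "mi_size \<alpha> = (\<Sum>i\<in>UNIV. \<alpha> i)"

definition mi_fact :: "'n::finite multi_index \<Rightarrow> nat" where
  "mi_fact \<alpha> = (\<Prod>i\<in>UNIV. fact (\<alpha> i))"

definition mi_power :: "'a::comm_ring_1 ^ 'n \<Rightarrow> 'n::finite multi_index \<Rightarrow> 'a" where
  "mi_power z \<alpha> = (\<Prod>i\<in>UNIV. (z $ i) ^ \<alpha> i)"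

definition partial_deriv :: "'n::finite \<Rightarrow> (real^'n \<Rightarrow> complex) \<Rightarrow> real^'n \<Rightarrow> complex" where
  "partial_deriv i g x = vector_derivative (\<lambda>t. g (x + t *\<^sub>R axis i 1)) (at 0)"

text \<open>
  Differentiability of every iterated partial derivative implies that each of them is
  continuous, so this is the usual class of infinitely differentiable functions.
\<close>

definition smooth :: "(real^'n::finite \<Rightarrow> complex) \<Rightarrow> bool" where
  "smooth g \<longleftrightarrow> (\<forall>is x. foldr partial_deriv is g differentiable (at x))"

text \<open>
  The list of directions enumerates the multi-index \<open>\<alpha>\<close> in some order; on smooth functions
  partial derivatives commute, so the order is immaterial.
\<close>

definition mi_deriv :: "'n::finite multi_index \<Rightarrow> (real^'n \<Rightarrow> complex) \<Rightarrow> real^'n \<Rightarrow> complex" where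
  "mi_deriv \<alpha> g = foldr partial_deriv (SOME is. \<forall>i. count_list is i = \<alpha> i) g"

definition mi_D :: "'n::finite multi_index \<Rightarrow> (real^'n \<Rightarrow> complex) \<Rightarrow> real^'n \<Rightarrow> complex" where
  "mi_D \<alpha> g x = (- \<i>) ^ mi_size \<alpha> * mi_deriv \<alpha> g x"

definition schwartz :: "(real^'n::finite \<Rightarrow> complex) \<Rightarrow> bool" where
  "schwartz \<psi> \<longleftrightarrow>
     smooth \<psi> \<and> (\<forall>k \<alpha>. bdd_above (range (\<lambda>x. (1 + norm x) ^ k * norm (mi_D \<alpha> \<psi> x))))"

definition schwartz_seminorm :: "nat \<Rightarrow> (real^'n::finite \<Rightarrow> complex) \<Rightarrow> real" where
  "schwartz_seminorm d \<psi> =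
     (SUP \<alpha>\<in>{\<alpha>. mi_size \<alpha> \<le> d}. SUP x. (1 + norm x) ^ d * norm (mi_D \<alpha> \<psi> x))"

text \<open>
  Functionals on the Schwartz space are functions on all of \<open>real^'n \<Rightarrow> complex\<close>; only their
  values on Schwartz functions are meaningful.
\<close>

type_synonym 'n functional = "(real^'n \<Rightarrow> complex) \<Rightarrow> complex"

definition temperate_order_le :: "'n::finite functional \<Rightarrow> nat \<Rightarrow> bool" where
  "temperate_order_le u d \<longleftrightarrow>
     (\<exists>c. \<forall>\<psi>. schwartz \<psi> \<longrightarrow> norm (u \<psi>) \<le> c * schwartz_seminorm d \<psi>)"

text \<open>
  Tempered distributions are the continuous linear functionals. The seminorms increase with
  \<open>d\<close> and define the topology of the Schwartz space, so continuity of a linear functional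
  is boundedness with respect to one of them.
\<close>

definition tempered_distribution :: "'n::finite functional \<Rightarrow> bool" where
  "tempered_distribution u \<longleftrightarrow>
     (\<forall>\<psi> \<theta> a b. schwartz \<psi> \<longrightarrow> schwartz \<theta> \<longrightarrow>
        u (\<lambda>x. a * \<psi> x + b * \<theta> x) = a * u \<psi> + b * u \<theta>) \<and>
     (\<exists>d. temperate_order_le u d)"

definition temperate_order :: "'n::finite functional \<Rightarrow> nat \<Rightarrow> bool" where
  "temperate_order u d \<longleftrightarrow> temperate_order_le u d \<and> (\<forall>k<d. \<not> temperate_order_le u k)"

definition fourier :: "(real^'n::finite \<Rightarrow> complex) \<Rightarrow> real^'n \<Rightarrow> complex" where
  "fourier g \<xi> = (LINT x|lborel. exp (- (\<i> * complex_of_real (x \<bullet> \<xi>))) * g x)"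

definition fourier_dist :: "'n::finite functional \<Rightarrow> 'n functional" where
  "fourier_dist u \<psi> = u (fourier \<psi>)"

definition conv_dist ::
  "(real^'n::finite \<Rightarrow> complex) \<Rightarrow> 'n functional \<Rightarrow> real^'n \<Rightarrow> complex" where
  "conv_dist g u x = u (\<lambda>y. g (x - y))"

definition regular_dist :: "(real^'n::finite \<Rightarrow> complex) \<Rightarrow> 'n functional" where
  "regular_dist g \<psi> = (LINT x|lborel. g x * \<psi> x)"

definition dyadic_dilation ::
  "int \<Rightarrow> (real^'n::finite \<Rightarrow> complex) \<Rightarrow> real^'n \<Rightarrow> complex" where
  "dyadic_dilation \<nu> g x =
     complex_of_real (2 powi (\<nu> * int CARD('n))) * g ((2 powi \<nu>) *\<^sub>R x)"

text \<open>
  The annulus radii satisfy \<open>K0 < K1 < 1 < L1 < L0\<close>; \<open>L1\<close> and \<open>L0\<close> are usually written as \<open>K\<close> with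
  upper indices 1 and 0.
\<close>

definition admissible ::
  "real \<Rightarrow> real \<Rightarrow> real \<Rightarrow> real \<Rightarrow> (real^'n::finite \<Rightarrow> complex) \<Rightarrow> bool" where
  "admissible K0 K1 L1 L0 \<phi> \<longleftrightarrow>
     schwartz \<phi> \<and>
     closure {\<xi>. fourier \<phi> \<xi> \<noteq> 0} \<subseteq> {\<xi>. K0 \<le> norm \<xi> \<and> norm \<xi> \<le> L0} \<and>
     (\<exists>c>0. \<forall>\<xi>. K1 \<le> norm \<xi> \<and> norm \<xi> \<le> L1 \<longrightarrow> norm (fourier \<phi> \<xi>) \<ge> c)"

text \<open>
  For admissible \<open>\<phi>\<close> only finitely many terms of the sum are nonzero at each \<open>\<xi>\<close>, and the
  Fourier transform is injective on Schwartz functions, so the description is unique.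
\<close>

definition low_pass :: "(real^'n::finite \<Rightarrow> complex) \<Rightarrow> real^'n \<Rightarrow> complex" where
  "low_pass \<phi> = (THE \<Phi>. schwartz \<Phi> \<and>
     (\<forall>\<xi>. fourier \<Phi> \<xi> = 1 - (\<Sum>\<nu>. fourier \<phi> ((2 powi (- int \<nu>)) *\<^sub>R \<xi>))))"

text \<open>\<open>m\<close> is an integer so that \<open>m = -1\<close> gives the empty sum, i.e. the zero polynomial.\<close>

definition mi_poly :: "int \<Rightarrow> ('n::finite multi_index \<Rightarrow> complex) \<Rightarrow> real^'n \<Rightarrow> complex" where
  "mi_poly m c x = (\<Sum>\<alpha> | int (mi_size \<alpha>) \<le> m. c \<alpha> * complex_of_real (mi_power x \<alpha>))"

definition lp_coeff ::
  "(real^'n::finite \<Rightarrow> complex) \<Rightarrow> 'n functional \<Rightarrow> nat \<Rightarrow> 'n multi_index \<Rightarrow> complex" where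
  "lp_coeff \<phi> f N \<alpha> =
     1 / of_nat (mi_fact \<alpha>) *
     mi_deriv \<alpha> (conv_dist (dyadic_dilation (- int N) (low_pass \<phi>)) f) 0"

text \<open>The summation index is shifted: \<open>k = 0, 1, \<dots>\<close> stands for \<open>\<nu> = k - N \<ge> -N\<close>.\<close>

definition lp_term ::
  "(real^'n::finite \<Rightarrow> complex) \<Rightarrow> 'n functional \<Rightarrow> nat \<Rightarrow> nat \<Rightarrow> 'n functional" where
  "lp_term \<phi> f N k = regular_dist (conv_dist (dyadic_dilation (int k - int N) \<phi>) f)"

definition lp_remainder ::
  "(real^'n::finite \<Rightarrow> complex) \<Rightarrow> 'n functional \<Rightarrow> (nat \<Rightarrow> real^'n \<Rightarrow> complex) \<Rightarrow>
   nat \<Rightarrow> 'n functional" where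
  "lp_remainder \<phi> f P N \<psi> = f \<psi> - ((\<Sum>k. lp_term \<phi> f N k \<psi>) + regular_dist (P N) \<psi>)"

definition dist_bigo :: "(nat \<Rightarrow> 'n::finite functional) \<Rightarrow> real \<Rightarrow> bool" where
  "dist_bigo T r \<longleftrightarrow>
     (\<forall>\<psi>. schwartz \<psi> \<longrightarrow> (\<lambda>N. T N \<psi>) \<in> O(\<lambda>N. complex_of_real (2 powr (- real N * r))))"

definition dist_smallo_1 :: "(nat \<Rightarrow> 'n::finite functional) \<Rightarrow> bool" where
  "dist_smallo_1 T \<longleftrightarrow> (\<forall>\<psi>. schwartz \<psi> \<longrightarrow> (\<lambda>N. T N \<psi>) \<in> o(\<lambda>N. 1))"

end

theory Submission
  imports Defs "HOL-Probability.Probability"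
begin

text \<open>
  Write \<open>\<phi>_\<nu>\<close>, \<open>\<Phi>_\<nu>\<close> for the dyadic dilations. On the Fourier side \<open>\<phi>_\<nu> = \<Phi>_(\<nu>+1) - \<Phi>_\<nu>\<close>, so the series
  telescopes, and \<open>\<Phi>_\<nu> * f\<close> tends to \<open>f\<close> because \<open>\<Phi>\<close> has integral 1. What remains of \<open>f\<close> is
  \<open>\<Phi>_(-N) * f\<close>; subtracting its Taylor polynomial of degree \<open>m\<close> at 0 leaves, after pairing with \<open>\<psi>\<close>,
  the value of \<open>f\<close> at a test function whose derivatives are \<open>O(s^(n+m+1) / (1 + s|y|)^k)\<close> with
  \<open>s = 2^(-N)\<close>, for every \<open>k\<close>. The weight \<open>(1 + |y|)^d\<close> costs a factor \<open>s^(-d)\<close>. If \<open>n + m + 1 = d\<close>, these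
  test functions live on separate dyadic scales, so their pairings with \<open>f\<close> are absolutely summable
  and therefore \<open>o(1)\<close>. The coefficients are determined up to \<open>o(1)\<close> because the Fourier transform of
  \<open>\<Phi>\<close> is 1 near 0, which makes the derivatives of \<open>\<Phi>\<close> dual to the monomials.
\<close>

section \<open>Partial derivatives and Schwartz functions\<close>

text \<open>One device carries most of the analysis: convolving a Schwartz function with a linear
  functional that is bounded in a seminorm. Its derivative rule is proved once, for an abstract
  functional, and applied to \<open>f\<close>, to Schwartz functions and to characters. It yields
  the derivatives of \<open>\<Phi>_(-N) * f\<close>, the stability of the Schwartz class under
  convolution, and the Fourier transform of a derivative.

  Pairing \<open>\<Phi>_(-N) * f\<close> with \<psi> is an integral of values of \<open>f\<close>;
  to see it as one value of \<open>f\<close>, the integral has to be moved inside \<open>f\<close>,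
  for which only linearity and one seminorm bound are at hand.

  For n + m + 1 < d the remainder need not be o(1). If f is a monomial of degree above m, all terms
  \<open>\<phi>_\<nu> * f\<close> vanish (the Fourier transform of \<phi> is 0 near 0), and so do
  all coefficients of degree at most m, since \<open>\<Phi>_(-N) * f = f\<close>; the remainder is
  then f itself. Sufficiency of the coefficient condition is therefore tied to n + m + 1 \<ge> d,
  while necessity is obtained for every m by comparison with a higher degree.\<close>

abbreviation partials :: "'n::finite list \<Rightarrow> (real^'n \<Rightarrow> complex) \<Rightarrow> real^'n \<Rightarrow> complex" where
  "partials \<equiv> foldr partial_deriv"

lemma partial_derivI:
  assumes "(g has_derivative D) (at x)"
  shows "partial_deriv i g x = D (axis i 1)"
proof -
  interpret D: bounded_linear D
    using assms by (rule has_derivative_bounded_linear)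
  have "((\<lambda>t. g (x + t *\<^sub>R axis i 1)) has_derivative (\<lambda>t. D (t *\<^sub>R axis i 1))) (at 0)"
    by (rule has_derivative_compose[of "\<lambda>t. x + t *\<^sub>R axis i 1", simplified])
       (auto intro!: derivative_eq_intros assms)
  then have "((\<lambda>t. g (x + t *\<^sub>R axis i 1)) has_vector_derivative D (axis i 1)) (at 0)"
    by (simp add: has_vector_derivative_def D.scaleR)
  then show ?thesis
    unfolding partial_deriv_def by (rule vector_derivative_at)
qed

lemma has_derivative_partial_deriv:
  assumes "g differentiable (at x)"
  shows "(g has_derivative (\<lambda>h. \<Sum>i\<in>UNIV. (h $ i) *\<^sub>R partial_deriv i g x)) (at x)"
proof -
  obtain D where D: "(g has_derivative D) (at x)"
    using assms by (auto simp: differentiable_def)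
  interpret D: bounded_linear D
    using D by (rule has_derivative_bounded_linear)
  have "D h = (\<Sum>i\<in>UNIV. (h $ i) *\<^sub>R partial_deriv i g x)" for h
  proof -
    have "D h = D (\<Sum>i\<in>UNIV. (h $ i) *\<^sub>R axis i 1)"
      by (simp only: scalar_mult_eq_scaleR[symmetric] basis_expansion)
    then show ?thesis
      by (simp add: D.sum D.scaleR partial_derivI[OF D])
  qed
  then have "D = (\<lambda>h. \<Sum>i\<in>UNIV. (h $ i) *\<^sub>R partial_deriv i g x)" by auto
  with D show ?thesis by simp
qed

lemma has_vector_derivative_line:
  assumes "g differentiable (at (x + t *\<^sub>R v))"
  shows "((\<lambda>t. g (x + t *\<^sub>R v)) has_vector_derivative
           (\<Sum>i\<in>UNIV. (v $ i) *\<^sub>R partial_deriv i g (x + t *\<^sub>R v))) (at t)"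
proof -
  have "((\<lambda>t. g (x + t *\<^sub>R v)) has_derivative
      (\<lambda>s. \<Sum>i\<in>UNIV. ((s *\<^sub>R v) $ i) *\<^sub>R partial_deriv i g (x + t *\<^sub>R v))) (at t)"
    by (rule has_derivative_compose[where f = "\<lambda>t. x + t *\<^sub>R v"])
       (auto intro!: derivative_eq_intros has_derivative_partial_deriv assms)
  then show ?thesis
    by (simp add: has_vector_derivative_def scaleR_sum_right)
qed

lemma has_vector_derivative_partial:
  assumes "g differentiable (at (x + t *\<^sub>R axis i 1))"
  shows "((\<lambda>t. g (x + t *\<^sub>R axis i 1)) has_vector_derivative
           partial_deriv i g (x + t *\<^sub>R axis i 1)) (at t)"
proof -
  have "(\<Sum>j\<in>UNIV. (axis i (1::real) $ j) *\<^sub>R partial_deriv j g (x + t *\<^sub>R axis i 1)) =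
        (\<Sum>j\<in>UNIV. if j = i then partial_deriv j g (x + t *\<^sub>R axis i 1) else 0)"
    by (intro sum.cong) (auto simp: axis_def)
  then show ?thesis
    using has_vector_derivative_line[OF assms] by simp
qed

lemma norm_diff_le_vector_derivative:
  fixes h :: "real \<Rightarrow> 'a::real_normed_vector"
  assumes "0 \<le> s" and "\<And>t. 0 \<le> t \<Longrightarrow> t \<le> s \<Longrightarrow> (h has_vector_derivative h' t) (at t)"
    and "\<And>t. 0 \<le> t \<Longrightarrow> t \<le> s \<Longrightarrow> norm (h' t) \<le> B"
  shows "norm (h s - h 0) \<le> B * s"
proof -
  have "norm (h s - h 0) \<le> B * norm (s - 0)"
  proof (rule differentiable_bound[of "{0..s}" _ "\<lambda>t u. u *\<^sub>R h' t"])
    show "onorm (\<lambda>u. u *\<^sub>R h' t) \<le> B" if "t \<in> {0..s}" for t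
      using assms(3)[of t] that
      by (intro onorm_bound) (auto simp: mult.commute[of B] intro: mult_left_mono order_trans[of 0 "norm (h' t)" B])
  qed (use assms in \<open>auto simp: has_vector_derivative_def intro: has_derivative_at_withinI\<close>)
  with \<open>0 \<le> s\<close> show ?thesis by simp
qed

section \<open>Symmetry of mixed partial derivatives\<close>

lemma rectangle_estimate:
  assumes "\<And>y. g differentiable (at y)" and "\<And>y. partial_deriv i g differentiable (at y)"
    and "continuous (at x) (partial_deriv j (partial_deriv i g))" and "0 < e"
  shows "\<exists>r>0. \<forall>s. 0 < s \<and> s < r \<longrightarrow>
    norm (g (x + s *\<^sub>R axis i 1 + s *\<^sub>R axis j 1) - g (x + s *\<^sub>R axis i 1)
      - (g (x + s *\<^sub>R axis j 1) - g x) - s\<^sup>2 *\<^sub>R partial_deriv j (partial_deriv i g) x) \<le> e * s\<^sup>2"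
proof -
  define A where "A = partial_deriv j (partial_deriv i g) x"
  obtain r where r: "r > 0"
    "\<And>y. dist y x < r \<Longrightarrow> dist (partial_deriv j (partial_deriv i g) y) A < e"
    using assms(3,4) unfolding continuous_at_eps_delta A_def by blast
  have *: "norm (g (x + s *\<^sub>R axis i 1 + s *\<^sub>R axis j 1) - g (x + s *\<^sub>R axis i 1)
      - (g (x + s *\<^sub>R axis j 1) - g x) - s\<^sup>2 *\<^sub>R A) \<le> e * s\<^sup>2" if s: "0 < s" "s < r / 2" for s
  proof -
    \<comment> \<open>The mean value inequality is used twice: along direction j for the derivative
      in direction i, then along direction i for the difference of two parallel values of
      \<open>g\<close>. Subtracting the linear term with slope \<open>A\<close> makes the derivative
      small instead of merely bounded.\<close>
    have inner: "norm ((partial_deriv i g (x + t *\<^sub>R axis i 1 + s *\<^sub>R axis j 1) - s *\<^sub>R A) -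
        (partial_deriv i g (x + t *\<^sub>R axis i 1 + 0 *\<^sub>R axis j 1) - 0 *\<^sub>R A)) \<le> e * s"
      if t: "0 \<le> t" "t \<le> s" for t
    proof (rule norm_diff_le_vector_derivative[where
          h' = "\<lambda>u. partial_deriv j (partial_deriv i g) (x + t *\<^sub>R axis i 1 + u *\<^sub>R axis j 1) - A"])
      show "((\<lambda>u. partial_deriv i g (x + t *\<^sub>R axis i 1 + u *\<^sub>R axis j 1) - u *\<^sub>R A) has_vector_derivative
          partial_deriv j (partial_deriv i g) (x + t *\<^sub>R axis i 1 + u *\<^sub>R axis j 1) - A) (at u)" for u
        by (auto intro!: derivative_eq_intros has_vector_derivative_partial assms)
      show "norm (partial_deriv j (partial_deriv i g) (x + t *\<^sub>R axis i 1 + u *\<^sub>R axis j 1) - A) \<le> e"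
        if u: "0 \<le> u" "u \<le> s" for u
      proof -
        have "dist (x + t *\<^sub>R axis i 1 + u *\<^sub>R axis j 1) x \<le> norm (t *\<^sub>R axis i 1 :: real^'a) + norm (u *\<^sub>R axis j 1 :: real^'a)"
          by (simp add: dist_norm norm_triangle_ineq add.assoc del: norm_scaleR)
        also have "\<dots> < r" using u t s by simp
        finally show ?thesis using r(2) by (auto simp: dist_norm intro: less_imp_le)
      qed
    qed (use s in auto)
    have "norm ((g (x + s *\<^sub>R axis j 1 + s *\<^sub>R axis i 1) - g (x + s *\<^sub>R axis i 1) - (s * s) *\<^sub>R A)
      - (g (x + s *\<^sub>R axis j 1 + 0 *\<^sub>R axis i 1) - g (x + 0 *\<^sub>R axis i 1) - (0 * s) *\<^sub>R A)) \<le> (e * s) * s"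
    proof (rule norm_diff_le_vector_derivative[where
          h' = "\<lambda>t. partial_deriv i g (x + s *\<^sub>R axis j 1 + t *\<^sub>R axis i 1)
            - partial_deriv i g (x + t *\<^sub>R axis i 1) - s *\<^sub>R A"])
      show "((\<lambda>t. g (x + s *\<^sub>R axis j 1 + t *\<^sub>R axis i 1) - g (x + t *\<^sub>R axis i 1) - (t * s) *\<^sub>R A)
          has_vector_derivative partial_deriv i g (x + s *\<^sub>R axis j 1 + t *\<^sub>R axis i 1)
            - partial_deriv i g (x + t *\<^sub>R axis i 1) - s *\<^sub>R A) (at t)" for t
        by (auto intro!: derivative_eq_intros has_vector_derivative_partial assms)
      show "norm (partial_deriv i g (x + s *\<^sub>R axis j 1 + t *\<^sub>R axis i 1)
            - partial_deriv i g (x + t *\<^sub>R axis i 1) - s *\<^sub>R A) \<le> e * s" if "0 \<le> t" "t \<le> s" for t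
        using inner[OF that] by (simp add: algebra_simps)
    qed (use s in auto)
    then show ?thesis by (simp add: algebra_simps power2_eq_square)
  qed
  show ?thesis
    using * r(1) by (intro exI[of _ "r / 2"]) (auto simp: A_def)
qed

text \<open>The second difference of \<open>g\<close> over a square of side s does not change when
  the two directions are swapped, while \<open>rectangle_estimate\<close> compares it with either
  mixed derivative up to an error of order e s^2.\<close>

lemma partial_deriv_commute:
  assumes g: "smooth g"
  shows "partial_deriv i (partial_deriv j g) = partial_deriv j (partial_deriv i g)"
proof
  fix x
  define A where "A = partial_deriv j (partial_deriv i g) x"
  define B where "B = partial_deriv i (partial_deriv j g) x"
  have D: "partials is g differentiable (at y)" for "is" y
    using g by (simp add: smooth_def)
  have D0: "g differentiable (at y)" for y using D[of "[]"] by simp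
  have D1: "partial_deriv k g differentiable (at y)" for k y using D[of "[k]"] by simp
  have D2: "continuous (at y) (partial_deriv l (partial_deriv k g))" for k l y
    using D[of "[l, k]" y] by (simp add: differentiable_imp_continuous_within)
  have "norm (B - A) \<le> e" if "e > 0" for e
  proof -
    have e2: "e / 2 > 0" using that by simp
    obtain r1 where r1: "r1 > 0" "\<And>s. 0 < s \<Longrightarrow> s < r1 \<Longrightarrow>
        norm (g (x + s *\<^sub>R axis i 1 + s *\<^sub>R axis j 1) - g (x + s *\<^sub>R axis i 1)
      - (g (x + s *\<^sub>R axis j 1) - g x) - s\<^sup>2 *\<^sub>R A) \<le> e / 2 * s\<^sup>2"
      using rectangle_estimate[OF D0 D1 D2 e2] unfolding A_def by blast
    obtain r2 where r2: "r2 > 0" "\<And>s. 0 < s \<Longrightarrow> s < r2 \<Longrightarrow>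
        norm (g (x + s *\<^sub>R axis j 1 + s *\<^sub>R axis i 1) - g (x + s *\<^sub>R axis j 1)
      - (g (x + s *\<^sub>R axis i 1) - g x) - s\<^sup>2 *\<^sub>R B) \<le> e / 2 * s\<^sup>2"
      using rectangle_estimate[OF D0 D1 D2 e2] unfolding B_def by blast
    define s where "s = min r1 r2 / 2"
    have s: "0 < s" "s < r1" "s < r2" using r1(1) r2(1) by (auto simp: s_def)
    define R where "R = g (x + s *\<^sub>R axis i 1 + s *\<^sub>R axis j 1) - g (x + s *\<^sub>R axis i 1)
      - (g (x + s *\<^sub>R axis j 1) - g x)"
    have "norm (R - s\<^sup>2 *\<^sub>R A) \<le> e / 2 * s\<^sup>2"
      using r1(2)[OF s(1,2)] by (simp add: R_def)
    moreover have "norm (R - s\<^sup>2 *\<^sub>R B) \<le> e / 2 * s\<^sup>2"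
      using r2(2)[OF s(1,3)] by (simp add: R_def algebra_simps)
    ultimately have "norm ((R - s\<^sup>2 *\<^sub>R A) - (R - s\<^sup>2 *\<^sub>R B)) \<le> e * s\<^sup>2"
      using norm_triangle_ineq4[of "R - s\<^sup>2 *\<^sub>R A" "R - s\<^sup>2 *\<^sub>R B"] by simp
    then have "s\<^sup>2 * norm (B - A) \<le> s\<^sup>2 * e"
      by (simp add: scaleR_diff_right[symmetric] mult.commute)
    then show ?thesis using s(1) by simp
  qed
  then have "norm (B - A) \<le> 0"
    by (rule field_le_epsilon) simp
  then show "partial_deriv i (partial_deriv j g) x = partial_deriv j (partial_deriv i g) x"
    by (simp add: A_def B_def)
qed

lemma smooth_partials: "smooth g \<Longrightarrow> smooth (partials is g)"
  unfolding smooth_def by (metis foldr_append comp_apply)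

lemma partials_perm:
  assumes "smooth g" and "mset is = mset js"
  shows "partials is g = partials js g"
proof -
  \<comment> \<open>Commuting two adjacent directions moves a single entry through a whole list; a
    permutation is then resolved by extracting one entry at a time.\<close>
  have shift: "partials (xs @ [i]) g = partials (i # xs) g" if "smooth g" for xs i g
    using that
  proof (induction xs arbitrary: g)
    case (Cons k xs)
    have "partials ((k # xs) @ [i]) g = partial_deriv k (partial_deriv i (partials xs g))"
      using Cons by simp
    also have "\<dots> = partials (i # k # xs) g"
      using partial_deriv_commute[OF smooth_partials[OF Cons.prems]] by simp
    finally show ?case .
  qed simp
  show ?thesis
    using assms(2)
  proof (induction "is" arbitrary: js)
    case (Cons i "is")
    then obtain ys zs where js: "js = ys @ i # zs"
      by (metis list.set_intros(1) set_mset_mset split_list)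
    have "partials js g = partials (ys @ [i]) (partials zs g)"
      by (simp add: js)
    also have "\<dots> = partial_deriv i (partials (ys @ zs) g)"
      using shift[OF smooth_partials[OF assms(1)]] by simp
    also have "partials (ys @ zs) g = partials is g"
      using Cons.prems by (intro Cons.IH[symmetric]) (simp add: js)
    finally show ?case by simp
  qed simp
qed

section \<open>Multi-indices as lists of directions\<close>

definition mi_list :: "'n::finite multi_index \<Rightarrow> 'n list" where
  "mi_list \<alpha> = (SOME is. \<forall>i. count_list is i = \<alpha> i)"

lemma count_list_eq_count_mset: "count_list xs x = count (mset xs) x"
  by (induction xs) auto

lemma count_mi_list: "count_list (mi_list \<alpha>) i = \<alpha> i"
proof -
  \<comment> \<open>Over a finite index type every function has finite support, hence is the
    multiplicity function of a multiset; this shows that the choice behind \<open>mi_list\<close> is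
    from a nonempty set.\<close>
  obtain xs where "mset xs = Abs_multiset \<alpha>"
    using ex_mset by blast
  then have "\<forall>i. count_list xs i = \<alpha> i"
    by (simp add: count_list_eq_count_mset)
  then have "\<forall>i. count_list (mi_list \<alpha>) i = \<alpha> i"
    unfolding mi_list_def by (rule someI)
  then show ?thesis by simp
qed

lemma mi_deriv_eq: "mi_deriv \<alpha> g = partials (mi_list \<alpha>) g"
  by (simp add: mi_deriv_def mi_list_def)

lemma mi_size_count_list: "mi_size (count_list is) = length is"
  unfolding mi_size_def by (rule sum_count_set) auto

lemma length_mi_list: "length (mi_list \<alpha>) = mi_size \<alpha>"
  by (metis count_mi_list mi_size_count_list ext)

lemma mi_deriv_list:
  assumes "smooth g"
  shows "partials is g = mi_deriv (count_list is) g"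
  unfolding mi_deriv_eq
  by (intro partials_perm[OF assms] multiset_eqI)
     (simp add: count_mi_list flip: count_list_eq_count_mset)

lemma schwartz_smooth: "schwartz g \<Longrightarrow> smooth g"
  by (simp add: schwartz_def)

lemma norm_mi_D: "norm (mi_D \<alpha> g x) = norm (mi_deriv \<alpha> g x)"
  by (simp add: mi_D_def norm_mult norm_power)

text \<open>Lists of directions replace multi-indices from here on: applying one more partial
  derivative is then just \<open>Cons\<close>, which suits induction. The two descriptions agree
  because mixed derivatives commute.\<close>

lemma schwartz_iff:
  "schwartz g \<longleftrightarrow> (\<forall>is x. partials is g differentiable (at x)) \<and>
     (\<forall>is k. \<exists>C. \<forall>x. (1 + norm x) ^ k * norm (partials is g x) \<le> C)"
  (is "_ \<longleftrightarrow> ?D \<and> ?B")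
proof
  assume g: "schwartz g"
  have "\<exists>C. \<forall>x. (1 + norm x) ^ k * norm (partials is g x) \<le> C" for k "is"
    using g unfolding mi_deriv_list[OF schwartz_smooth[OF g]]
    by (auto simp: schwartz_def norm_mi_D bdd_above_def)
  then show "?D \<and> ?B"
    using g by (auto simp: schwartz_def smooth_def)
next
  assume "?D \<and> ?B"
  then show "schwartz g"
    by (auto simp: schwartz_def smooth_def norm_mi_D bdd_above_def mi_deriv_eq)
qed

text \<open>The Schwartz class is the largest class of differentiable, rapidly decreasing functions
  that is closed under partial derivatives. Membership is later shown by exhibiting such a class,
  which avoids Leibniz formulas for higher derivatives.\<close>

lemma schwartz_coinduct [consumes 1, case_names differentiable bounded partial]:
  assumes "Q g"
    and "\<And>g x. Q g \<Longrightarrow> g differentiable (at x)"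
    and "\<And>g k. Q g \<Longrightarrow> \<exists>C. \<forall>x. (1 + norm x) ^ k * norm (g x) \<le> C"
    and "\<And>g i. Q g \<Longrightarrow> Q (partial_deriv i g)"
  shows "schwartz g"
proof -
  have "Q (partials is g)" for "is"
    by (induction "is") (auto intro: assms)
  then show ?thesis
    unfolding schwartz_iff using assms(2,3) by blast
qed

lemma schwartz_differentiable: "schwartz g \<Longrightarrow> g differentiable (at x)"
  unfolding schwartz_iff by (metis foldr_Nil id_apply)

lemma schwartz_bounded:
  assumes "schwartz g"
  obtains C where "C \<ge> 0" and "\<And>x. (1 + norm x) ^ k * norm (g x) \<le> C"
proof -
  obtain C where "\<forall>x. (1 + norm x) ^ k * norm (g x) \<le> C"
    using assms unfolding schwartz_iff by (metis foldr_Nil id_apply)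
  moreover from this[rule_format, of 0] have "C \<ge> 0"
    by (rule order_trans[rotated]) auto
  ultimately show thesis using that by blast
qed

lemma schwartz_partials: "schwartz g \<Longrightarrow> schwartz (partials is g)"
  unfolding schwartz_iff by (metis foldr_append comp_apply)

lemma schwartz_partial_deriv: "schwartz g \<Longrightarrow> schwartz (partial_deriv i g)"
  using schwartz_partials[of g "[i]"] by simp

lemma schwartz_mi_deriv: "schwartz g \<Longrightarrow> schwartz (mi_deriv \<alpha> g)"
  by (simp add: mi_deriv_eq schwartz_partials)

lemma schwartz_continuous: "schwartz g \<Longrightarrow> continuous_on S g"
  by (meson continuous_at_imp_continuous_on differentiable_imp_continuous_within schwartz_differentiable)

lemma schwartz_borel [measurable (raw)]: "schwartz g \<Longrightarrow> g \<in> borel_measurable borel"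
  by (intro borel_measurable_continuous_onI schwartz_continuous)

section \<open>Closure properties of the Schwartz class\<close>

lemma partial_deriv_lincomb:
  assumes "g differentiable (at x)" and "h differentiable (at x)"
  shows "partial_deriv i (\<lambda>x. a * g x + b * h x) x = a * partial_deriv i g x + b * partial_deriv i h x"
proof -
  have "((\<lambda>x. a * g x + b * h x) has_derivative
     (\<lambda>v. a * (\<Sum>i\<in>UNIV. (v $ i) *\<^sub>R partial_deriv i g x) + b * (\<Sum>i\<in>UNIV. (v $ i) *\<^sub>R partial_deriv i h x))) (at x)"
    by (intro derivative_intros has_derivative_partial_deriv assms)
  from partial_derivI[OF this, of i]
  show ?thesis
    using partial_derivI[OF has_derivative_partial_deriv[OF assms(1)], of i]
      partial_derivI[OF has_derivative_partial_deriv[OF assms(2)], of i] by simp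
qed

lemma schwartz_lincomb:
  assumes "schwartz g" and "schwartz h"
  shows "schwartz (\<lambda>x. a * g x + b * h x)"
proof -
  have "\<exists>g' h'. schwartz g' \<and> schwartz h' \<and> (\<lambda>x. a * g x + b * h x) = (\<lambda>x. a * g' x + b * h' x)"
    using assms by blast
  then show ?thesis
  proof (coinduct rule: schwartz_coinduct[where Q = "\<lambda>f. \<exists>g h. schwartz g \<and> schwartz h \<and> f = (\<lambda>x. a * g x + b * h x)"])
    case (differentiable f x)
    then obtain g h where f: "schwartz g" "schwartz h" "f = (\<lambda>x. a * g x + b * h x)" by blast
    show ?case
      unfolding f(3) by (intro derivative_intros schwartz_differentiable f)
  next
    case (bounded f k)
    then obtain g h where f: "schwartz g" "schwartz h" "f = (\<lambda>x. a * g x + b * h x)" by blast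
    obtain C where C: "\<And>x. (1 + norm x) ^ k * norm (g x) \<le> C" using schwartz_bounded[OF f(1)] by metis
    obtain D where D: "\<And>x. (1 + norm x) ^ k * norm (h x) \<le> D" using schwartz_bounded[OF f(2)] by metis
    have "(1 + norm x) ^ k * norm (f x) \<le> norm a * C + norm b * D" for x
    proof -
      have "(1 + norm x) ^ k * norm (f x) \<le> (1 + norm x) ^ k * (norm a * norm (g x) + norm b * norm (h x))"
        by (intro mult_left_mono) (auto simp: f norm_mult[symmetric] norm_triangle_ineq)
      also have "\<dots> = norm a * ((1 + norm x) ^ k * norm (g x)) + norm b * ((1 + norm x) ^ k * norm (h x))"
        by (simp add: algebra_simps)
      also have "\<dots> \<le> norm a * C + norm b * D"
        by (intro add_mono mult_left_mono C D) auto
      finally show ?thesis .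
    qed
    then show ?case by blast
  next
    case (partial f i)
    then obtain g h where f: "schwartz g" "schwartz h" "f = (\<lambda>x. a * g x + b * h x)" by blast
    have "partial_deriv i f = (\<lambda>x. a * partial_deriv i g x + b * partial_deriv i h x)"
      unfolding f using f by (intro ext partial_deriv_lincomb schwartz_differentiable)
    then show ?case using f schwartz_partial_deriv by blast
  qed
qed

lemma schwartz_add: "schwartz g \<Longrightarrow> schwartz h \<Longrightarrow> schwartz (\<lambda>x. g x + h x)"
  using schwartz_lincomb[of g h 1 1] by simp

lemma schwartz_diff: "schwartz g \<Longrightarrow> schwartz h \<Longrightarrow> schwartz (\<lambda>x. g x - h x)"
  using schwartz_lincomb[of g h 1 "-1"] by simp

lemma schwartz_cmult: "schwartz g \<Longrightarrow> schwartz (\<lambda>x. c * g x)"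
  using schwartz_lincomb[of g g c 0] by simp

lemma schwartz_zero: "schwartz (\<lambda>x::real^'n::finite. 0)"
proof -
  have "partial_deriv i (\<lambda>x::real^'n. 0) = (\<lambda>x. 0)" for i
    by (intro ext partial_derivI[of _ "\<lambda>_. 0"]) auto
  then show ?thesis
    by (intro schwartz_coinduct[where Q = "\<lambda>f. f = (\<lambda>x::real^'n. 0)"]) auto
qed

lemma schwartz_sum: "finite A \<Longrightarrow> (\<And>a. a \<in> A \<Longrightarrow> schwartz (g a)) \<Longrightarrow> schwartz (\<lambda>x. \<Sum>a\<in>A. g a x)"
  by (induction rule: finite_induct) (auto intro: schwartz_zero schwartz_add)

lemma partials_lincomb:
  assumes "schwartz g" "schwartz h"
  shows "partials is (\<lambda>x. a * g x + b * h x) =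
    (\<lambda>x. a * partials is g x + b * partials is h x)"
proof (induction "is")
  case (Cons i "is")
  show ?case
    unfolding foldr.simps comp_apply Cons
    by (intro ext partial_deriv_lincomb schwartz_differentiable schwartz_partials assms)
qed auto

lemma partials_sum:
  fixes g :: "'a \<Rightarrow> real^'b \<Rightarrow> complex"
  assumes "finite A" "\<And>a. a \<in> A \<Longrightarrow> schwartz (g a)"
  shows "partials is (\<lambda>x. \<Sum>a\<in>A. c a * g a x) = (\<lambda>x. \<Sum>a\<in>A. c a * partials is (g a) x)"
  using assms
proof (induction A rule: finite_induct)
  case empty
  have "partials is (\<lambda>x::real^'b. 0) = (\<lambda>x. 0)"
    using partials_lincomb[OF schwartz_zero schwartz_zero, where a = 0 and b = 0] by simp
  then show ?case by simp
next
  case (insert a A)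
  have "schwartz (\<lambda>x. \<Sum>a\<in>A. c a * g a x)"
    using insert by (intro schwartz_sum schwartz_cmult) auto
  then show ?case
    using insert partials_lincomb[of "g a" "\<lambda>x. \<Sum>a\<in>A. c a * g a x" "is" "c a" 1] by simp
qed

lemma partial_deriv_affine:
  assumes "g differentiable (at (a *\<^sub>R x + b))"
  shows "partial_deriv i (\<lambda>x. g (a *\<^sub>R x + b)) x = of_real a * partial_deriv i g (a *\<^sub>R x + b)"
proof -
  have "((\<lambda>x. g (a *\<^sub>R x + b)) has_derivative
     (\<lambda>v. \<Sum>i\<in>UNIV. ((a *\<^sub>R v) $ i) *\<^sub>R partial_deriv i g (a *\<^sub>R x + b))) (at x)"
    by (rule has_derivative_compose[where f = "\<lambda>x. a *\<^sub>R x + b"])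
       (auto intro!: derivative_eq_intros has_derivative_partial_deriv assms)
  from partial_derivI[OF this, of i] partial_derivI[OF has_derivative_partial_deriv[OF assms], of i]
  show ?thesis
    by (simp add: scaleR_conv_of_real[where 'a = complex] sum_distrib_left mult.assoc)
qed

text \<open>Submultiplicativity of the weight, a form of Peetre's inequality. It moves polynomial
  weights from one variable to another in all estimates of convolutions.\<close>

lemma norm_weight_le: "1 + norm (x + y) \<le> (1 + norm x) * (1 + norm (y::'a::real_normed_vector))"
proof -
  have "1 + norm (x + y) \<le> 1 + (norm x + norm y) + norm x * norm y"
    using norm_triangle_ineq[of x y] by (simp add: add_increasing2)
  then show ?thesis by (simp add: algebra_simps)
qed

text \<open>The class used for coinduction carries a free scalar factor, because every
  differentiation produces a factor \<open>a\<close>.\<close>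

lemma schwartz_affine:
  assumes "schwartz g" and "a \<noteq> 0"
  shows "schwartz (\<lambda>x. g (a *\<^sub>R x + b))"
proof -
  have "\<exists>h c. schwartz h \<and> (\<lambda>x. g (a *\<^sub>R x + b)) = (\<lambda>x. c * h (a *\<^sub>R x + b))"
    by (intro exI[of _ g] exI[of _ 1]) (auto simp: assms)
  then show ?thesis
  proof (coinduct rule: schwartz_coinduct[where Q = "\<lambda>f. \<exists>h c. schwartz h \<and> f = (\<lambda>x. c * h (a *\<^sub>R x + b))"])
    case (differentiable f x)
    then obtain h c where f: "schwartz h" "f = (\<lambda>x. c * h (a *\<^sub>R x + b))" by blast
    have "(\<lambda>x. h (a *\<^sub>R x + b)) differentiable (at x)"
      using differentiable_chain_at[of "\<lambda>x. a *\<^sub>R x + b" x h] schwartz_differentiable[OF f(1)]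
      by (auto simp: o_def intro!: derivative_intros)
    then show ?case unfolding f by (intro derivative_intros)
  next
    case (bounded f k)
    then obtain h c where f: "schwartz h" "f = (\<lambda>x. c * h (a *\<^sub>R x + b))" by blast
    obtain C where C: "\<And>x. (1 + norm x) ^ k * norm (h x) \<le> C" using schwartz_bounded[OF f(1)] by metis
    \<comment> \<open>From a x = (a x + b) - b and \<open>norm_weight_le\<close>: the weight at x is
      at most \<open>M\<close> times the weight at a x + b.\<close>
    define M where "M = (1 + 1 / \<bar>a\<bar>) * (1 + norm b)"
    have "(1 + norm x) ^ k * norm (f x) \<le> norm c * (M ^ k * C)" for x
    proof -
      have "norm x = norm ((a *\<^sub>R x + b) + (- b)) / \<bar>a\<bar>"
        using assms(2) by simp
      also have "1 + \<dots> \<le> (1 + 1 / \<bar>a\<bar>) * (1 + norm ((a *\<^sub>R x + b) + (- b)))"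
        using mult_nonneg_nonneg[of "1 / \<bar>a\<bar>" "norm ((a *\<^sub>R x + b) + (- b))"]
        by (simp add: distrib_left distrib_right add_increasing del: add_uminus_conv_diff add_diff_cancel_right' norm_scaleR)
      also have "\<dots> \<le> (1 + 1 / \<bar>a\<bar>) * ((1 + norm (a *\<^sub>R x + b)) * (1 + norm b))"
        using norm_weight_le[of "a *\<^sub>R x + b" "- b"] by (intro mult_left_mono) auto
      finally have "1 + norm x \<le> M * (1 + norm (a *\<^sub>R x + b))"
        by (simp add: M_def mult_ac)
      then have "(1 + norm x) ^ k \<le> (M * (1 + norm (a *\<^sub>R x + b))) ^ k"
        by (intro power_mono) auto
      then have "(1 + norm x) ^ k * norm (f x) \<le> (M * (1 + norm (a *\<^sub>R x + b))) ^ k * norm (f x)"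
        by (rule mult_right_mono) simp
      also have "\<dots> = norm c * (M ^ k * ((1 + norm (a *\<^sub>R x + b)) ^ k * norm (h (a *\<^sub>R x + b))))"
        by (simp add: f norm_mult power_mult_distrib mult_ac)
      also have "\<dots> \<le> norm c * (M ^ k * C)"
        by (intro mult_left_mono C) (auto simp: M_def)
      finally show ?thesis .
    qed
    then show ?case by blast
  next
    case (partial f i)
    then obtain h c where f: "schwartz h" "f = (\<lambda>x. c * h (a *\<^sub>R x + b))" by blast
    have "(\<lambda>x. h (a *\<^sub>R x + b)) differentiable (at x)" for x
      using differentiable_chain_at[of "\<lambda>x. a *\<^sub>R x + b" x h] schwartz_differentiable[OF f(1)]
      by (auto simp: o_def intro!: derivative_intros)
    then have "partial_deriv i f x = c * (of_real a * partial_deriv i h (a *\<^sub>R x + b))" for x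
      unfolding f(2) using partial_deriv_lincomb[of "\<lambda>x. h (a *\<^sub>R x + b)" x "\<lambda>x. h (a *\<^sub>R x + b)" i c 0]
      by (simp add: partial_deriv_affine schwartz_differentiable[OF f(1)])
    then have "partial_deriv i f = (\<lambda>x. (c * of_real a) * partial_deriv i h (a *\<^sub>R x + b))"
      by (auto simp: mult.assoc)
    then show ?case using f(1) schwartz_partial_deriv by blast
  qed
qed

lemma partials_affine:
  assumes "schwartz g" and "a \<noteq> 0"
  shows "partials is (\<lambda>x. c * g (a *\<^sub>R x + b)) =
    (\<lambda>x. c * of_real a ^ length is * partials is g (a *\<^sub>R x + b))"
proof (induction "is")
  case (Cons i "is")
  let ?h = "partials is g"
  have h: "schwartz ?h" by (rule schwartz_partials[OF assms(1)])
  have d: "(\<lambda>x. ?h (a *\<^sub>R x + b)) differentiable (at x)" for x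
    by (intro schwartz_differentiable schwartz_affine h assms)
  show ?case
    unfolding foldr.simps comp_apply Cons
    using partial_deriv_lincomb[OF d d, where i = i and a = "c * of_real a ^ length is" and b = 0]
    by (simp add: partial_deriv_affine schwartz_differentiable[OF h] mult_ac)
qed auto

text \<open>Functions of the form x_i g alone are not visibly closed under differentiation, since a
  derivative of x_i g also contains g. The coinduction runs over all x_i g + h with Schwartz g and
  h.\<close>

lemma schwartz_nth_mult:
  assumes "schwartz g"
  shows "schwartz (\<lambda>x. of_real (x $ i) * g x)"
    and "partial_deriv j (\<lambda>x. of_real (x $ i) * g x) =
      (\<lambda>x. of_real (x $ i) * partial_deriv j g x + (if i = j then g x else 0))"
proof -
  let ?Q = "\<lambda>f. \<exists>g h. schwartz g \<and> schwartz h \<and> f = (\<lambda>x::real^'a. of_real (x $ i) * g x + h x)"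
  have der: "((\<lambda>x. of_real (x $ i) * g x + h x) has_derivative (\<lambda>v. of_real (x $ i) * (\<Sum>j\<in>UNIV. (v $ j) *\<^sub>R partial_deriv j g x)
      + of_real (v $ i) * g x + (\<Sum>j\<in>UNIV. (v $ j) *\<^sub>R partial_deriv j h x))) (at x)"
    if "schwartz g" "schwartz h" for g h :: "real^'a \<Rightarrow> complex" and x
  proof -
    have "((\<lambda>x::real^'a. complex_of_real (x $ i)) has_derivative (\<lambda>v. complex_of_real (v $ i))) (at x)"
      by (intro bounded_linear_imp_has_derivative bounded_linear_compose[OF bounded_linear_of_real bounded_linear_vec_nth])
    then show ?thesis
      using that
      by (intro has_derivative_add has_derivative_mult has_derivative_partial_deriv schwartz_differentiable)
  qed
  have par: "partial_deriv j (\<lambda>x. of_real (x $ i) * g x + h x) =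
      (\<lambda>x. of_real (x $ i) * partial_deriv j g x + ((if i = j then g x else 0) + partial_deriv j h x))"
    if gh: "schwartz g" "schwartz h" for g h :: "real^'a \<Rightarrow> complex" and j
  proof
    fix x
    note S = partial_derivI[OF has_derivative_partial_deriv[OF schwartz_differentiable], of _ j x, symmetric]
    show "partial_deriv j (\<lambda>x. of_real (x $ i) * g x + h x) x =
       of_real (x $ i) * partial_deriv j g x + ((if i = j then g x else 0) + partial_deriv j h x)"
      using partial_derivI[OF der[OF gh], of j x] S[OF gh(1)] S[OF gh(2)] by (simp add: axis_def)
  qed
  show "schwartz (\<lambda>x. of_real (x $ i) * g x)"
  proof (rule schwartz_coinduct[where Q = ?Q])
    show "?Q (\<lambda>x. of_real (x $ i) * g x)"
      using schwartz_zero assms by (intro exI[of _ g] exI[of _ "\<lambda>x. 0"]) auto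
    show "f differentiable (at x)" if "?Q f" for f x
      using that der by (auto simp: differentiable_def)
    show "\<exists>C. \<forall>x. (1 + norm x) ^ k * norm (f x) \<le> C" if "?Q f" for f k
    proof -
      from that obtain g h where f: "schwartz g" "schwartz h" "f = (\<lambda>x. of_real (x $ i) * g x + h x)" by blast
      obtain C where C: "\<And>x. (1 + norm x) ^ Suc k * norm (g x) \<le> C" using schwartz_bounded[OF f(1)] by metis
      obtain D where D: "\<And>x. (1 + norm x) ^ k * norm (h x) \<le> D" using schwartz_bounded[OF f(2)] by metis
      have "(1 + norm x) ^ k * norm (f x) \<le> C + D" for x
      proof -
        have "norm (f x) \<le> \<bar>x $ i\<bar> * norm (g x) + norm (h x)"
          using norm_triangle_ineq[of "of_real (x $ i) * g x" "h x"] by (simp add: f norm_mult)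
        also have "\<dots> \<le> (1 + norm x) * norm (g x) + norm (h x)"
          using component_le_norm_cart[of x i] by (intro add_mono mult_right_mono) auto
        finally have "(1 + norm x) ^ k * norm (f x) \<le> (1 + norm x) ^ k * ((1 + norm x) * norm (g x) + norm (h x))"
          by (rule mult_left_mono) auto
        also have "\<dots> = (1 + norm x) ^ Suc k * norm (g x) + (1 + norm x) ^ k * norm (h x)"
          by (simp add: algebra_simps)
        also have "\<dots> \<le> C + D" by (intro add_mono C D)
        finally show ?thesis .
      qed
      then show ?thesis by blast
    qed
    show "?Q (partial_deriv j f)" if "?Q f" for f j
    proof -
      from that obtain g h where f: "schwartz g" "schwartz h" "f = (\<lambda>x. of_real (x $ i) * g x + h x)" by blast
      have "schwartz (\<lambda>x. (if i = j then g x else 0) + partial_deriv j h x)"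
        using f by (cases "i = j") (auto intro: schwartz_add schwartz_partial_deriv)
      then show ?thesis
        unfolding f(3) par[OF f(1,2)] using schwartz_partial_deriv[OF f(1)] by blast
    qed
  qed
  show "partial_deriv j (\<lambda>x. of_real (x $ i) * g x) =
      (\<lambda>x. of_real (x $ i) * partial_deriv j g x + (if i = j then g x else 0))"
  proof -
    have "partial_deriv j (\<lambda>x::real^'a. 0) = (\<lambda>x. 0)"
      by (intro ext partial_derivI[of _ "\<lambda>_. 0"]) auto
    then show ?thesis using par[OF assms schwartz_zero, of j] by simp
  qed
qed

section \<open>Taylor expansion\<close>

lemma mi_size_upd: "mi_size (\<alpha>(i := Suc (\<alpha> i))) = Suc (mi_size \<alpha>)"
  unfolding mi_size_def by (subst (1 2) sum.remove[of UNIV i]) (auto intro!: sum.cong)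

lemma mi_fact_upd: "mi_fact (\<alpha>(i := Suc (\<alpha> i))) = Suc (\<alpha> i) * mi_fact \<alpha>"
proof -
  have "(\<Prod>j\<in>UNIV - {i}. fact ((\<alpha>(i := Suc (\<alpha> i))) j)) = (\<Prod>j\<in>UNIV - {i}. fact (\<alpha> j) :: nat)"
    by (intro prod.cong) auto
  then show ?thesis
    unfolding mi_fact_def by (subst (1 2) prod.remove[of UNIV i]) (auto simp: algebra_simps)
qed

lemma mi_power_upd: "mi_power v (\<alpha>(i := Suc (\<alpha> i))) = v $ i * mi_power v \<alpha>"
proof -
  have "(\<Prod>j\<in>UNIV - {i}. v $ j ^ (\<alpha>(i := Suc (\<alpha> i))) j) = (\<Prod>j\<in>UNIV - {i}. v $ j ^ \<alpha> j)"
    by (intro prod.cong) auto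
  then show ?thesis
    unfolding mi_power_def by (subst (1 2) prod.remove[of UNIV i]) (auto simp: algebra_simps)
qed

lemma mi_fact_pos: "mi_fact \<alpha> > 0"
  unfolding mi_fact_def by (intro prod_pos) auto

lemma mi_fact_nonzero [simp]: "mi_fact \<alpha> \<noteq> 0"
  using mi_fact_pos[of \<alpha>] by simp

lemma finite_mi_size_le: "finite {\<alpha>::'n::finite multi_index. mi_size \<alpha> \<le> k}"
proof (rule finite_subset)
  show "{\<alpha>::'n multi_index. mi_size \<alpha> \<le> k} \<subseteq> PiE UNIV (\<lambda>_. {..k})"
  proof clarify
    fix \<alpha> :: "'n multi_index" assume "mi_size \<alpha> \<le> k"
    moreover have "\<alpha> i \<le> mi_size \<alpha>" for i
      unfolding mi_size_def by (rule member_le_sum) auto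
    ultimately show "\<alpha> \<in> PiE UNIV (\<lambda>_. {..k})"
      by (auto intro: order_trans)
  qed
qed (auto intro: finite_PiE)

lemma finite_mi_size_less: "finite {\<alpha>::'n::finite multi_index. mi_size \<alpha> < k}"
  by (rule finite_subset[OF _ finite_mi_size_le[of k]]) auto

lemma finite_mi_size_eq: "finite {\<alpha>::'n::finite multi_index. mi_size \<alpha> = k}"
  by (rule finite_subset[OF _ finite_mi_size_le[of k]]) auto

lemma abs_mi_power_le: "\<bar>mi_power v \<alpha>\<bar> \<le> norm (v::real^'n::finite) ^ mi_size \<alpha>"
proof -
  have "\<bar>mi_power v \<alpha>\<bar> = (\<Prod>i\<in>UNIV. \<bar>v $ i\<bar> ^ \<alpha> i)"
    by (simp add: mi_power_def abs_prod power_abs)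
  also have "\<dots> \<le> (\<Prod>i\<in>UNIV. norm v ^ \<alpha> i)"
    by (intro prod_mono conjI power_mono component_le_norm_cart) auto
  also have "\<dots> = norm v ^ mi_size \<alpha>"
    by (simp add: power_sum mi_size_def)
  finally show ?thesis .
qed

lemma partial_deriv_mi_deriv:
  assumes "smooth g"
  shows "partial_deriv i (mi_deriv \<alpha> g) = mi_deriv (\<alpha>(i := Suc (\<alpha> i))) g"
proof -
  have "partial_deriv i (mi_deriv \<alpha> g) = partials (i # mi_list \<alpha>) g"
    by (simp add: mi_deriv_eq)
  also have "\<dots> = mi_deriv (count_list (i # mi_list \<alpha>)) g"
    by (rule mi_deriv_list[OF assms])
  also have "count_list (i # mi_list \<alpha>) = \<alpha>(i := Suc (\<alpha> i))"
    by (auto simp: count_mi_list)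
  finally show ?thesis .
qed

definition zero_mi :: "'n::finite multi_index" where "zero_mi = (\<lambda>_. 0)"

lemma mi_size_0_iff: "mi_size \<alpha> = 0 \<longleftrightarrow> \<alpha> = zero_mi"
  by (auto simp: mi_size_def zero_mi_def)

lemma mi_zero [simp]: "mi_size zero_mi = 0" "mi_fact zero_mi = 1" "mi_power v zero_mi = 1"
  by (simp_all add: mi_size_def mi_fact_def mi_power_def zero_mi_def)

lemma mi_deriv_zero [simp]: "mi_deriv zero_mi g = g"
proof -
  have "mi_list (zero_mi :: 'a multi_index) = []"
    using length_mi_list[of "zero_mi :: 'a multi_index"] by simp
  then show ?thesis by (simp add: mi_deriv_eq)
qed

definition dir_deriv :: "real^'n::finite \<Rightarrow> (real^'n \<Rightarrow> complex) \<Rightarrow> real^'n \<Rightarrow> complex" where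
  "dir_deriv v g x = (\<Sum>i\<in>UNIV. of_real (v $ i) * partial_deriv i g x)"

lemma schwartz_dir_deriv: "schwartz g \<Longrightarrow> schwartz (dir_deriv v g)"
  unfolding dir_deriv_def by (intro schwartz_sum schwartz_cmult schwartz_partial_deriv) auto

lemma schwartz_dir_deriv_pow: "schwartz g \<Longrightarrow> schwartz ((dir_deriv v ^^ k) g)"
  by (induction k) (auto intro: schwartz_dir_deriv)

text \<open>The multinomial theorem for the operator v . grad, whose components commute on smooth
  functions. In the induction a multi-index of size k + 1 is reached from every i with
  \<open>\<alpha> i > 0\<close>, with weight \<open>\<alpha> i / Suc k\<close>; these weights sum to
  1.\<close>

lemma dir_deriv_pow:
  assumes "schwartz g"
  shows "(dir_deriv v ^^ k) g x =
    (\<Sum>\<alpha> | mi_size \<alpha> = k. of_real (fact k / mi_fact \<alpha> * mi_power v \<alpha>) * mi_deriv \<alpha> g x)"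
proof (induction k arbitrary: x)
  case 0
  then show ?case by (simp add: mi_size_0_iff)
next
  case (Suc k)
  define c where "c k \<alpha> = complex_of_real (fact k / mi_fact \<alpha> * mi_power v \<alpha>)" for k \<alpha>
  let ?S = "\<lambda>k. {\<alpha>::'a multi_index. mi_size \<alpha> = k}"
  have step: "c k \<alpha> * of_real (v $ i) = of_real (real (Suc (\<alpha> i)) / real (Suc k)) * c (Suc k) (\<alpha>(i := Suc (\<alpha> i)))" for \<alpha> i
  proof -
    have "q / F * P * w = a / b * (b * q / (a * F) * (w * P))" if "a \<noteq> 0" "b \<noteq> 0" for q F P w a b :: real
      using that by simp
    from this[of "real (Suc (\<alpha> i))" "real (Suc k)" "fact k" "real (mi_fact \<alpha>)" "mi_power v \<alpha>" "v $ i"]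
    show ?thesis
      unfolding c_def mi_fact_upd mi_power_upd of_real_mult[symmetric] of_real_eq_iff
      by (simp only: of_nat_mult fact_Suc)
  qed
  have IH: "(dir_deriv v ^^ k) g = (\<lambda>x. \<Sum>\<alpha>\<in>?S k. c k \<alpha> * mi_deriv \<alpha> g x)"
    using Suc by (auto simp: c_def)
  have "partial_deriv i ((dir_deriv v ^^ k) g) = (\<lambda>x. \<Sum>\<alpha>\<in>?S k. c k \<alpha> * mi_deriv (\<alpha>(i := Suc (\<alpha> i))) g x)" for i
    unfolding IH
    using partials_sum[of "?S k" "\<lambda>\<alpha>. mi_deriv \<alpha> g" "[i]" "c k"] assms
    by (simp add: finite_mi_size_eq schwartz_mi_deriv partial_deriv_mi_deriv schwartz_smooth)
  then have "(dir_deriv v ^^ Suc k) g x =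
      (\<Sum>i\<in>UNIV. \<Sum>\<alpha>\<in>?S k. c k \<alpha> * of_real (v $ i) * mi_deriv (\<alpha>(i := Suc (\<alpha> i))) g x)"
    by (simp add: dir_deriv_def sum_distrib_left mult_ac)
  also have "\<dots> = (\<Sum>i\<in>UNIV. \<Sum>\<alpha>\<in>{\<alpha>\<in>?S (Suc k). \<alpha> i > 0}. of_real (\<alpha> i / Suc k) * c (Suc k) \<alpha> * mi_deriv \<alpha> g x)"
  proof (rule sum.cong[OF refl])
    fix i :: 'a
    have *: "mi_size (\<alpha>(i := \<alpha> i - Suc 0)) = k" if "mi_size \<alpha> = Suc k" "0 < \<alpha> i" for \<alpha> :: "'a multi_index"
      using mi_size_upd[of "\<alpha>(i := \<alpha> i - 1)" i] that by simp
    show "(\<Sum>\<alpha>\<in>?S k. c k \<alpha> * of_real (v $ i) * mi_deriv (\<alpha>(i := Suc (\<alpha> i))) g x) =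
      (\<Sum>\<alpha>\<in>{\<alpha>\<in>?S (Suc k). \<alpha> i > 0}. of_real (\<alpha> i / Suc k) * c (Suc k) \<alpha> * mi_deriv \<alpha> g x)"
      by (rule sum.reindex_bij_witness[where i = "\<lambda>\<alpha>. \<alpha>(i := \<alpha> i - 1)" and j = "\<lambda>\<alpha>. \<alpha>(i := Suc (\<alpha> i))"])
         (auto simp: mi_size_upd step * add.commute)
  qed
  also have "\<dots> = (\<Sum>i\<in>UNIV. \<Sum>\<alpha>\<in>?S (Suc k). of_real (\<alpha> i / Suc k) * c (Suc k) \<alpha> * mi_deriv \<alpha> g x)"
    by (intro sum.cong[OF refl] sum.mono_neutral_left) (auto simp: finite_mi_size_eq)
  also have "\<dots> = (\<Sum>\<alpha>\<in>?S (Suc k). (\<Sum>i\<in>UNIV. of_real (\<alpha> i / Suc k)) * c (Suc k) \<alpha> * mi_deriv \<alpha> g x)"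
    by (subst sum.swap) (simp add: sum_distrib_right)
  also have "\<dots> = (\<Sum>\<alpha>\<in>?S (Suc k). c (Suc k) \<alpha> * mi_deriv \<alpha> g x)"
  proof (intro sum.cong refl)
    fix \<alpha> :: "'a multi_index" assume "\<alpha> \<in> ?S (Suc k)"
    then have "(\<Sum>i\<in>UNIV. real (\<alpha> i)) = Suc k"
      by (simp add: mi_size_def flip: of_nat_sum)
    then have "(\<Sum>i\<in>UNIV. real (\<alpha> i) / Suc k) = 1"
      by (simp only: sum_divide_distrib[symmetric]) simp
    then have "(\<Sum>i\<in>UNIV. complex_of_real (\<alpha> i / Suc k)) = 1"
      by (simp only: of_real_sum[symmetric] of_real_1)
    then show "(\<Sum>i\<in>UNIV. complex_of_real (\<alpha> i / Suc k)) * c (Suc k) \<alpha> * mi_deriv \<alpha> g x = c (Suc k) \<alpha> * mi_deriv \<alpha> g x"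
      by simp
  qed
  finally show ?case by (simp add: c_def)
qed

text \<open>The family \<open>h\<close> lists a function together with all its derivatives, so the
  induction on \<open>p\<close> passes to the shifted family \<open>\<lambda>k. h (Suc k)\<close>.
  The factor 1 / p! of the sharp remainder is given up: since \<open>s \<le> 1\<close>, the bound
  \<open>B\<close> survives each step unchanged.\<close>

lemma norm_taylor_remainder_le:
  fixes h :: "nat \<Rightarrow> real \<Rightarrow> complex"
  assumes "\<And>k t. (h k has_vector_derivative h (Suc k) t) (at t)"
    and "\<And>t. 0 \<le> t \<Longrightarrow> t \<le> 1 \<Longrightarrow> norm (h p t) \<le> B" and "0 \<le> s" "s \<le> 1"
  shows "norm (h 0 s - (\<Sum>k<p. of_real (s ^ k / fact k) * h k 0)) \<le> B"
  using assms
proof (induction p arbitrary: h s)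
  case (Suc p)
  let ?R = "\<lambda>s. h 0 s - (\<Sum>k<Suc p. of_real (s ^ k / fact k) * h k 0)"
  have "norm (?R s - ?R 0) \<le> B * s"
  proof (rule norm_diff_le_vector_derivative[where
        h' = "\<lambda>s. h (Suc 0) s - (\<Sum>k<p. of_real (s ^ k / fact k) * h (Suc k) 0)"])
    show "norm (h (Suc 0) t - (\<Sum>k<p. of_real (t ^ k / fact k) * h (Suc k) 0)) \<le> B"
      if "0 \<le> t" "t \<le> s" for t
      using Suc.IH[of "\<lambda>k. h (Suc k)" t] Suc.prems that by simp
    show "(?R has_vector_derivative h (Suc 0) t - (\<Sum>k<p. of_real (t ^ k / fact k) * h (Suc k) 0)) (at t)" for t
    proof -
      have "((\<lambda>s. complex_of_real (s ^ k / fact k)) has_vector_derivative of_real (of_nat k * t ^ (k - 1) / fact k)) (at t)" for k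
      proof -
        have "((\<lambda>s. s ^ k / fact k) has_real_derivative of_nat k * t ^ (k - 1) / fact k) (at t)"
          using DERIV_pow[of k t UNIV] by (intro DERIV_cdivide) simp
        then show ?thesis
          by (intro has_vector_derivative_of_real) (simp add: has_real_derivative_iff_has_vector_derivative)
      qed
      then have "(?R has_vector_derivative h (Suc 0) t - (\<Sum>k<Suc p. of_real (of_nat k * t ^ (k - 1) / fact k) * h k 0)) (at t)"
        by (intro has_vector_derivative_diff has_vector_derivative_sum has_vector_derivative_mult_left Suc.prems)
      also have "(\<Sum>k<Suc p. of_real (of_nat k * t ^ (k - 1) / fact k) * h k 0) =
          (\<Sum>k<p. of_real (t ^ k / fact k) * h (Suc k) 0)"
        by (subst sum.lessThan_Suc_shift) (simp add: field_simps del: of_nat_Suc)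
      finally show ?thesis .
    qed
  qed (use Suc.prems in auto)
  moreover have "?R 0 = 0"
    by (subst sum.lessThan_Suc_shift) simp
  moreover have "B \<ge> 0"
    using Suc.prems(2)[of 0] by (auto intro: order_trans[OF norm_ge_zero])
  then have "B * s \<le> B"
    using Suc.prems(4) by (rule mult_right_le_one_le[OF _ Suc.prems(3)])
  ultimately show ?case by simp
qed simp

lemma taylor_sum_eq:
  assumes "schwartz g"
  shows "(\<Sum>k<p. of_real (1 / fact k) * (dir_deriv v ^^ k) g z) =
    (\<Sum>\<alpha> | mi_size \<alpha> < p. of_real (mi_power v \<alpha> / mi_fact \<alpha>) * mi_deriv \<alpha> g z)"
proof -
  have "(\<Sum>k<p. of_real (1 / fact k) * (dir_deriv v ^^ k) g z) =
     (\<Sum>k<p. \<Sum>\<alpha> | \<alpha> \<in> {\<alpha>. mi_size \<alpha> < p} \<and> mi_size \<alpha> = k. of_real (mi_power v \<alpha> / mi_fact \<alpha>) * mi_deriv \<alpha> g z)"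
  proof (intro sum.cong refl)
    fix k assume k: "k \<in> {..<p}"
    have "of_real (1 / fact k) * (dir_deriv v ^^ k) g z =
        (\<Sum>\<alpha> | mi_size \<alpha> = k. of_real (mi_power v \<alpha> / mi_fact \<alpha>) * mi_deriv \<alpha> g z)"
      unfolding dir_deriv_pow[OF assms] sum_distrib_left
      by (intro sum.cong refl) (simp add: field_simps)
    also have "{\<alpha>::'a multi_index. mi_size \<alpha> = k} = {\<alpha>. \<alpha> \<in> {\<alpha>. mi_size \<alpha> < p} \<and> mi_size \<alpha> = k}"
      using k by auto
    finally show "of_real (1 / fact k) * (dir_deriv v ^^ k) g z =
      (\<Sum>\<alpha> | \<alpha> \<in> {\<alpha>. mi_size \<alpha> < p} \<and> mi_size \<alpha> = k. of_real (mi_power v \<alpha> / mi_fact \<alpha>) * mi_deriv \<alpha> g z)" .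
  qed
  also have "\<dots> = (\<Sum>\<alpha> | mi_size \<alpha> < p. of_real (mi_power v \<alpha> / mi_fact \<alpha>) * mi_deriv \<alpha> g z)"
    by (rule sum.group) (auto simp: finite_mi_size_less)
  finally show ?thesis .
qed

text \<open>The decay is measured at the base point z although the remainder involves derivatives on
  the whole segment to z + v; \<open>norm_weight_le\<close> transfers the weight at the cost of (1 +
  |v|)^k. Decay at the base point is what later survives integration over the increment.\<close>

lemma schwartz_taylor:
  assumes "schwartz g"
  obtains C where "C \<ge> 0" and "\<And>z v. (1 + norm z) ^ k *
    norm (g (z + v) - (\<Sum>j<p. of_real (1 / fact j) * (dir_deriv v ^^ j) g z)) \<le> C * norm v ^ p * (1 + norm v) ^ k"
proof -
  have "\<exists>C. C \<ge> 0 \<and> (\<forall>x. (1 + norm x) ^ k * norm (mi_deriv \<alpha> g x) \<le> C)" for \<alpha>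
    using schwartz_bounded[OF schwartz_mi_deriv[OF assms]] by metis
  then obtain K where K: "\<And>\<alpha>. K \<alpha> \<ge> 0" "\<And>\<alpha> x. (1 + norm x) ^ k * norm (mi_deriv \<alpha> g x) \<le> K \<alpha>"
    by metis
  define C where "C = (\<Sum>\<alpha> | mi_size \<alpha> = p. fact p / mi_fact \<alpha> * K \<alpha>)"
  have C: "C \<ge> 0" unfolding C_def by (intro sum_nonneg mult_nonneg_nonneg K) auto
  moreover have "(1 + norm z) ^ k *
    norm (g (z + v) - (\<Sum>j<p. of_real (1 / fact j) * (dir_deriv v ^^ j) g z)) \<le> C * norm v ^ p * (1 + norm v) ^ k" for z v
  proof -
    define h where "h j t = (dir_deriv v ^^ j) g (z + t *\<^sub>R v)" for j t
    have "norm (h p t) \<le> C * norm v ^ p * (1 + norm v) ^ k / (1 + norm z) ^ k" if t: "0 \<le> t" "t \<le> 1" for t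
    proof -
      let ?w = "z + t *\<^sub>R v"
      have "1 + norm (?w + (- t *\<^sub>R v)) \<le> (1 + norm ?w) * (1 + norm (- t *\<^sub>R v))"
        by (rule norm_weight_le)
      also have "\<dots> \<le> (1 + norm ?w) * (1 + norm v)"
        using t by (intro mult_left_mono) (auto intro: mult_left_le_one_le)
      finally have "(1 + norm z) ^ k \<le> ((1 + norm ?w) * (1 + norm v)) ^ k"
        by (intro power_mono) auto
      moreover have "(1 + norm ?w) ^ k * norm (h p t) \<le> C * norm v ^ p"
      proof -
        have "(1 + norm ?w) ^ k * norm (h p t) \<le> (1 + norm ?w) ^ k *
           (\<Sum>\<alpha> | mi_size \<alpha> = p. fact p / mi_fact \<alpha> * norm v ^ p * norm (mi_deriv \<alpha> g ?w))"
          unfolding h_def dir_deriv_pow[OF assms]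
        proof (intro mult_left_mono sum_norm_le)
          fix \<alpha> :: "'a multi_index" assume "\<alpha> \<in> {\<alpha>. mi_size \<alpha> = p}"
          then show "norm (of_real (fact p / mi_fact \<alpha> * mi_power v \<alpha>) * mi_deriv \<alpha> g ?w)
             \<le> fact p / mi_fact \<alpha> * norm v ^ p * norm (mi_deriv \<alpha> g ?w)"
            using abs_mi_power_le[of v \<alpha>]
            by (auto simp: norm_mult norm_divide norm_power abs_mult intro!: mult_right_mono mult_left_mono divide_right_mono)
        qed auto
        also have "\<dots> = (\<Sum>\<alpha> | mi_size \<alpha> = p. fact p / mi_fact \<alpha> * norm v ^ p * ((1 + norm ?w) ^ k * norm (mi_deriv \<alpha> g ?w)))"
          by (simp add: sum_distrib_left mult_ac)
        also have "\<dots> \<le> (\<Sum>\<alpha> | mi_size \<alpha> = p. fact p / mi_fact \<alpha> * norm v ^ p * K \<alpha>)"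
          by (intro sum_mono mult_left_mono K) auto
        also have "\<dots> = C * norm v ^ p"
          by (simp add: C_def sum_distrib_left sum_distrib_right mult_ac)
        finally show ?thesis .
      qed
      ultimately have "(1 + norm z) ^ k * norm (h p t) \<le> ((1 + norm ?w) * (1 + norm v)) ^ k * norm (h p t)"
        by (intro mult_right_mono) auto
      also have "\<dots> = (1 + norm v) ^ k * ((1 + norm ?w) ^ k * norm (h p t))"
        by (simp add: power_mult_distrib)
      also have "\<dots> \<le> (1 + norm v) ^ k * (C * norm v ^ p)"
        by (intro mult_left_mono \<open>(1 + norm ?w) ^ k * norm (h p t) \<le> C * norm v ^ p\<close>) auto
      finally show ?thesis
        by (simp add: pos_le_divide_eq add_pos_nonneg mult_ac)
    qed
    moreover have "(h j has_vector_derivative h (Suc j) t) (at t)" for j t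
    proof -
      have "(h j has_vector_derivative (\<Sum>i\<in>UNIV. v $ i *\<^sub>R partial_deriv i ((dir_deriv v ^^ j) g) (z + t *\<^sub>R v))) (at t)"
        unfolding h_def
        by (intro has_vector_derivative_line schwartz_differentiable schwartz_dir_deriv_pow assms)
      then show ?thesis
        by (simp add: h_def dir_deriv_def scaleR_conv_of_real)
    qed
    ultimately have "norm (h 0 1 - (\<Sum>j<p. of_real (1 ^ j / fact j) * h j 0)) \<le> C * norm v ^ p * (1 + norm v) ^ k / (1 + norm z) ^ k"
      by (intro norm_taylor_remainder_le) auto
    then show ?thesis
      by (simp add: h_def pos_le_divide_eq add_pos_nonneg mult_ac)
  qed
  ultimately show thesis using that by blast
qed

lemma finite_bound_exists:
  assumes "finite A" and "\<And>a. a \<in> A \<Longrightarrow> \<exists>C\<ge>0. \<forall>x. F a x \<le> C * (G x :: real)" and "\<And>x. G x \<ge> 0"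
  shows "\<exists>C\<ge>0. \<forall>a\<in>A. \<forall>x. F a x \<le> C * G x"
proof -
  obtain K where K: "\<And>a. a \<in> A \<Longrightarrow> K a \<ge> 0 \<and> (\<forall>x. F a x \<le> K a * G x)"
    using assms(2) by metis
  show ?thesis
  proof (intro exI[of _ "sum K A"] conjI ballI allI)
    show "sum K A \<ge> 0" using K by (intro sum_nonneg) auto
    fix a x assume a: "a \<in> A"
    then have "F a x \<le> K a * G x" using K by blast
    also have "\<dots> \<le> sum K A * G x"
      using K a assms(1,3) by (intro mult_right_mono member_le_sum) auto
    finally show "F a x \<le> sum K A * G x" .
  qed
qed

lemma finite_lists_le: "finite {is::'n::finite list. length is \<le> d}"
  using finite_lists_length_le[of "UNIV :: 'n set" d] by simp

lemma schwartz_bounded_lists: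
  assumes "schwartz g"
  obtains C where "C \<ge> 0"
    and "\<And>is x. length is \<le> d \<Longrightarrow> (1 + norm x) ^ k * norm (partials is g x) \<le> C"
proof -
  have "\<exists>C\<ge>0. \<forall>is\<in>{is. length is \<le> d}. \<forall>x. (1 + norm x) ^ k * norm (partials is g x) \<le> C * 1"
  proof (intro finite_bound_exists finite_lists_le)
    show "\<exists>C\<ge>0. \<forall>x. (1 + norm x) ^ k * norm (partials is g x) \<le> C * 1" for "is"
      using schwartz_bounded[OF schwartz_partials[OF assms], of k "is"] by (metis mult_1_right)
  qed auto
  then show thesis using that by auto
qed

lemma schwartz_taylor_lists:
  assumes "schwartz g"
  obtains C where "C \<ge> 0" and "\<And>is z v. length is \<le> d \<Longrightarrow> (1 + norm z) ^ k *
    norm (partials is g (z + v) - (\<Sum>j<p. of_real (1 / fact j) * (dir_deriv v ^^ j) (partials is g) z))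
      \<le> C * norm v ^ p * (1 + norm v) ^ k"
proof -
  have "\<exists>C\<ge>0. \<forall>is\<in>{is. length is \<le> d}. \<forall>zv. (1 + norm (fst zv)) ^ k *
    norm (partials is g (fst zv + snd zv) - (\<Sum>j<p. of_real (1 / fact j) * (dir_deriv (snd zv) ^^ j) (partials is g) (fst zv)))
      \<le> C * (norm (snd zv) ^ p * (1 + norm (snd zv)) ^ k)"
  proof (intro finite_bound_exists finite_lists_le)
    show "\<exists>C\<ge>0. \<forall>zv. (1 + norm (fst zv)) ^ k *
    norm (partials is g (fst zv + snd zv) - (\<Sum>j<p. of_real (1 / fact j) * (dir_deriv (snd zv) ^^ j) (partials is g) (fst zv)))
      \<le> C * (norm (snd zv) ^ p * (1 + norm (snd zv)) ^ k)" for "is"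
      by (rule schwartz_taylor[OF schwartz_partials[OF assms], of k "is" p]) (auto simp: mult.assoc)
  qed auto
  then show thesis using that by (auto simp: mult.assoc)
qed

text \<open>A substitute for differentiation under a functional or under an integral sign: a
  quadratic bound on the remainder yields differentiability and the values of the partial
  derivatives at once, with no interchange of limits.\<close>

lemma quadratic_remainder_derivative:
  fixes G :: "real^'n::finite \<Rightarrow> complex"
  assumes "\<And>h. norm (G (x + h) - G x - (\<Sum>i\<in>UNIV. of_real (h $ i) * c i)) \<le> K * norm h ^ 2 * (1 + norm h) ^ d"
  shows "G differentiable (at x)" and "partial_deriv i G x = c i"
proof -
  let ?D = "\<lambda>h::real^'n. \<Sum>i\<in>UNIV. of_real (h $ i) * c i"
  have "(G has_derivative ?D) (at x)"
    unfolding has_derivative_at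
  proof
    show "bounded_linear ?D"
      by (intro bounded_linear_sum bounded_linear_mult_left[THEN bounded_linear_compose]
          bounded_linear_compose[OF bounded_linear_of_real bounded_linear_vec_nth])
    show "(\<lambda>h. norm (G (x + h) - G x - ?D h) / norm h) \<midarrow>0\<rightarrow> 0"
    proof (rule Lim_null_comparison)
      show "\<forall>\<^sub>F h in at 0. norm (norm (G (x + h) - G x - ?D h) / norm h) \<le> K * norm h * (1 + norm h) ^ d"
      proof (intro always_eventually allI)
        fix h
        show "norm (norm (G (x + h) - G x - ?D h) / norm h) \<le> K * norm h * (1 + norm h) ^ d"
          using assms[of h] by (cases "h = 0") (auto simp: divide_le_eq power2_eq_square mult_ac)
      qed
      have "((\<lambda>h::real^'n. K * norm h * (1 + norm h) ^ d) \<longlongrightarrow> K * norm (0::real^'n) * (1 + norm (0::real^'n)) ^ d) (at 0)"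
        by (intro tendsto_intros)
      then show "((\<lambda>h::real^'n. K * norm h * (1 + norm h) ^ d) \<longlongrightarrow> 0) (at 0)" by simp
    qed
  qed
  then show "G differentiable (at x)" and "partial_deriv i G x = c i"
    by (auto simp: differentiable_def partial_derivI axis_def if_distrib[of of_real] if_distrib[of "\<lambda>x. x * _"] cong: if_cong)
qed

section \<open>Convolution with functionals of finite order\<close>

text \<open>Boundedness is phrased with any common bound \<open>B\<close> for the weighted
  derivatives of order at most \<open>d\<close>, so that no suprema have to be handled. The locale
  covers \<open>f\<close> as well as integration against a function of polynomial growth.\<close>

locale tempered_functional =
  fixes u :: "'n::finite functional" and d :: nat and c :: real
  assumes lincomb: "schwartz \<psi> \<Longrightarrow> schwartz \<theta> \<Longrightarrow> u (\<lambda>x. a * \<psi> x + b * \<theta> x) = a * u \<psi> + b * u \<theta>"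
    and bounded: "schwartz \<psi> \<Longrightarrow>
      (\<And>is x. length is \<le> d \<Longrightarrow> (1 + norm x) ^ d * norm (partials is \<psi> x) \<le> B) \<Longrightarrow>
      norm (u \<psi>) \<le> c * B"
    and nonneg: "c \<ge> 0"
begin

lemma zero: "u (\<lambda>x. 0) = 0"
  using lincomb[OF schwartz_zero schwartz_zero, of 0 0] by simp

lemma cmult: "schwartz \<psi> \<Longrightarrow> u (\<lambda>x. a * \<psi> x) = a * u \<psi>"
  using lincomb[of \<psi> \<psi> a 0] by simp

lemma diff: "schwartz \<psi> \<Longrightarrow> schwartz \<theta> \<Longrightarrow> u (\<lambda>x. \<psi> x - \<theta> x) = u \<psi> - u \<theta>"
  using lincomb[of \<psi> \<theta> 1 "-1"] by simp

lemma sum: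
  "finite A \<Longrightarrow> (\<And>k. k \<in> A \<Longrightarrow> schwartz (\<psi> k)) \<Longrightarrow> u (\<lambda>x. \<Sum>k\<in>A. a k * \<psi> k x) = (\<Sum>k\<in>A. a k * u (\<psi> k))"
proof (induction A rule: finite_induct)
  case (insert k A)
  have "u (\<lambda>x. a k * \<psi> k x + 1 * (\<Sum>k\<in>A. a k * \<psi> k x)) = a k * u (\<psi> k) + 1 * u (\<lambda>x. \<Sum>k\<in>A. a k * \<psi> k x)"
    using insert by (intro lincomb schwartz_sum schwartz_cmult) auto
  then show ?case using insert by simp
qed (simp add: zero)

end

lemma schwartz_reflect: "schwartz g \<Longrightarrow> schwartz (\<lambda>y. g (x - y))"
  using schwartz_affine[of g "-1" x] by (simp add: diff_conv_add_uminus add.commute del: add_uminus_conv_diff)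

lemma partials_reflect:
  "schwartz g \<Longrightarrow> partials is (\<lambda>y. g (x - y)) = (\<lambda>y. (- 1) ^ length is * partials is g (x - y))"
  using partials_affine[of g "-1" "is" 1 x]
  by (simp add: diff_conv_add_uminus add.commute del: add_uminus_conv_diff)

context tempered_functional
begin

lemma conv_dist_bounded:
  assumes "schwartz g"
  obtains C where "C \<ge> 0" and "\<And>x. norm (conv_dist g u x) \<le> C * (1 + norm x) ^ d"
proof -
  obtain K where K: "K \<ge> 0" "\<And>is x. length is \<le> d \<Longrightarrow> (1 + norm x) ^ d * norm (partials is g x) \<le> K"
    by (rule schwartz_bounded_lists[OF assms]) (rule that)
  have "norm (conv_dist g u x) \<le> c * (K * (1 + norm x) ^ d)" for x
    unfolding conv_dist_def
  proof (rule bounded[OF schwartz_reflect[OF assms]])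
    fix "is" :: "'n list" and y assume "is": "length is \<le> d"
    have "(1 + norm (x - (x - y))) ^ d \<le> ((1 + norm x) * (1 + norm (x - y))) ^ d"
      using norm_weight_le[of x "- (x - y)"] by (intro power_mono) (auto simp: norm_minus_commute)
    then have "(1 + norm y) ^ d * norm (partials is (\<lambda>y. g (x - y)) y)
       \<le> ((1 + norm x) * (1 + norm (x - y))) ^ d * norm (partials is g (x - y))"
      by (simp add: partials_reflect[OF assms] norm_mult norm_power mult_right_mono)
    also have "\<dots> = ((1 + norm (x - y)) ^ d * norm (partials is g (x - y))) * (1 + norm x) ^ d"
      by (simp add: power_mult_distrib)
    also have "\<dots> \<le> K * (1 + norm x) ^ d"
      by (intro mult_right_mono K "is") auto
    finally show "(1 + norm y) ^ d * norm (partials is (\<lambda>y. g (x - y)) y) \<le> K * (1 + norm x) ^ d" .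
  qed
  then show thesis
    using that[of "c * K"] nonneg K(1) by (simp add: mult.assoc)
qed

text \<open>The Taylor remainder of \<open>g\<close> at x - y is a Schwartz function of y and is
  inserted into \<open>u\<close>. Its seminorm is controlled by
  \<open>schwartz_taylor_lists\<close>; moving the weight from y to x - y costs (1 + |x|)^d.\<close>

lemma conv_dist_taylor:
  assumes "schwartz g"
  obtains C where "C \<ge> 0" and "\<And>x h. norm (conv_dist g u (x + h) -
     (\<Sum>j<p. of_real (1 / fact j) * conv_dist ((dir_deriv h ^^ j) g) u x))
       \<le> C * norm h ^ p * (1 + norm h) ^ d * (1 + norm x) ^ d"
proof -
  obtain K where K: "K \<ge> 0" "\<And>is z v. length is \<le> d \<Longrightarrow> (1 + norm z) ^ d *
    norm (partials is g (z + v) - (\<Sum>j<p. of_real (1 / fact j) * (dir_deriv v ^^ j) (partials is g) z))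
      \<le> K * norm v ^ p * (1 + norm v) ^ d"
    by (rule schwartz_taylor_lists[OF assms]) (rule that)
  \<comment> \<open>Hence every derivative of the Taylor remainder of \<open>g\<close> is, up to
    sign, the Taylor remainder of the same derivative of \<open>g\<close>.\<close>
  have comm: "partials is ((dir_deriv h ^^ j) g) = (dir_deriv h ^^ j) (partials is g)" for "is" h j
  proof (induction j)
    case (Suc j)
    define G where "G = (dir_deriv h ^^ j) g"
    have G: "schwartz G" unfolding G_def by (rule schwartz_dir_deriv_pow[OF assms])
    have "dir_deriv h G = (\<lambda>x. \<Sum>i\<in>UNIV. of_real (h $ i) * partial_deriv i G x)"
      by (rule ext) (rule dir_deriv_def)
    then have "partials is (dir_deriv h G) = (\<lambda>x. \<Sum>i\<in>UNIV. of_real (h $ i) * partials is (partial_deriv i G) x)"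
      using partials_sum[of UNIV "\<lambda>i. partial_deriv i G" "is"] G
      by (simp add: schwartz_partial_deriv)
    also have "partials is (partial_deriv i G) = partial_deriv i (partials is G)" for i
      using partials_perm[of G "is @ [i]" "i # is"] G
      by (simp add: schwartz_smooth)
    then have "(\<lambda>x. \<Sum>i\<in>UNIV. of_real (h $ i) * partials is (partial_deriv i G) x) = dir_deriv h (partials is G)"
      by (auto simp: dir_deriv_def)
    finally show ?case
      using Suc by (simp add: G_def)
  qed simp
  have "norm (conv_dist g u (x + h) - (\<Sum>j<p. of_real (1 / fact j) * conv_dist ((dir_deriv h ^^ j) g) u x))
       \<le> c * (K * norm h ^ p * (1 + norm h) ^ d * (1 + norm x) ^ d)" for x h
  proof -
    let ?s = "\<lambda>y. \<Sum>j<p. of_real (1 / fact j) * (dir_deriv h ^^ j) g (x - y)"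
    have s1: "schwartz (\<lambda>y. g (x + h - y))" by (rule schwartz_reflect[OF assms])
    have s2: "schwartz (\<lambda>y. (dir_deriv h ^^ j) g (x - y))" for j
      by (intro schwartz_reflect schwartz_dir_deriv_pow assms)
    have s3: "schwartz ?s" by (intro schwartz_sum schwartz_cmult s2) auto
    have "norm (u (\<lambda>y. g (x + h - y) - ?s y)) \<le> c * (K * norm h ^ p * (1 + norm h) ^ d * (1 + norm x) ^ d)"
    proof (rule bounded[OF schwartz_diff[OF s1 s3]])
      fix "is" :: "'n list" and y assume "is": "length is \<le> d"
      have "(1 + norm (x - (x - y))) ^ d \<le> ((1 + norm x) * (1 + norm (x - y))) ^ d"
        using norm_weight_le[of x "- (x - y)"] by (intro power_mono) (auto simp: norm_minus_commute)
      moreover have "partials is (\<lambda>y. g (x + h - y) - ?s y) y =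
         (-1) ^ length is * (partials is g ((x - y) + h) -
           (\<Sum>j<p. of_real (1 / fact j) * (dir_deriv h ^^ j) (partials is g) (x - y)))"
      proof -
        have "partials is (\<lambda>y. g (x + h - y) - ?s y) =
            (\<lambda>y. partials is (\<lambda>y. g (x + h - y)) y - partials is ?s y)"
          using partials_lincomb[OF s1 s3, of "is" 1 "-1"] by simp
        also have "partials is ?s = (\<lambda>y. \<Sum>j<p. of_real (1 / fact j) * partials is (\<lambda>y. (dir_deriv h ^^ j) g (x - y)) y)"
          by (intro partials_sum s2) auto
        finally show ?thesis
          by (simp add: partials_reflect assms schwartz_dir_deriv_pow comm
              right_diff_distrib sum_distrib_left mult_ac algebra_simps)
      qed
      ultimately have "(1 + norm y) ^ d * norm (partials is (\<lambda>y. g (x + h - y) - ?s y) y)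
          \<le> ((1 + norm x) * (1 + norm (x - y))) ^ d * norm (partials is g ((x - y) + h) -
           (\<Sum>j<p. of_real (1 / fact j) * (dir_deriv h ^^ j) (partials is g) (x - y)))"
        by (simp add: norm_mult norm_power mult_right_mono)
      also have "\<dots> = ((1 + norm (x - y)) ^ d * norm (partials is g ((x - y) + h) -
           (\<Sum>j<p. of_real (1 / fact j) * (dir_deriv h ^^ j) (partials is g) (x - y)))) * (1 + norm x) ^ d"
        by (simp add: power_mult_distrib)
      also have "\<dots> \<le> K * norm h ^ p * (1 + norm h) ^ d * (1 + norm x) ^ d"
        by (intro mult_right_mono K "is") auto
      finally show "(1 + norm y) ^ d * norm (partials is (\<lambda>y. g (x + h - y) - ?s y) y)
         \<le> K * norm h ^ p * (1 + norm h) ^ d * (1 + norm x) ^ d" .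
    qed
    then show ?thesis
      using diff[OF s1 s3] sum[of "{..<p}" "\<lambda>j y. (dir_deriv h ^^ j) g (x - y)" "\<lambda>j. of_real (1 / fact j)"] s2
      by (simp add: conv_dist_def)
  qed
  then show thesis
    using that[of "c * K"] nonneg K(1) by (simp add: mult.assoc)
qed

text \<open>The case p = 2 of \<open>conv_dist_taylor\<close>: the terms of order 0 and 1 remain,
  and the error is quadratic in h.\<close>

lemma conv_dist_derivative:
  assumes "schwartz g"
  shows "conv_dist g u differentiable (at x)"
    and "partial_deriv i (conv_dist g u) = conv_dist (partial_deriv i g) u"
proof -
  obtain C where C: "\<And>x h. norm (conv_dist g u (x + h) -
     (\<Sum>j<2. of_real (1 / fact j) * conv_dist ((dir_deriv h ^^ j) g) u x))
       \<le> C * norm h ^ 2 * (1 + norm h) ^ d * (1 + norm x) ^ d"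
    by (rule conv_dist_taylor[OF assms]) (rule that)
  have lin: "conv_dist (dir_deriv h g) u x = (\<Sum>i\<in>UNIV. of_real (h $ i) * conv_dist (partial_deriv i g) u x)" for h x
    unfolding conv_dist_def dir_deriv_def
    by (intro sum) (auto intro: schwartz_reflect schwartz_partial_deriv assms)
  have *: "norm (conv_dist g u (x + h) - conv_dist g u x - (\<Sum>i\<in>UNIV. of_real (h $ i) * conv_dist (partial_deriv i g) u x))
     \<le> (C * (1 + norm x) ^ d) * norm h ^ 2 * (1 + norm h) ^ d" for x h
    using C[of x h] by (simp add: numeral_2_eq_2 lin diff_diff_eq mult_ac)
  show "conv_dist g u differentiable (at x)"
    by (rule quadratic_remainder_derivative(1)[OF *])
  show "partial_deriv i (conv_dist g u) = conv_dist (partial_deriv i g) u"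
    by (rule ext, rule quadratic_remainder_derivative(2)[OF *])
qed

lemma partials_conv_dist:
  "schwartz g \<Longrightarrow> partials is (conv_dist g u) = conv_dist (partials is g) u"
  by (induction "is") (auto simp: conv_dist_derivative schwartz_partials)

end

section \<open>Integrals against Schwartz functions\<close>

lemma integrable_inverse_one_plus_square: "integrable lborel (\<lambda>x::real. 1 / (1 + x\<^sup>2))"
proof -
  let ?f = "\<lambda>x::real. 1 / (1 + x\<^sup>2)"
  have pos: "integrable lborel (\<lambda>x. indicator {0<..} x *\<^sub>R ?f x)"
    using integrable_I0i_1_div_plus_square
    by (simp add: interval_lebesgue_integrable_def set_integrable_def einterval_def zero_ereal_def greaterThan_def)
  have "integrable lborel (\<lambda>x. indicator {0<..} (0 + (-1) * x) *\<^sub>R ?f (0 + (-1) * x))"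
    by (rule lborel_integrable_real_affine[OF pos]) simp
  then have "integrable lborel (\<lambda>x. indicator {0<..} x *\<^sub>R ?f x + indicator {0<..} (-x) *\<^sub>R ?f x)"
    using pos by simp
  moreover have "AE x in lborel. indicator {0<..} x *\<^sub>R ?f x + indicator {0<..} (-x) *\<^sub>R ?f x = ?f x"
    using AE_lborel_singleton[of "0::real"] by eventually_elim (auto simp: indicator_def)
  ultimately show ?thesis
    by (subst integrable_cong_AE[symmetric]) auto
qed

text \<open>\<open>lborel\<close> is the image of a product of copies of Lebesgue measure on the
  line. The lemma serves the integrability of \<open>decay\<close> and the Gaussian
  integrals.\<close>

lemma lborel_integral_prod:
  fixes f :: "'a::euclidean_space \<Rightarrow> real \<Rightarrow> 'b::{real_normed_field,banach,second_countable_topology}"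
  assumes int: "\<And>b. b \<in> Basis \<Longrightarrow> integrable lborel (f b)"
  shows "integrable lborel (\<lambda>x::'a. \<Prod>b\<in>Basis. f b (x \<bullet> b))"
    and "(LINT x|lborel. (\<Prod>b\<in>Basis. f b (x \<bullet> b))) = (\<Prod>b\<in>Basis. (LINT t|lborel. f b t))"
proof -
  interpret product_sigma_finite "\<lambda>b::'a. lborel :: real measure" by standard
  let ?T = "\<lambda>g::'a \<Rightarrow> real. \<Sum>b\<in>Basis. g b *\<^sub>R b"
  have [measurable]: "f b \<in> borel_measurable borel" if "b \<in> Basis" for b
    using int[OF that] by (auto dest: borel_measurable_integrable)
  have [measurable]: "?T \<in> measurable (PiM Basis (\<lambda>b. lborel)) borel"
    by measurable
  have meas: "(\<lambda>x::'a. \<Prod>b\<in>Basis. f b (x \<bullet> b)) \<in> borel_measurable borel"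
    by measurable
  have eq: "(\<Prod>b\<in>Basis. f b (?T g \<bullet> b)) = (\<Prod>b\<in>Basis. f b (g b))" for g
    by (intro prod.cong refl) simp
  show "integrable lborel (\<lambda>x::'a. \<Prod>b\<in>Basis. f b (x \<bullet> b))"
    by (subst lborel_eq) (simp add: integrable_distr_eq[OF _ meas] eq product_integrable_prod int)
  show "(LINT x|lborel. (\<Prod>b\<in>Basis. f b (x \<bullet> b))) = (\<Prod>b\<in>Basis. (LINT t|lborel. f b t))"
    by (subst lborel_eq) (simp add: integral_distr[OF _ meas] eq product_integral_prod int)
qed

lemma lborel_integral_affine:
  fixes f :: "'a::euclidean_space \<Rightarrow> 'b::{banach,second_countable_topology}"
  assumes [measurable]: "f \<in> borel_measurable borel" and "c \<noteq> 0"
  shows "(LINT x|lborel. f x) = \<bar>c\<bar> ^ DIM('a) *\<^sub>R (LINT x|lborel. f (t + c *\<^sub>R x))"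
  by (subst lborel_affine[OF \<open>c \<noteq> 0\<close>, of t]) (simp add: integral_density integral_distr)

lemma lborel_integral_reflect:
  fixes f :: "'a::euclidean_space \<Rightarrow> 'b::{banach,second_countable_topology}"
  assumes "f \<in> borel_measurable borel"
  shows "(LINT x|lborel. f (t - x)) = (LINT x|lborel. f x)"
  using lborel_integral_affine[OF assms, of "-1" t] by simp

text \<open>With this exponent \<open>decay\<close> is dominated by the product of the functions \<open>1 / (1 + x\<^sub>i\<^sup>2)\<close>.\<close>

abbreviation decay :: "real^'n::finite \<Rightarrow> real" where
  "decay x \<equiv> 1 / (1 + norm x) ^ (2 * CARD('n))"

lemma integrable_decay: "integrable lborel (decay :: real^'n::finite \<Rightarrow> real)"
proof (rule Bochner_Integration.integrable_bound)
  show "integrable lborel (\<lambda>x::real^'n. \<Prod>b\<in>Basis. 1 / (1 + (x \<bullet> b)\<^sup>2))"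
    by (intro lborel_integral_prod(1) integrable_inverse_one_plus_square)
  show "AE x::real^'n in lborel. norm (decay x) \<le> norm (\<Prod>b\<in>Basis. 1 / (1 + (x \<bullet> b)\<^sup>2))"
  proof (intro AE_I2)
    fix x :: "real^'n"
    have pos: "0 < 1 + (x \<bullet> b)\<^sup>2" for b
      by (simp add: add_pos_nonneg)
    have "(\<Prod>b\<in>(Basis::(real^'n) set). 1 + (x \<bullet> b)\<^sup>2) \<le> (\<Prod>b\<in>(Basis::(real^'n) set). (1 + norm x)\<^sup>2)"
    proof (intro prod_mono conjI)
      fix b :: "real^'n" assume "b \<in> Basis"
      then have "(x \<bullet> b)\<^sup>2 \<le> (norm x)\<^sup>2"
        using Basis_le_norm[of b x] by (simp add: abs_le_square_iff[symmetric])
      then show "1 + (x \<bullet> b)\<^sup>2 \<le> (1 + norm x)\<^sup>2"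
        using norm_ge_zero[of x] by (simp add: power2_sum del: norm_ge_zero)
    qed (use pos in \<open>auto intro: less_imp_le\<close>)
    also have "\<dots> = (1 + norm x) ^ (2 * CARD('n))"
      by (simp add: power_mult)
    finally have "1 / (1 + norm x) ^ (2 * CARD('n)) \<le> 1 / (\<Prod>b\<in>(Basis::(real^'n) set). 1 + (x \<bullet> b)\<^sup>2)"
      by (intro divide_left_mono mult_pos_pos prod_pos pos) (auto simp: add_pos_nonneg)
    then show "norm (decay x) \<le> norm (\<Prod>b\<in>Basis. 1 / (1 + (x \<bullet> b)\<^sup>2))"
      using pos by (simp add: prod_dividef abs_of_pos prod_pos)
  qed
qed simp

lemma integrable_poly_mult:
  fixes w :: "real^'n::finite \<Rightarrow> complex"
  assumes "w \<in> borel_measurable borel" and "\<And>x. norm (w x) \<le> K * (1 + norm x) ^ k" and "schwartz g"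
  shows "integrable lborel (\<lambda>x. w x * g x)"
proof -
  obtain C where C: "\<And>x. (1 + norm x) ^ (k + 2 * CARD('n)) * norm (g x) \<le> C"
    by (rule schwartz_bounded[OF assms(3)]) (rule that)
  show ?thesis
  proof (rule Bochner_Integration.integrable_bound)
    show "integrable lborel (\<lambda>x::real^'n. K * C * decay x)"
      using integrable_decay by (rule integrable_mult_right)
    show "AE x in lborel. norm (w x * g x) \<le> norm (K * C * decay x)"
    proof (intro AE_I2)
      fix x :: "real^'n"
      have K: "K \<ge> 0" using assms(2)[of 0] by (auto intro: order_trans[OF norm_ge_zero])
      have "norm (w x * g x) \<le> K * (1 + norm x) ^ k * norm (g x)"
        unfolding norm_mult by (intro mult_right_mono assms) auto
      also have "\<dots> = K * ((1 + norm x) ^ (k + 2 * CARD('n)) * norm (g x)) / (1 + norm x) ^ (2 * CARD('n))"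
        using norm_ge_zero[of x] by (simp add: power_add add_nonneg_eq_0_iff)
      also have "\<dots> \<le> K * C / (1 + norm x) ^ (2 * CARD('n))"
        by (intro divide_right_mono mult_left_mono C K) auto
      also have "\<dots> = K * C * decay x" by simp
      also have "\<dots> \<le> norm (K * C * decay x)"
        unfolding real_norm_def by (rule abs_ge_self)
      finally show "norm (w x * g x) \<le> norm (K * C * decay x)" .
    qed
    show "(\<lambda>x. w x * g x) \<in> borel_measurable lborel"
      using assms(1) schwartz_borel[OF assms(3)] by measurable
  qed
qed

lemma schwartz_integrable: "schwartz g \<Longrightarrow> integrable lborel g"
  using integrable_poly_mult[of "\<lambda>_. 1" 1 0 g] by simp

lemma norm_weight_mult: "norm (complex_of_real ((1 + norm x) ^ k) * z) = (1 + norm x) ^ k * norm z"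
  by (simp only: norm_mult norm_of_real abs_of_nonneg[OF zero_le_power[OF add_nonneg_nonneg[OF zero_le_one norm_ge_zero]]])

lemma integrable_weight_mult:
  assumes "schwartz g"
  shows "integrable lborel (\<lambda>x. (1 + norm x) ^ k * norm (g x))"
proof -
  have "integrable lborel (\<lambda>x. complex_of_real ((1 + norm x) ^ k) * g x)"
    by (rule integrable_poly_mult[of _ 1 k]) (auto simp: assms norm_power simp flip: of_real_power)
  then have "integrable lborel (\<lambda>x. norm (complex_of_real ((1 + norm x) ^ k) * g x))"
    by (rule integrable_norm)
  then show ?thesis by (simp only: norm_weight_mult)
qed

text \<open>The order consists of k for the growth of \<open>w\<close> and of
  \<open>2 * CARD('n)\<close> further powers of the weight that leave the integrable factor
  \<open>decay\<close>. Of the assumed bounds only the one for the empty list, on \<psi> itself,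
  enters the estimate.\<close>

lemma tempered_regular_dist:
  fixes w :: "real^'n::finite \<Rightarrow> complex"
  assumes [measurable]: "w \<in> borel_measurable borel" and w: "\<And>x. norm (w x) \<le> K * (1 + norm x) ^ k"
  shows "tempered_functional (regular_dist w) (k + 2 * CARD('n)) (K * (LINT x|lborel. decay (x::real^'n)))"
proof
  have K: "K \<ge> 0" using w[of 0] by (auto intro: order_trans[OF norm_ge_zero])
  then show "K * (LINT x|lborel. decay (x::real^'n)) \<ge> 0"
    by (intro mult_nonneg_nonneg integral_nonneg_AE) auto
  show "regular_dist w (\<lambda>x. a * \<psi> x + b * \<theta> x) = a * regular_dist w \<psi> + b * regular_dist w \<theta>"
    if "schwartz \<psi>" "schwartz \<theta>" for \<psi> \<theta> a b
  proof -
    have "regular_dist w (\<lambda>x. a * \<psi> x + b * \<theta> x) = (LINT x|lborel. a * (w x * \<psi> x) + b * (w x * \<theta> x))"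
      unfolding regular_dist_def by (intro Bochner_Integration.integral_cong) (auto simp: algebra_simps)
    also have "\<dots> = a * regular_dist w \<psi> + b * regular_dist w \<theta>"
      using integrable_poly_mult[OF assms that(1)] integrable_poly_mult[OF assms that(2)]
      by (simp add: regular_dist_def)
    finally show ?thesis .
  qed
  show "norm (regular_dist w \<psi>) \<le> K * (LINT x|lborel. decay (x::real^'n)) * B"
    if \<psi>: "schwartz \<psi>" and B: "\<And>is x. length is \<le> k + 2 * CARD('n) \<Longrightarrow>
      (1 + norm x) ^ (k + 2 * CARD('n)) * norm (partials is \<psi> x) \<le> B" for \<psi> B
  proof -
    have "norm (regular_dist w \<psi>) \<le> (LINT x|lborel. (K * B) * decay (x::real^'n))"
      unfolding regular_dist_def
    proof (rule Bochner_Integration.integral_norm_bound_integral)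
      show "integrable lborel (\<lambda>x. w x * \<psi> x)" by (rule integrable_poly_mult[OF assms \<psi>])
      show "integrable lborel (\<lambda>x. (K * B) * decay (x::real^'n))"
        using integrable_decay by (rule integrable_mult_right)
      show "norm (w x * \<psi> x) \<le> K * B * decay x" for x :: "real^'n"
      proof -
        have "norm (w x * \<psi> x) \<le> K * (1 + norm x) ^ k * norm (\<psi> x)"
          unfolding norm_mult by (intro mult_right_mono w) auto
        also have "\<dots> = K * ((1 + norm x) ^ (k + 2 * CARD('n)) * norm (\<psi> x)) / (1 + norm x) ^ (2 * CARD('n))"
          using norm_ge_zero[of x] by (simp add: power_add add_nonneg_eq_0_iff)
        also have "\<dots> \<le> K * B / (1 + norm x) ^ (2 * CARD('n))"
          using B[of "[]" x] by (intro divide_right_mono mult_left_mono K) auto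
        finally show ?thesis by simp
      qed
    qed
    also have "\<dots> = K * (LINT x|lborel. decay (x::real^'n)) * B"
      by (simp only: integral_mult_right_zero mult_ac)
    finally show ?thesis .
  qed
qed

lemma tempered_regular_schwartz:
  fixes \<psi> :: "real^'n::finite \<Rightarrow> complex"
  assumes "schwartz \<psi>"
  obtains K where "tempered_functional (regular_dist \<psi>) (2 * CARD('n)) K"
proof -
  obtain C where "\<And>x. (1 + norm x) ^ 0 * norm (\<psi> x) \<le> C"
    by (rule schwartz_bounded[OF assms]) (rule that)
  then have "tempered_functional (regular_dist \<psi>) (0 + 2 * CARD('n)) (C * (LINT x|lborel. decay (x::real^'n)))"
    by (intro tempered_regular_dist schwartz_borel assms) simp
  then show thesis using that by simp
qed

lemma norm_weight_power_le: "(1 + norm y) ^ k \<le> (1 + norm x) ^ k * (1 + norm (x - y :: 'a::real_normed_vector)) ^ k"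
  using norm_weight_le[of x "- (x - y)"]
  unfolding power_mult_distrib[symmetric] by (intro power_mono) (auto simp: norm_minus_commute)

text \<open>For fixed \<psi> these convolutions form a class closed under partial derivatives,
  because a derivative falls on the first factor. For the decay, the weight at y is split into
  weights at x and y - x, the arguments of the two factors.\<close>

lemma schwartz_conv:
  assumes "schwartz g" and \<psi>: "schwartz \<psi>"
  shows "schwartz (conv_dist g (regular_dist \<psi>))"
proof -
  obtain K where "tempered_functional (regular_dist \<psi>) (2 * CARD('a)) K"
    by (rule tempered_regular_schwartz[OF \<psi>])
  then interpret u: tempered_functional "regular_dist \<psi>" "2 * CARD('a)" K .
  have "\<exists>h. schwartz h \<and> conv_dist g (regular_dist \<psi>) = conv_dist h (regular_dist \<psi>)"
    using assms by blast
  then show ?thesis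
  proof (rule schwartz_coinduct)
    show "\<exists>h'. schwartz h' \<and> partial_deriv i h = conv_dist h' (regular_dist \<psi>)"
      if "\<exists>h'. schwartz h' \<and> h = conv_dist h' (regular_dist \<psi>)" for h i
      using that u.conv_dist_derivative(2) schwartz_partial_deriv by blast
    show "h differentiable (at x)"
      if "\<exists>h'. schwartz h' \<and> h = conv_dist h' (regular_dist \<psi>)" for h x
      using that u.conv_dist_derivative(1) by blast
    show "\<exists>C. \<forall>x. (1 + norm x) ^ k * norm (h x) \<le> C"
      if "\<exists>h'. schwartz h' \<and> h = conv_dist h' (regular_dist \<psi>)" for h k
    proof -
      from that obtain h' where h': "schwartz h'" "h = conv_dist h' (regular_dist \<psi>)" by blast
      obtain C where C: "\<And>x. (1 + norm x) ^ k * norm (h' x) \<le> C"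
        by (rule schwartz_bounded[OF h'(1)]) (rule that)
      have "(1 + norm y) ^ k * norm (h y) \<le> (LINT x|lborel. C * ((1 + norm x) ^ k * norm (\<psi> x)))" for y
      proof -
        have "norm (complex_of_real ((1 + norm y) ^ k) * h y) \<le> (LINT x|lborel. C * ((1 + norm x) ^ k * norm (\<psi> x)))"
          unfolding h'(2) conv_dist_def regular_dist_def integral_mult_right_zero[symmetric]
        proof (rule Bochner_Integration.integral_norm_bound_integral)
          show "integrable lborel (\<lambda>x. complex_of_real ((1 + norm y) ^ k) * (\<psi> x * h' (y - x)))"
          proof (intro integrable_mult_right)
            obtain D where "\<And>x. (1 + norm x) ^ 0 * norm (\<psi> x) \<le> D"
              by (rule schwartz_bounded[OF \<psi>]) (rule that)
            then show "integrable lborel (\<lambda>x. \<psi> x * h' (y - x))"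
              by (intro integrable_poly_mult[of _ D 0] schwartz_borel schwartz_reflect \<psi> h') simp
          qed
          show "integrable lborel (\<lambda>x. C * ((1 + norm x) ^ k * norm (\<psi> x)))"
            using integrable_weight_mult[OF \<psi>] by (rule integrable_mult_right)
          fix x
          have "norm (complex_of_real ((1 + norm y) ^ k) * (\<psi> x * h' (y - x))) = (1 + norm y) ^ k * (norm (\<psi> x) * norm (h' (y - x)))"
            by (simp only: norm_weight_mult) (simp only: norm_mult)
          also have "\<dots> \<le> ((1 + norm x) ^ k * (1 + norm (y - x)) ^ k) * (norm (\<psi> x) * norm (h' (y - x)))"
            using norm_weight_power_le[of y k x] by (intro mult_right_mono) (auto simp: norm_minus_commute)
          also have "\<dots> = ((1 + norm x) ^ k * norm (\<psi> x)) * ((1 + norm (y - x)) ^ k * norm (h' (y - x)))"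
            by simp
          also have "\<dots> \<le> ((1 + norm x) ^ k * norm (\<psi> x)) * C"
            by (intro mult_left_mono C) auto
          finally show "norm (complex_of_real ((1 + norm y) ^ k) * (\<psi> x * h' (y - x))) \<le> C * ((1 + norm x) ^ k * norm (\<psi> x))"
            by (simp add: mult.commute)
        qed
        then show ?thesis by (simp only: norm_weight_mult)
      qed
      then show ?thesis by blast
    qed
  qed
qed

section \<open>Correlation, the transpose of convolution\<close>

lemma partials_diff:
  assumes "schwartz g" "schwartz h"
  shows "partials is (\<lambda>x. g x - h x) =
    (\<lambda>x. partials is g x - partials is h x)"
  using partials_lincomb[OF assms, where a = 1 and b = "-1"] by simp

text \<open>Chosen so that g * u paired with \<psi> is the value of u at
  \<open>corr g \<psi>\<close>; estimates of the pairing become seminorm estimates of this function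
  of y.\<close>

definition corr :: "(real^'n::finite \<Rightarrow> complex) \<Rightarrow> (real^'n \<Rightarrow> complex) \<Rightarrow> real^'n \<Rightarrow> complex" where
  "corr g \<psi> y = (LINT x|lborel. g (x - y) * \<psi> x)"

lemma corr_eq_conv_dist: "corr g \<psi> = conv_dist (\<lambda>z. g (0 - z)) (regular_dist \<psi>)"
  by (auto simp: corr_def conv_dist_def regular_dist_def mult.commute)

lemma schwartz_corr: "schwartz g \<Longrightarrow> schwartz \<psi> \<Longrightarrow> schwartz (corr g \<psi>)"
  unfolding corr_eq_conv_dist by (intro schwartz_conv schwartz_reflect)

lemma partials_corr:
  assumes "schwartz g" and "schwartz \<psi>"
  shows "partials is (corr g \<psi>) = (\<lambda>y. (- 1) ^ length is * corr (partials is g) \<psi> y)"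
proof -
  obtain K where "tempered_functional (regular_dist \<psi>) (2 * CARD('a)) K"
    by (rule tempered_regular_schwartz[OF assms(2)])
  then interpret u: tempered_functional "regular_dist \<psi>" "2 * CARD('a)" K .
  have "partials is (corr g \<psi>) = conv_dist (partials is (\<lambda>z. g (0 - z))) (regular_dist \<psi>)"
    unfolding corr_eq_conv_dist by (intro u.partials_conv_dist schwartz_reflect assms)
  also have "\<dots> = (\<lambda>y. (- 1) ^ length is * corr (partials is g) \<psi> y)"
    unfolding partials_reflect[OF assms(1)] corr_def conv_dist_def regular_dist_def integral_mult_right_zero[symmetric]
    by (auto simp: mult_ac)
  finally show ?thesis .
qed

lemma integrable_shift_mult:
  assumes "schwartz g" "schwartz \<psi>"
  shows "integrable lborel (\<lambda>x. g (x - y) * \<psi> x)"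
proof -
  obtain D where D: "\<And>x. (1 + norm x) ^ 0 * norm (g x) \<le> D"
    by (rule schwartz_bounded[OF assms(1)]) (rule that)
  have "(\<lambda>x. g (x - y)) \<in> borel_measurable borel"
    using schwartz_borel[OF assms(1)] by measurable
  then show ?thesis
    using D by (intro integrable_poly_mult[of _ D 0] assms) auto
qed

text \<open>The weights of the finite sum do not depend on \<open>H\<close>. The same weights can
  thus be used for the translates of \<open>g\<close> and for the values of
  \<open>conv_dist g u\<close>, which is where linearity of \<open>u\<close> connects the two
  integrals.\<close>

lemma simple_function_integral_compose:
  fixes \<psi> :: "real^'n::finite \<Rightarrow> complex"
  assumes "simple_function lborel s" and "integrable lborel \<psi>"
  shows "(LINT x|lborel. H (s x) * \<psi> x) = (\<Sum>a\<in>range s. (LINT x|lborel. indicator (s -` {a}) x * \<psi> x) * H a)"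
    and "integrable lborel (\<lambda>x. H (s x) * \<psi> x)"
proof -
  have fin: "finite (range s)"
    using assms(1) by (simp add: simple_function_def)
  have meas: "s -` {a} \<in> sets borel" for a
  proof (cases "a \<in> range s")
    case False
    then have "s -` {a} = {}" by auto
    then show ?thesis by simp
  qed (use assms(1) in \<open>auto simp: simple_function_def\<close>)
  have eq: "H (s x) * \<psi> x = (\<Sum>a\<in>range s. (indicator (s -` {a}) x * \<psi> x) * H a)" for x
  proof -
    have "(\<Sum>a\<in>range s. (indicator (s -` {a}) x * \<psi> x) * H a) = (\<Sum>a\<in>range s. if a = s x then \<psi> x * H a else 0)"
      by (intro sum.cong) (auto simp: indicator_def)
    then show ?thesis using fin by simp
  qed
  have int: "integrable lborel (\<lambda>x. (indicator (s -` {a}) x * \<psi> x) * H a)" for a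
  proof -
    have "integrable lborel (\<lambda>x. indicator (s -` {a}) x *\<^sub>R \<psi> x)"
      using assms(2) meas by (intro integrable_mult_indicator) auto
    then show ?thesis by (simp add: scaleR_conv_of_real of_real_indicator)
  qed
  show "(LINT x|lborel. H (s x) * \<psi> x) = (\<Sum>a\<in>range s. (LINT x|lborel. indicator (s -` {a}) x * \<psi> x) * H a)"
    unfolding eq using int by (simp add: Bochner_Integration.integral_sum)
  show "integrable lborel (\<lambda>x. H (s x) * \<psi> x)"
    unfolding eq using int by simp
qed

context tempered_functional
begin

text \<open>
  Replacing the integration variable by simple functions \<open>s i\<close> turns the integral into a finite sum,
  which commutes with \<open>u\<close> by linearity; the error is controlled in the seminorm by the Lipschitz
  estimate for the translates of \<open>g\<close>.
\<close>

lemma integral_conv_dist: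
  assumes g: "schwartz g" and \<psi>: "schwartz \<psi>"
  shows "regular_dist (conv_dist g u) \<psi> = u (corr g \<psi>)"
proof -
  have "\<exists>F. (\<forall>i. simple_function lborel (F i)) \<and> (\<forall>x\<in>space lborel. (\<lambda>i. F i x) \<longlonglongrightarrow> x) \<and>
    (\<forall>i. \<forall>x\<in>space lborel. dist (F i x) 0 \<le> 2 * dist x (0::real^'n))"
    by (rule borel_measurable_implies_sequence_metric) simp
  then obtain s :: "nat \<Rightarrow> real^'n \<Rightarrow> real^'n" where s: "\<And>i. simple_function lborel (s i)" "\<And>x. (\<lambda>i. s i x) \<longlonglongrightarrow> x"
    "\<And>i x. norm (s i x) \<le> 2 * norm x"
    by auto
  have sm [measurable]: "s i \<in> borel_measurable borel" for i
    using borel_measurable_simple_function[OF s(1)] by simp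
  have [measurable]: "\<psi> \<in> borel_measurable borel" "g \<in> borel_measurable borel" by (simp_all add: schwartz_borel g \<psi>)
  have ip: "integrable lborel \<psi>" by (rule schwartz_integrable[OF \<psi>])
  let ?S = "\<lambda>i y. LINT x|lborel. g (s i x - y) * \<psi> x"
  let ?m = "\<lambda>i a. LINT x|lborel. indicator (s i -` {a}) x * \<psi> x"
  have fin: "finite (range (s i))" for i
    using s(1)[of i] by (simp add: simple_function_def)
  have S: "?S i = (\<lambda>y. \<Sum>a\<in>range (s i). ?m i a * g (a - y))" for i
    using simple_function_integral_compose(1)[OF s(1) ip, of "\<lambda>a. g (a - _)"] by auto
  have schwS: "schwartz (?S i)" for i
    unfolding S by (intro schwartz_sum schwartz_cmult fin schwartz_reflect g)
  have uS: "u (?S i) = (LINT x|lborel. conv_dist g u (s i x) * \<psi> x)" for i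
  proof -
    have "u (?S i) = (\<Sum>a\<in>range (s i). ?m i a * u (\<lambda>y. g (a - y)))"
      unfolding S by (intro sum fin schwartz_reflect g)
    then show ?thesis
      unfolding simple_function_integral_compose(1)[OF s(1) ip, of "conv_dist g u"] by (simp add: conv_dist_def)
  qed
  have cont: "continuous_on UNIV (conv_dist g u)"
    by (intro continuous_at_imp_continuous_on ballI differentiable_imp_continuous_within conv_dist_derivative g)
  then have [measurable]: "conv_dist g u \<in> borel_measurable borel"
    by (rule borel_measurable_continuous_onI)
  have scale: "1 + norm (s i x) \<le> 2 * (1 + norm x)" for i x
    using s(3)[of i x] by simp
  have lim1: "(\<lambda>i. u (?S i)) \<longlonglongrightarrow> (LINT x|lborel. conv_dist g u x * \<psi> x)"
    unfolding uS
  proof -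
    obtain C where C: "C \<ge> 0" "\<And>x. norm (conv_dist g u x) \<le> C * (1 + norm x) ^ d"
      by (rule conv_dist_bounded[OF g]) (rule that)
    show "(\<lambda>i. LINT x|lborel. conv_dist g u (s i x) * \<psi> x) \<longlonglongrightarrow> (LINT x|lborel. conv_dist g u x * \<psi> x)"
    proof (rule integral_dominated_convergence[where w = "\<lambda>x. (C * 2 ^ d) * ((1 + norm x) ^ d * norm (\<psi> x))"])
      show "integrable lborel (\<lambda>x. (C * 2 ^ d) * ((1 + norm x) ^ d * norm (\<psi> x)))"
        using integrable_weight_mult[OF \<psi>] by (rule integrable_mult_right)
      show "AE x in lborel. (\<lambda>i. conv_dist g u (s i x) * \<psi> x) \<longlonglongrightarrow> conv_dist g u x * \<psi> x"
        using cont by (intro AE_I2 tendsto_mult tendsto_const) (auto intro: continuous_on_tendsto_compose[OF _ s(2)])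
      show "AE x in lborel. norm (conv_dist g u (s i x) * \<psi> x) \<le> (C * 2 ^ d) * ((1 + norm x) ^ d * norm (\<psi> x))" for i
      proof (intro AE_I2)
        fix x
        have "norm (conv_dist g u (s i x)) \<le> C * (1 + norm (s i x)) ^ d" by (rule C)
        also have "\<dots> \<le> C * (2 * (1 + norm x)) ^ d"
          by (intro mult_left_mono power_mono scale C) auto
        also have "\<dots> = C * 2 ^ d * (1 + norm x) ^ d"
          by (simp only: power_mult_distrib mult.assoc)
        finally show "norm (conv_dist g u (s i x) * \<psi> x) \<le> (C * 2 ^ d) * ((1 + norm x) ^ d * norm (\<psi> x))"
          using mult_right_mono[of "norm (conv_dist g u (s i x))" "C * 2 ^ d * (1 + norm x) ^ d" "norm (\<psi> x)"]
          by (simp only: norm_mult mult.assoc) simp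
      qed
    qed measurable
  qed
  obtain K where K: "K \<ge> 0" "\<And>is z v. length is \<le> d \<Longrightarrow> (1 + norm z) ^ d *
    norm (partials is g (z + v) - (\<Sum>j<1. of_real (1 / fact j) * (dir_deriv v ^^ j) (partials is g) z))
      \<le> K * norm v ^ 1 * (1 + norm v) ^ d"
    by (rule schwartz_taylor_lists[OF g, where k = d and d = d and p = 1]) (rule that)
  \<comment> \<open>\<open>?b\<close> majorizes the integrand of the weighted seminorm: a Lipschitz
    factor in the distance of \<open>s i x\<close> from x, the increment weight bounded by (3 (1 +
    |x|))^d because \<open>s i x\<close> has norm at most 2 |x|, and (1 + |x|)^d from moving the
    weight off y. In \<open>?w\<close> the Lipschitz factor is replaced by 3 (1 + |x|), which gives
    a majorant independent of i.\<close>
  let ?b = "\<lambda>i x. K * norm (s i x - x) * (3 * (1 + norm x)) ^ d * (1 + norm x) ^ d * norm (\<psi> x)" and ?w = "\<lambda>x. (K * 3 ^ Suc d) * ((1 + norm x) ^ (Suc (2 * d)) * norm (\<psi> x))"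
  let ?B = "\<lambda>i. LINT x|lborel. ?b i x"
  have step3: "norm (s i x - x) \<le> 3 * norm x" for i x
    using norm_triangle_ineq4[of "s i x" x] s(3)[of i x] by simp
  have dom: "?b i x
       \<le> ?w x" for i x
  proof -
    have "?b i x
       \<le> K * (3 * (1 + norm x)) * (3 * (1 + norm x)) ^ d * (1 + norm x) ^ d * norm (\<psi> x)"
      using step3[of i x] by (intro mult_right_mono mult_left_mono K) auto
    also have "K * (3 * w) * (3 * w) ^ d * w ^ d * n = (K * 3 ^ Suc d) * (w ^ (Suc (2 * d)) * n)" for w n :: real
      by (simp add: power_mult_distrib power_add mult_2)
    finally show ?thesis .
  qed
  have intdom: "integrable lborel (?w)"
    using integrable_weight_mult[OF \<psi>] by (rule integrable_mult_right)
  have intB: "integrable lborel (?b i)" for i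
    by (rule Bochner_Integration.integrable_bound[OF intdom])
       (use dom K(1) in \<open>auto intro: order_trans[OF _ abs_ge_self]\<close>)
  have B: "?B \<longlonglongrightarrow> integral\<^sup>L (lborel :: (real^'n) measure) (\<lambda>_. 0 :: real)"
  proof (rule integral_dominated_convergence[where w = "?w"])
    show "integrable lborel (?w)"
      by (rule intdom)
    show "AE x in lborel. (\<lambda>i. ?b i x) \<longlonglongrightarrow> 0"
    proof (intro AE_I2)
      fix x
      have "(\<lambda>i. ?b i x)
         \<longlonglongrightarrow> K * norm (x - x) * (3 * (1 + norm x)) ^ d * (1 + norm x) ^ d * norm (\<psi> x)"
        by (intro tendsto_intros s)
      then show "(\<lambda>i. ?b i x) \<longlonglongrightarrow> 0"
        by simp
    qed
    show "AE x in lborel. norm (?b i x)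
       \<le> ?w x" for i
      using dom K(1) by (auto simp del: power_Suc)
  qed measurable
  have le: "norm (u (?S i) - u (corr g \<psi>)) \<le> c * ?B i" for i
    unfolding diff[OF schwS schwartz_corr[OF g \<psi>], symmetric]
  proof (rule bounded[OF schwartz_diff[OF schwS schwartz_corr[OF g \<psi>]]])
    fix "is" :: "'n list" and y assume len: "length is \<le> d"
    let ?G = "partials is g"
    have G: "schwartz ?G" by (rule schwartz_partials[OF g])
    have "partials is (?S i) y = (\<Sum>a\<in>range (s i). ?m i a * ((- 1) ^ length is * ?G (a - y)))"
      unfolding S using partials_sum[OF fin, of i "\<lambda>a y. g (a - y)" "is" "?m i"]
      by (simp add: schwartz_reflect g partials_reflect)
    also have "\<dots> = (- 1) ^ length is * (LINT x|lborel. ?G (s i x - y) * \<psi> x)"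
      unfolding simple_function_integral_compose(1)[OF s(1) ip, of "\<lambda>a. ?G (a - y)"] sum_distrib_left
      by (simp add: mult_ac)
    finally have "partials is (\<lambda>x. ?S i x - corr g \<psi> x) y =
       (- 1) ^ length is * ((LINT x|lborel. ?G (s i x - y) * \<psi> x) - corr ?G \<psi> y)"
      by (simp add: partials_diff[OF schwS schwartz_corr[OF g \<psi>]] partials_corr[OF g \<psi>] right_diff_distrib)
    also have "(LINT x|lborel. ?G (s i x - y) * \<psi> x) - corr ?G \<psi> y = (LINT x|lborel. (?G (s i x - y) - ?G (x - y)) * \<psi> x)"
      unfolding corr_def left_diff_distrib
      by (rule Bochner_Integration.integral_diff[symmetric])
         (intro simple_function_integral_compose(2)[OF s(1) ip, of "\<lambda>a. ?G (a - y)"] integrable_shift_mult G \<psi>)+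
    finally have eq: "(1 + norm y) ^ d * norm (partials is (\<lambda>x. ?S i x - corr g \<psi> x) y)
      = norm (LINT x|lborel. complex_of_real ((1 + norm y) ^ d) * ((?G (s i x - y) - ?G (x - y)) * \<psi> x))"
      by (simp only: norm_weight_mult integral_mult_right_zero)
         (simp only: norm_mult norm_power norm_minus_cancel norm_one power_one mult_1)
    also have "\<dots> \<le> ?B i"
    proof (rule Bochner_Integration.integral_norm_bound_integral[OF _ intB])
      show "integrable lborel (\<lambda>x. complex_of_real ((1 + norm y) ^ d) * ((?G (s i x - y) - ?G (x - y)) * \<psi> x))"
        unfolding left_diff_distrib
        by (intro integrable_mult_right Bochner_Integration.integrable_diff
            simple_function_integral_compose(2)[OF s(1) ip, of "\<lambda>a. ?G (a - y)"] integrable_shift_mult G \<psi>)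
      fix x
      have "(1 + norm y) ^ d * norm (?G (s i x - y) - ?G (x - y))
         \<le> ((1 + norm x) ^ d * (1 + norm (x - y)) ^ d) * norm (?G (s i x - y) - ?G (x - y))"
        by (intro mult_right_mono norm_weight_power_le) auto
      also have "\<dots> = (1 + norm x) ^ d * ((1 + norm (x - y)) ^ d * norm (?G (s i x - y) - ?G (x - y)))"
        by simp
      also have "\<dots> \<le> (1 + norm x) ^ d * (K * norm (s i x - x) * (1 + norm (s i x - x)) ^ d)"
        using K(2)[OF len, of "x - y" "s i x - x"] by (intro mult_left_mono) auto
      also have "\<dots> \<le> (1 + norm x) ^ d * (K * norm (s i x - x) * (3 * (1 + norm x)) ^ d)"
        using step3[of i x] by (intro mult_left_mono power_mono mult_nonneg_nonneg K) auto
      finally have "(1 + norm y) ^ d * norm (?G (s i x - y) - ?G (x - y)) * norm (\<psi> x) \<le>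
          (1 + norm x) ^ d * (K * norm (s i x - x) * (3 * (1 + norm x)) ^ d) * norm (\<psi> x)"
        by (rule mult_right_mono) auto
      then show "norm (complex_of_real ((1 + norm y) ^ d) * ((?G (s i x - y) - ?G (x - y)) * \<psi> x))
         \<le> ?b i x"
        by (simp only: norm_weight_mult) (simp only: norm_mult mult_ac)
    qed
    finally show "(1 + norm y) ^ d * norm (partials is (\<lambda>x. ?S i x - corr g \<psi> x) y) \<le> ?B i" .
  qed
  have "?B \<longlonglongrightarrow> 0"
    using B by (simp only: Bochner_Integration.integral_zero)
  then have "(\<lambda>i. c * ?B i) \<longlonglongrightarrow> 0"
    by (rule tendsto_mult_right_zero)
  with always_eventually[OF allI[OF le]] have "(\<lambda>i. u (?S i) - u (corr g \<psi>)) \<longlonglongrightarrow> 0"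
    by (rule Lim_null_comparison)
  then have "(\<lambda>i. u (?S i)) \<longlonglongrightarrow> u (corr g \<psi>)"
    by (rule LIM_zero_cancel)
  from LIMSEQ_unique[OF lim1 this] show ?thesis
    unfolding regular_dist_def .
qed

end

section \<open>The Fourier transform\<close>

lemma norm_exp_i [simp]: "norm (exp (- (\<i> * complex_of_real t))) = 1"
  using norm_exp_i_times[of "- t"] by simp

lemma lborel_integrable_affine:
  fixes f :: "'a::euclidean_space \<Rightarrow> 'b::{banach,second_countable_topology}"
  assumes f: "integrable lborel f" and "c \<noteq> 0"
  shows "integrable lborel (\<lambda>x. f (t + c *\<^sub>R x))"
proof -
  have [measurable]: "f \<in> borel_measurable borel"
    using f by (auto dest: borel_measurable_integrable)
  have "integrable lborel (\<lambda>x. \<bar>c\<bar> ^ DIM('a) *\<^sub>R f (t + c *\<^sub>R x))"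
    using f by (subst (asm) lborel_affine[OF \<open>c \<noteq> 0\<close>, of t]) (simp add: integrable_density integrable_distr_eq)
  then have "integrable lborel (\<lambda>x. inverse (\<bar>c\<bar> ^ DIM('a)) *\<^sub>R (\<bar>c\<bar> ^ DIM('a) *\<^sub>R f (t + c *\<^sub>R x)))"
    by (rule integrable_scaleR_right)
  then show ?thesis using \<open>c \<noteq> 0\<close> by simp
qed

lemma fourier_integrable:
  assumes "schwartz g"
  shows "integrable lborel (\<lambda>x. exp (- (\<i> * complex_of_real (x \<bullet> \<xi>))) * g x)"
  by (rule integrable_poly_mult[of _ 1 0]) (auto simp: assms)

lemma fourier_lincomb:
  assumes "schwartz g" "schwartz h"
  shows "fourier (\<lambda>x. a * g x + b * h x) \<xi> = a * fourier g \<xi> + b * fourier h \<xi>"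
proof -
  have "fourier (\<lambda>x. a * g x + b * h x) \<xi> = (LINT x|lborel. a * (exp (- (\<i> * complex_of_real (x \<bullet> \<xi>))) * g x) +
      b * (exp (- (\<i> * complex_of_real (x \<bullet> \<xi>))) * h x))"
    unfolding fourier_def by (intro Bochner_Integration.integral_cong) (auto simp: algebra_simps)
  also have "\<dots> = a * fourier g \<xi> + b * fourier h \<xi>"
    using fourier_integrable[OF assms(1)] fourier_integrable[OF assms(2)] by (simp add: fourier_def)
  finally show ?thesis .
qed

lemma fourier_diff: "schwartz g \<Longrightarrow> schwartz h \<Longrightarrow> fourier (\<lambda>x. g x - h x) \<xi> = fourier g \<xi> - fourier h \<xi>"
  using fourier_lincomb[of g h 1 "-1"] by simp

lemma fourier_cmult: "fourier (\<lambda>x. a * g x) \<xi> = a * fourier g \<xi>"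
  unfolding fourier_def integral_mult_right_zero[symmetric] by (simp add: mult_ac)

lemma norm_fourier_le:
  assumes "schwartz g"
  shows "norm (fourier g \<xi>) \<le> (LINT x|lborel. norm (g x))"
  unfolding fourier_def
  by (rule Bochner_Integration.integral_norm_bound_integral)
     (use fourier_integrable[OF assms] schwartz_integrable[OF assms] in \<open>auto simp: norm_mult\<close>)

lemma fourier_shift:
  assumes "schwartz g"
  shows "fourier (\<lambda>x. g (x + a)) \<xi> = exp (\<i> * complex_of_real (a \<bullet> \<xi>)) * fourier g \<xi>"
proof -
  have [measurable]: "g \<in> borel_measurable borel" by (rule schwartz_borel[OF assms])
  have "fourier g \<xi> = (LINT x|lborel. exp (- (\<i> * complex_of_real ((a + x) \<bullet> \<xi>))) * g (a + x))"
    unfolding fourier_def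
    using lborel_integral_affine[of "\<lambda>x. exp (- (\<i> * complex_of_real (x \<bullet> \<xi>))) * g x" 1 a] by simp
  also have "\<dots> = (LINT x|lborel. exp (- (\<i> * complex_of_real (a \<bullet> \<xi>))) * (exp (- (\<i> * complex_of_real (x \<bullet> \<xi>))) * g (x + a)))"
    by (intro Bochner_Integration.integral_cong) (auto simp: inner_add_left exp_add[symmetric] algebra_simps)
  also have "\<dots> = exp (- (\<i> * complex_of_real (a \<bullet> \<xi>))) * fourier (\<lambda>x. g (x + a)) \<xi>"
    by (simp add: fourier_def)
  finally show ?thesis
    by (simp add: exp_minus field_simps)
qed

text \<open>
  Convolving \<open>g\<close> with the character of frequency \<open>\<xi>\<close> multiplies the character by the value of the
  Fourier transform at \<open>\<xi>\<close>; differentiating this convolution replaces integration by parts.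
\<close>

lemma fourier_partial_deriv:
  assumes g: "schwartz g"
  shows "fourier (partial_deriv i g) \<xi> = \<i> * complex_of_real (\<xi> $ i) * fourier g \<xi>"
proof -
  let ?w = "\<lambda>y. exp (\<i> * complex_of_real (y \<bullet> \<xi>))"
  interpret u: tempered_functional "regular_dist ?w" "0 + 2 * CARD('a)" "1 * (LINT x|lborel. decay (x::real^'a))"
    by (rule tempered_regular_dist) auto
  have conv: "conv_dist h (regular_dist ?w) x = ?w x * fourier h \<xi>" if h: "schwartz h" for h x
  proof -
    have [measurable]: "h \<in> borel_measurable borel" by (rule schwartz_borel[OF h])
    have "conv_dist h (regular_dist ?w) x = (LINT y|lborel. ?w (x - (x - y)) * h (x - y))"
      by (simp add: conv_dist_def regular_dist_def)
    also have "\<dots> = (LINT y|lborel. ?w (x - y) * h y)"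
      by (rule lborel_integral_reflect[of "\<lambda>y. ?w (x - y) * h y"]) measurable
    also have "\<dots> = (LINT y|lborel. ?w x * (exp (- (\<i> * complex_of_real (y \<bullet> \<xi>))) * h y))"
      by (intro Bochner_Integration.integral_cong refl)
         (simp add: inner_diff_left exp_diff exp_minus field_simps)
    finally show ?thesis by (simp add: fourier_def)
  qed
  have "partial_deriv i (conv_dist g (regular_dist ?w)) 0 = fourier (partial_deriv i g) \<xi>"
    by (simp add: u.conv_dist_derivative[OF g] conv schwartz_partial_deriv[OF g])
  moreover have "conv_dist g (regular_dist ?w) = (\<lambda>x. ?w x * fourier g \<xi>)"
    using conv[OF g] by auto
  moreover have "((\<lambda>t. ?w (0 + t *\<^sub>R axis i 1) * fourier g \<xi>) has_vector_derivative \<i> * complex_of_real (\<xi> $ i) * fourier g \<xi>) (at 0)"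
  proof -
    have "((\<lambda>z. exp (\<i> * (z * complex_of_real (\<xi> $ i))) * fourier g \<xi>) has_field_derivative \<i> * complex_of_real (\<xi> $ i) * fourier g \<xi>) (at (of_real 0))"
      by (auto intro!: derivative_eq_intros)
    from has_vector_derivative_real_field[OF this] show ?thesis
      by (simp add: inner_axis')
  qed
  ultimately show ?thesis
    unfolding partial_deriv_def[of i "conv_dist g (regular_dist ?w)"] by (simp add: vector_derivative_at)
qed

lemma fourier_partials:
  assumes "schwartz g"
  shows "fourier (partials is g) \<xi> = (\<Prod>i\<leftarrow>is. \<i> * complex_of_real (\<xi> $ i)) * fourier g \<xi>"
  by (induction "is") (simp_all add: fourier_partial_deriv schwartz_partials assms)

lemma norm_exp_i_second_order: "norm (exp (- (\<i> * complex_of_real t)) - 1 + \<i> * complex_of_real t) \<le> t\<^sup>2"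
proof -
  have "norm (exp (\<i> * complex_of_real (- t)) - (\<Sum>k\<le>1. (\<i> * complex_of_real (- t)) ^ k / fact k)) \<le> \<bar>- t\<bar> ^ Suc 1 / fact (Suc 1)"
    by (rule iexp_approx1)
  also have "\<dots> \<le> t\<^sup>2" by (simp add: numeral_2_eq_2[symmetric] power2_eq_square)
  finally show ?thesis by (simp add: algebra_simps)
qed

text \<open>The first-order expansion of the character in \<xi> has an error of at most (x . h)^2,
  and two powers of |x| are integrable against \<open>g\<close>;
  \<open>quadratic_remainder_derivative\<close> does the rest.\<close>

lemma fourier_derivative:
  assumes g: "schwartz g"
  shows "fourier g differentiable (at \<xi>)"
    and "partial_deriv i (fourier g) = fourier (\<lambda>x. (- \<i>) * (of_real (x $ i) * g x))"
proof -
  let ?c = "\<lambda>\<xi> i. fourier (\<lambda>x. (- \<i>) * (of_real (x $ i) * g x)) \<xi>"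
  let ?E = "\<lambda>x \<xi>. exp (- (\<i> * complex_of_real (x \<bullet> \<xi>)))"
  have *: "norm (fourier g (\<xi> + h) - fourier g \<xi> - (\<Sum>i\<in>UNIV. of_real (h $ i) * ?c \<xi> i))
     \<le> (LINT x|lborel. (1 + norm x) ^ 2 * norm (g x)) * norm h ^ 2 * (1 + norm h) ^ 0" for \<xi> h
  proof -
    let ?S = "\<lambda>x. \<Sum>i\<in>UNIV. of_real (h $ i) * (?E x \<xi> * ((- \<i>) * (of_real (x $ i) * g x)))"
    let ?d = "\<lambda>x. ?E x (\<xi> + h) * g x - ?E x \<xi> * g x - ?S x"
    have int: "integrable lborel (\<lambda>x. ?E x \<xi> * g x)" for \<xi> by (rule fourier_integrable[OF g])
    have int2: "integrable lborel (\<lambda>x. ?E x \<xi> * ((- \<i>) * (of_real (x $ i) * g x)))" for \<xi> i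
      by (intro fourier_integrable schwartz_cmult schwartz_nth_mult g)
    have sumint: "integrable lborel (?S)"
      by (intro Bochner_Integration.integrable_sum integrable_mult_right int2)
    have "fourier g (\<xi> + h) - fourier g \<xi> - (\<Sum>i\<in>UNIV. of_real (h $ i) * ?c \<xi> i) =
       (LINT x|lborel. ?d x)"
      unfolding fourier_def using int int2 sumint
      by (simp add: Bochner_Integration.integral_sum)
    also have "norm \<dots> \<le> (LINT x|lborel. norm h ^ 2 * ((1 + norm x) ^ 2 * norm (g x)))"
    proof (rule Bochner_Integration.integral_norm_bound_integral)
      show "integrable lborel (?d)"
        by (intro Bochner_Integration.integrable_diff int sumint)
      show "integrable lborel (\<lambda>x. norm h ^ 2 * ((1 + norm x) ^ 2 * norm (g x)))"
        using integrable_weight_mult[OF g] by (rule integrable_mult_right)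
      fix x :: "real^'a"
      have "(\<Sum>i\<in>UNIV. complex_of_real (h $ i) * (?E x \<xi> * ((- \<i>) * (of_real (x $ i) * g x)))) = (\<Sum>i\<in>UNIV. complex_of_real (x $ i * h $ i)) * (?E x \<xi> * ((- \<i>) * g x))"
        unfolding sum_distrib_right by (intro sum.cong) (auto simp: mult_ac)
      also have "(\<Sum>i\<in>UNIV. complex_of_real (x $ i * h $ i)) = complex_of_real (x \<bullet> h)"
        by (simp add: inner_vec_def)
      finally have "?d x =
         ?E x \<xi> * (?E x h - 1 + \<i> * complex_of_real (x \<bullet> h)) * g x"
        by (simp add: inner_add_right exp_add[symmetric] algebra_simps)
      then have "norm (?d x)
         = norm (?E x h - 1 + \<i> * complex_of_real (x \<bullet> h)) * norm (g x)"
        by (simp add: norm_mult)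
      also have "\<dots> \<le> (x \<bullet> h)\<^sup>2 * norm (g x)"
        by (intro mult_right_mono norm_exp_i_second_order) auto
      also have "\<dots> \<le> ((1 + norm x) * norm h)\<^sup>2 * norm (g x)"
      proof (intro mult_right_mono)
        have "\<bar>x \<bullet> h\<bar> \<le> norm x * norm h" by (rule Cauchy_Schwarz_ineq2)
        also have "\<dots> \<le> (1 + norm x) * norm h" by (intro mult_right_mono) auto
        finally show "(x \<bullet> h)\<^sup>2 \<le> ((1 + norm x) * norm h)\<^sup>2"
          by (simp add: abs_le_square_iff[symmetric])
      qed auto
      finally show "norm (?d x)
        \<le> norm h ^ 2 * ((1 + norm x) ^ 2 * norm (g x))"
        by (simp add: power_mult_distrib mult_ac)
    qed
    finally show ?thesis by (simp add: mult.commute)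
  qed
  show "fourier g differentiable (at \<xi>)"
    by (rule quadratic_remainder_derivative(1)[OF *])
  show "partial_deriv i (fourier g) = fourier (\<lambda>x. (- \<i>) * (of_real (x $ i) * g x))"
    by (rule ext, rule quadratic_remainder_derivative(2)[OF *])
qed

text \<open>One power of 1 + |\<xi>| is at most 1 plus the sum of the |\<xi>_i|, and each factor
  \<xi>_i is absorbed by passing from \<open>g\<close> to a partial derivative. The induction
  therefore quantifies over \<open>g\<close>.\<close>

lemma fourier_decay:
  assumes "schwartz g"
  shows "\<exists>C. \<forall>\<xi>. (1 + norm \<xi>) ^ k * norm (fourier g \<xi>) \<le> C"
  using assms
proof (induction k arbitrary: g)
  case 0
  then show ?case using norm_fourier_le by auto
next
  case (Suc k)
  obtain C where C: "\<And>\<xi>. (1 + norm \<xi>) ^ k * norm (fourier g \<xi>) \<le> C"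
    using Suc by blast
  have "\<exists>D. \<forall>i \<xi>. (1 + norm \<xi>) ^ k * norm (fourier (partial_deriv i g) \<xi>) \<le> D i"
    using Suc.IH[OF schwartz_partial_deriv[OF Suc.prems]] by metis
  then obtain D where D: "\<And>i \<xi>. (1 + norm \<xi>) ^ k * norm (fourier (partial_deriv i g) \<xi>) \<le> D i"
    by blast
  have "(1 + norm \<xi>) ^ Suc k * norm (fourier g \<xi>) \<le> C + (\<Sum>i\<in>UNIV. D i)" for \<xi> :: "real^'a"
  proof -
    have "(1 + norm \<xi>) ^ Suc k * norm (fourier g \<xi>) = (1 + norm \<xi>) * ((1 + norm \<xi>) ^ k * norm (fourier g \<xi>))"
      by simp
    also have "\<dots> \<le> (1 + (\<Sum>i\<in>UNIV. \<bar>\<xi> $ i\<bar>)) * ((1 + norm \<xi>) ^ k * norm (fourier g \<xi>))"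
      by (intro mult_right_mono add_left_mono norm_le_l1_cart) auto
    also have "\<dots> = (1 + norm \<xi>) ^ k * norm (fourier g \<xi>) +
        (\<Sum>i\<in>UNIV. (1 + norm \<xi>) ^ k * norm (fourier (partial_deriv i g) \<xi>))"
      by (simp add: fourier_partial_deriv[OF Suc.prems] norm_mult algebra_simps sum_distrib_left)
    also have "\<dots> \<le> C + (\<Sum>i\<in>UNIV. D i)"
      by (intro add_mono sum_mono C D)
    finally show ?thesis .
  qed
  then show ?case by blast
qed

text \<open>The Fourier transforms of Schwartz functions form a class closed under partial
  derivatives, since differentiating a transform multiplies the original function by a
  coordinate.\<close>

lemma schwartz_fourier:
  assumes "schwartz g"
  shows "schwartz (fourier g)"
proof -
  have "\<exists>h. schwartz h \<and> fourier g = fourier h" using assms by blast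
  then show ?thesis
  proof (rule schwartz_coinduct)
    show "\<exists>h'. schwartz h' \<and> partial_deriv i f = fourier h'"
      if "\<exists>h. schwartz h \<and> f = fourier h" for f :: "real^'a \<Rightarrow> complex" and i
      using that fourier_derivative(2) schwartz_cmult[OF schwartz_nth_mult(1)] by blast
    show "f differentiable (at x)" if "\<exists>h. schwartz h \<and> f = fourier h" for f :: "real^'a \<Rightarrow> complex" and x
      using that fourier_derivative(1) by blast
    show "\<exists>C. \<forall>x. (1 + norm x) ^ k * norm (f x) \<le> C"
      if "\<exists>h. schwartz h \<and> f = fourier h" for f :: "real^'a \<Rightarrow> complex" and k
      using that fourier_decay by blast
  qed
qed

section \<open>Gaussians and Fourier inversion\<close>

abbreviation gauss :: "real^'n::finite \<Rightarrow> complex" where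
  "gauss x \<equiv> complex_of_real (exp (- (norm x)\<^sup>2 / 2))"

text \<open>Up to the factor sqrt (2 pi) this is the characteristic function of the standard normal
  distribution, at -s.\<close>

lemma gauss_1d:
  shows "integrable lborel (\<lambda>t. exp (- (\<i> * complex_of_real (t * s))) * complex_of_real (exp (- t\<^sup>2 / 2)))"
    and "(LINT t|lborel. exp (- (\<i> * complex_of_real (t * s))) * complex_of_real (exp (- t\<^sup>2 / 2))) =
      complex_of_real (sqrt (2 * pi) * exp (- s\<^sup>2 / 2))"
proof -
  have eq: "exp (- (\<i> * complex_of_real (t * s))) * complex_of_real (exp (- t\<^sup>2 / 2)) =
      complex_of_real (sqrt (2 * pi)) * (std_normal_density t *\<^sub>R exp (\<i> * complex_of_real ((- s) * t)))" for t
    by (simp add: std_normal_density_def scaleR_conv_of_real mult_ac)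
  have "integrable lborel std_normal_density"
    using integrable_std_normal_moment[of 0] by simp
  then have int: "integrable lborel (\<lambda>t. std_normal_density t *\<^sub>R exp (\<i> * complex_of_real ((- s) * t)))"
    by (rule Bochner_Integration.integrable_bound) (auto simp: normal_density_nonneg)
  show "integrable lborel (\<lambda>t. exp (- (\<i> * complex_of_real (t * s))) * complex_of_real (exp (- t\<^sup>2 / 2)))"
    unfolding eq using int by (rule integrable_mult_right)
  have "(LINT t|lborel. std_normal_density t *\<^sub>R exp (\<i> * complex_of_real ((- s) * t))) = char std_normal_distribution (- s)"
    unfolding char_def by (subst integral_density) (auto simp: normal_density_nonneg)
  also have "\<dots> = complex_of_real (exp (- s\<^sup>2 / 2))"
    by (simp add: char_std_normal_distribution)
  finally show "(LINT t|lborel. exp (- (\<i> * complex_of_real (t * s))) * complex_of_real (exp (- t\<^sup>2 / 2))) =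
      complex_of_real (sqrt (2 * pi) * exp (- s\<^sup>2 / 2))"
    unfolding eq integral_mult_right_zero by (simp only: of_real_mult)
qed

lemma fourier_gauss:
  fixes \<xi> :: "real^'n::finite"
  shows "integrable lborel (\<lambda>x. exp (- (\<i> * complex_of_real (x \<bullet> \<xi>))) * gauss x)"
    and "fourier gauss \<xi> = complex_of_real (sqrt (2 * pi) ^ CARD('n)) * gauss \<xi>"
proof -
  let ?f = "\<lambda>b t. exp (- (\<i> * complex_of_real (t * (\<xi> \<bullet> b)))) * complex_of_real (exp (- t\<^sup>2 / 2))"
  have norm_eq: "gauss x = (\<Prod>b\<in>Basis. complex_of_real (exp (- (x \<bullet> b)\<^sup>2 / 2)))" for x :: "real^'n"
  proof -
    have "(norm x)\<^sup>2 = (\<Sum>b\<in>Basis. (x \<bullet> b)\<^sup>2)"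
      unfolding power2_norm_eq_inner by (subst euclidean_inner) (simp add: power2_eq_square)
    then have "exp (- (norm x)\<^sup>2 / 2) = (\<Prod>b\<in>Basis. exp (- (x \<bullet> b)\<^sup>2 / 2))"
      by (simp add: exp_sum[symmetric] sum_negf sum_divide_distrib[symmetric])
    then show ?thesis by simp
  qed
  have eq: "exp (- (\<i> * complex_of_real (x \<bullet> \<xi>))) * gauss x = (\<Prod>b\<in>Basis. ?f b (x \<bullet> b))" for x
  proof -
    have "exp (- (\<i> * complex_of_real (x \<bullet> \<xi>))) = exp (\<Sum>b\<in>Basis. - (\<i> * complex_of_real ((x \<bullet> b) * (\<xi> \<bullet> b))))"
      by (subst euclidean_inner) (simp add: sum_negf sum_distrib_left)
    also have "\<dots> = (\<Prod>b\<in>Basis. exp (- (\<i> * complex_of_real ((x \<bullet> b) * (\<xi> \<bullet> b)))))"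
      by (rule exp_sum) simp
    finally show ?thesis
      unfolding norm_eq prod.distrib by simp
  qed
  show "integrable lborel (\<lambda>x. exp (- (\<i> * complex_of_real (x \<bullet> \<xi>))) * gauss x)"
    unfolding eq by (intro lborel_integral_prod(1) gauss_1d)
  have "fourier gauss \<xi> = (\<Prod>b\<in>(Basis::(real^'n) set). complex_of_real (sqrt (2 * pi) * exp (- (\<xi> \<bullet> b)\<^sup>2 / 2)))"
    unfolding fourier_def eq by (subst lborel_integral_prod(2)) (simp_all only: gauss_1d)
  also have "\<dots> = complex_of_real (sqrt (2 * pi) ^ CARD('n)) * gauss \<xi>"
    unfolding norm_eq by (simp add: prod.distrib)
  finally show "fourier gauss \<xi> = complex_of_real (sqrt (2 * pi) ^ CARD('n)) * gauss \<xi>" .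
qed

lemma gauss_integral: "integrable lborel (gauss :: real^'n::finite \<Rightarrow> complex)"
    "(LINT x|lborel. gauss (x::real^'n::finite)) = complex_of_real (sqrt (2 * pi) ^ CARD('n))"
  using fourier_gauss[of "0::real^'n"] by (simp_all add: fourier_def)

text \<open>Fourier inversion at the origin. The underlying double integral is not absolutely
  convergent for g \<noteq> 0, so Fubini is applied after damping with a Gaussian of width 1 / e.
  Rescaling x by e turns the transformed Gaussian into a fixed one, and dominated convergence
  applies on both sides as e tends to 0.\<close>

lemma integral_fourier:
  fixes g :: "real^'n::finite \<Rightarrow> complex"
  assumes g: "schwartz g"
  shows "(LINT \<xi>|lborel. fourier g \<xi>) = complex_of_real ((2 * pi) ^ CARD('n)) * g 0"
proof -
  let ?S = "complex_of_real (sqrt (2 * pi) ^ CARD('n))"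
  define e where "e m = inverse (real (Suc m))" for m
  have e: "e m > 0" "e \<longlonglongrightarrow> 0" for m
    unfolding e_def using LIMSEQ_inverse_real_of_nat by auto
  have [measurable]: "g \<in> borel_measurable borel" "fourier g \<in> borel_measurable borel"
    by (simp_all add: schwartz_borel g schwartz_fourier)
  let ?E = "\<lambda>x \<xi>::real^'n. exp (- (\<i> * complex_of_real (x \<bullet> \<xi>)))"
  have key: "(LINT \<xi>|lborel. fourier g \<xi> * gauss (e m *\<^sub>R \<xi>)) =
      (LINT x|lborel. g (e m *\<^sub>R x) * (?S * gauss x))" for m
  proof -
    have gint: "integrable lborel (\<lambda>\<xi>::real^'n. gauss (e m *\<^sub>R \<xi>))"
      using lborel_integrable_affine[OF gauss_integral(1)[where 'n = 'n], of "e m" 0] e(1)[of m] by simp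
    have pint: "integrable (lborel \<Otimes>\<^sub>M lborel) (\<lambda>(x, \<xi>). ?E x \<xi> * g x * gauss (e m *\<^sub>R \<xi>))"
    proof (rule lborel_pair.Fubini_integrable)
      have "integrable lborel (\<lambda>x. norm (g x) * (LINT \<xi>|lborel. norm (gauss (e m *\<^sub>R (\<xi>::real^'n)))))"
        by (intro integrable_mult_left integrable_norm schwartz_integrable g)
      then show "integrable lborel (\<lambda>x. LINT \<xi>|lborel. norm (case (x, \<xi>) of (x, \<xi>) \<Rightarrow> ?E x \<xi> * g x * gauss (e m *\<^sub>R \<xi>)))"
        by (simp add: norm_mult del: norm_of_real)
      show "AE x in lborel. integrable lborel (\<lambda>\<xi>. case (x, \<xi>) of (x, \<xi>) \<Rightarrow> ?E x \<xi> * g x * gauss (e m *\<^sub>R \<xi>))"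
      proof (intro AE_I2)
        fix x
        have "integrable lborel (\<lambda>\<xi>::real^'n. g x * gauss (e m *\<^sub>R \<xi>))"
          using gint by (rule integrable_mult_right)
        then show "integrable lborel (\<lambda>\<xi>. case (x, \<xi>) of (x, \<xi>) \<Rightarrow> ?E x \<xi> * g x * gauss (e m *\<^sub>R \<xi>))"
          by (rule Bochner_Integration.integrable_bound) (auto simp: norm_mult)
      qed
    qed (simp add: split_beta')
    have dim: "\<bar>1 / e m\<bar> ^ DIM(real^'n) = (1 / e m) ^ CARD('n)" "\<bar>e m\<bar> ^ DIM(real^'n) = e m ^ CARD('n)"
      using e(1)[of m] by simp_all
    have inner: "(LINT \<xi>|lborel. ?E x \<xi> * g x * gauss (e m *\<^sub>R \<xi>)) =
        g x * (complex_of_real ((1 / e m) ^ CARD('n)) * (?S * gauss ((1 / e m) *\<^sub>R x)))" for x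
    proof -
      have "(LINT \<xi>|lborel. ?E x \<xi> * g x * gauss (e m *\<^sub>R \<xi>)) = g x * (LINT \<xi>|lborel. ?E x \<xi> * gauss (e m *\<^sub>R \<xi>))"
        by (simp only: integral_mult_right_zero[symmetric] mult_ac)
      also have "(LINT \<xi>|lborel. ?E x \<xi> * gauss (e m *\<^sub>R \<xi>)) =
          \<bar>1 / e m\<bar> ^ DIM(real^'n) *\<^sub>R (LINT \<xi>|lborel. ?E x (0 + (1 / e m) *\<^sub>R \<xi>) * gauss (e m *\<^sub>R (0 + (1 / e m) *\<^sub>R \<xi>)))"
        using e(1)[of m] by (intro lborel_integral_affine) auto
      also have "(LINT \<xi>|lborel. ?E x (0 + (1 / e m) *\<^sub>R \<xi>) * gauss (e m *\<^sub>R (0 + (1 / e m) *\<^sub>R \<xi>))) = fourier gauss ((1 / e m) *\<^sub>R x)"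
        unfolding fourier_def using e(1)[of m] by (intro Bochner_Integration.integral_cong) (auto simp: inner_commute)
      also have "fourier gauss ((1 / e m) *\<^sub>R x) = ?S * gauss ((1 / e m) *\<^sub>R x)"
        by (rule fourier_gauss(2))
      finally show ?thesis
        by (simp only: scaleR_conv_of_real dim)
    qed
    have "(LINT \<xi>|lborel. fourier g \<xi> * gauss (e m *\<^sub>R \<xi>)) = (LINT \<xi>|lborel. LINT x|lborel. ?E x \<xi> * g x * gauss (e m *\<^sub>R \<xi>))"
      by (simp add: fourier_def)
    also have "\<dots> = (LINT x|lborel. LINT \<xi>|lborel. ?E x \<xi> * g x * gauss (e m *\<^sub>R \<xi>))"
      using lborel_pair.Fubini_integral[OF pint] by simp
    also have "\<dots> = (LINT x|lborel. g x * (complex_of_real ((1 / e m) ^ CARD('n)) * (?S * gauss ((1 / e m) *\<^sub>R x))))"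
      unfolding inner ..
    also have "\<dots> = \<bar>e m\<bar> ^ DIM(real^'n) *\<^sub>R (LINT x|lborel. g (0 + e m *\<^sub>R x) * (complex_of_real ((1 / e m) ^ CARD('n)) * (?S * gauss ((1 / e m) *\<^sub>R (0 + e m *\<^sub>R x)))))"
      using e(1)[of m] by (intro lborel_integral_affine) auto
    also have "\<dots> = (LINT x|lborel. complex_of_real (e m ^ CARD('n)) * (g (0 + e m *\<^sub>R x) * (complex_of_real ((1 / e m) ^ CARD('n)) * (?S * gauss ((1 / e m) *\<^sub>R (0 + e m *\<^sub>R x))))))"
      by (simp only: dim scaleR_conv_of_real integral_mult_right_zero)
    also have "\<dots> = (LINT x|lborel. g (e m *\<^sub>R x) * (?S * gauss x))"
    proof (intro Bochner_Integration.integral_cong refl)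
      fix x :: "real^'n"
      let ?A = "complex_of_real (e m ^ CARD('n))" and ?B = "complex_of_real ((1 / e m) ^ CARD('n))"
      have AB: "?A * ?B = 1"
        using e(1)[of m] unfolding of_real_mult[symmetric] power_mult_distrib[symmetric] by simp
      have cancel: "?A * (a * (?B * z)) = a * z" for a z
      proof -
        have "?A * (a * (?B * z)) = (?A * ?B) * (a * z)" by (simp only: mult_ac)
        then show ?thesis by (simp only: AB mult_1)
      qed
      have "(1 / e m) *\<^sub>R (0 + e m *\<^sub>R x) = x" using e(1)[of m] by simp
      then show "complex_of_real (e m ^ CARD('n)) * (g (0 + e m *\<^sub>R x) * (complex_of_real ((1 / e m) ^ CARD('n)) *
          (?S * gauss ((1 / e m) *\<^sub>R (0 + e m *\<^sub>R x))))) =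
          g (e m *\<^sub>R x) * (?S * gauss x)"
        by (simp only: cancel add_0)
    qed
    finally show ?thesis .
  qed
  have lim1: "(\<lambda>m. LINT \<xi>|lborel. fourier g \<xi> * gauss (e m *\<^sub>R \<xi>)) \<longlonglongrightarrow> (LINT \<xi>|lborel. fourier g \<xi>)"
  proof (rule integral_dominated_convergence[where w = "\<lambda>\<xi>. norm (fourier g \<xi>)"])
    show "integrable lborel (\<lambda>\<xi>. norm (fourier g \<xi>))"
      by (intro integrable_norm schwartz_integrable schwartz_fourier g)
    show "AE \<xi> in lborel. (\<lambda>m. fourier g \<xi> * gauss (e m *\<^sub>R \<xi>)) \<longlonglongrightarrow> fourier g \<xi>"
    proof (intro AE_I2)
      fix \<xi>
      have "(\<lambda>m. fourier g \<xi> * gauss (e m *\<^sub>R \<xi>)) \<longlonglongrightarrow> fourier g \<xi> * gauss (0 *\<^sub>R \<xi>)"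
        by (intro tendsto_intros e) auto
      then show "(\<lambda>m. fourier g \<xi> * gauss (e m *\<^sub>R \<xi>)) \<longlonglongrightarrow> fourier g \<xi>" by simp
    qed
    show "AE \<xi> in lborel. norm (fourier g \<xi> * gauss (e m *\<^sub>R \<xi>)) \<le> norm (fourier g \<xi>)" for m
      by (auto simp: norm_mult intro!: mult_right_le_one_le)
  qed measurable
  obtain C where C: "C \<ge> 0" "\<And>x. (1 + norm x) ^ 0 * norm (g x) \<le> C"
    by (rule schwartz_bounded[OF g]) (rule that)
  have lim2: "(\<lambda>m. LINT x|lborel. g (e m *\<^sub>R x) * (?S * gauss x))
     \<longlonglongrightarrow> (LINT x|lborel. g 0 * (?S * gauss (x::real^'n)))"
  proof (rule integral_dominated_convergence[where w = "\<lambda>x. C * norm (?S * gauss x)"])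
    show "integrable lborel (\<lambda>x::real^'n. C * norm (?S * gauss x))"
      by (intro integrable_mult_right integrable_norm gauss_integral)
    show "AE x in lborel. (\<lambda>m. g (e m *\<^sub>R x) * (?S * gauss x))
         \<longlonglongrightarrow> g 0 * (?S * gauss x)"
    proof (intro AE_I2 tendsto_mult tendsto_const)
      fix x :: "real^'n"
      have "(\<lambda>m. e m *\<^sub>R x) \<longlonglongrightarrow> 0 *\<^sub>R x" by (intro tendsto_intros e)
      then show "(\<lambda>m. g (e m *\<^sub>R x)) \<longlonglongrightarrow> g 0"
        using schwartz_continuous[OF g, of UNIV] by (intro continuous_on_tendsto_compose[of UNIV g]) auto
    qed
    show "AE x in lborel. norm (g (e m *\<^sub>R x) * (?S * gauss x)) \<le> C * norm (?S * gauss x)" for m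
      using C(2) by (intro AE_I2) (simp only: norm_mult, intro mult_right_mono, auto)
  qed measurable
  have "(LINT \<xi>|lborel. fourier g \<xi>) = (LINT x|lborel. g 0 * (?S * gauss (x::real^'n)))"
    using lim1 lim2 unfolding key by (rule LIMSEQ_unique)
  also have "\<dots> = g 0 * (?S * ?S)"
    by (simp only: integral_mult_right_zero gauss_integral)
  also have "\<dots> = complex_of_real ((2 * pi) ^ CARD('n)) * g 0"
  proof -
    have "sqrt (2 * pi) ^ CARD('n) * sqrt (2 * pi) ^ CARD('n) = (2 * pi) ^ CARD('n)"
      unfolding power_mult_distrib[symmetric] by simp
    then show ?thesis
      by (simp only: of_real_mult[symmetric] mult.commute)
  qed
  finally show ?thesis .
qed

text \<open>A translation moves the point of evaluation to the origin and multiplies the transform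
  by a character, which reduces the claim to \<open>integral_fourier\<close>.\<close>

lemma fourier_inversion:
  fixes g :: "real^'n::finite \<Rightarrow> complex"
  assumes g: "schwartz g"
  shows "fourier (fourier g) x = complex_of_real ((2 * pi) ^ CARD('n)) * g (- x)"
proof -
  have "schwartz (\<lambda>y. g (y + (- x)))"
    using schwartz_affine[OF g, of 1 "- x"] by simp
  from integral_fourier[OF this]
  have "(LINT \<xi>|lborel. exp (\<i> * complex_of_real ((- x) \<bullet> \<xi>)) * fourier g \<xi>) = complex_of_real ((2 * pi) ^ CARD('n)) * g (- x)"
    by (simp only: fourier_shift[OF g]) simp
  then show ?thesis
    by (simp add: fourier_def[of "fourier g"] inner_commute)
qed

lemma fourier_inject:
  fixes g h :: "real^'n::finite \<Rightarrow> complex"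
  assumes "schwartz g" "schwartz h" "\<And>\<xi>. fourier g \<xi> = fourier h \<xi>"
  shows "g = h"
proof
  fix x
  have "fourier g = fourier h" using assms(3) by auto
  then show "g x = h x"
    using fourier_inversion[OF assms(1), of "- x"] fourier_inversion[OF assms(2), of "- x"] by simp
qed

text \<open>By inversion, the transform of the reflected function divided by (2 pi)^n is a
  preimage.\<close>

lemma fourier_surj:
  fixes h :: "real^'n::finite \<Rightarrow> complex"
  assumes h: "schwartz h"
  obtains g where "schwartz g" "\<And>\<xi>. fourier g \<xi> = h \<xi>"
proof
  let ?c = "complex_of_real ((2 * pi) ^ CARD('n))"
  define k where "k = (\<lambda>x. (1 / ?c) * h (- x))"
  have k: "schwartz k"
    unfolding k_def using schwartz_reflect[OF h, of 0] by (intro schwartz_cmult) simp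
  show "schwartz (fourier k)" by (rule schwartz_fourier[OF k])
  show "fourier (fourier k) \<xi> = h \<xi>" for \<xi>
    unfolding fourier_inversion[OF k] by (simp add: k_def)
qed

section \<open>Dyadic partitions and the low-pass function\<close>

lemma partials_cong_open:
  assumes "open U" and "\<And>x. x \<in> U \<Longrightarrow> f x = g x" and "x \<in> U"
  shows "partials is f x = partials is g x"
  using assms(3)
proof (induction "is" arbitrary: x)
  case (Cons i "is")
  let ?f = "partials is f" and ?g = "partials is g"
  have "((\<lambda>t. x + t *\<^sub>R axis i 1) \<longlongrightarrow> x + 0 *\<^sub>R axis i 1) (nhds 0)"
    by (intro tendsto_intros filterlim_ident)
  then have "\<forall>\<^sub>F t in nhds 0. x + t *\<^sub>R axis i 1 \<in> U"
    using topological_tendstoD[OF _ assms(1)] Cons.prems by force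
  then have "\<forall>\<^sub>F t in nhds 0. t \<in> UNIV \<longrightarrow> ?f (x + t *\<^sub>R axis i 1) = ?g (x + t *\<^sub>R axis i 1)"
    by eventually_elim (simp add: Cons.IH)
  then have "vector_derivative (\<lambda>t. ?f (x + t *\<^sub>R axis i 1)) (at 0) = vector_derivative (\<lambda>t. ?g (x + t *\<^sub>R axis i 1)) (at 0)"
    by (rule vector_derivative_cong_eq) auto
  then show ?case
    by (simp add: partial_deriv_def[of i "partials is f"] partial_deriv_def[of i "partials is g"])
qed (simp add: assms)

lemma differentiable_cong_open:
  assumes "g differentiable (at x)" and "open U" "x \<in> U" "\<And>y. y \<in> U \<Longrightarrow> g y = f y"
  shows "f differentiable (at x)"
proof -
  obtain D where "(g has_derivative D) (at x)" using assms(1) by (auto simp: differentiable_def)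
  from has_derivative_transform_within_open[OF this assms(2-4)]
  show ?thesis by (auto simp: differentiable_def)
qed

lemma partials_const_diff:
  assumes "schwartz g"
  shows "partials is (\<lambda>x. c - g x) = (\<lambda>x. (if is = [] then c else 0) - partials is g x)"
proof (induction "is")
  case (Cons i "is")
  let ?c = "if is = [] then c else 0"
  have "partial_deriv i (\<lambda>x::real^'a. ?c) x = 0" for x
    by (rule partial_derivI[of _ "\<lambda>_. 0"]) auto
  then have "partial_deriv i (\<lambda>x. 1 * ?c + (-1) * partials is g x) x = - partial_deriv i (partials is g) x" for x
    using schwartz_differentiable[OF schwartz_partials[OF assms]]
    by (subst partial_deriv_lincomb) auto
  then show ?case
    unfolding foldr.simps comp_apply Cons by (simp add: fun_eq_iff)
qed simp

text \<open>Because \<open>r < R\<close>, the open sets |x| < R and |x| > r cover the space, and on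
  each of them \<open>h\<close> coincides with a smooth function. Derivatives are local, and decay
  is automatic because \<open>h\<close> vanishes for |x| > r.\<close>

lemma schwartz_cutoff:
  assumes "schwartz S" and near: "\<And>x. norm x < R \<Longrightarrow> h x = 1 - S x" and far: "\<And>x. r < norm x \<Longrightarrow> h x = 0"
    and "0 < r" "r < R"
  shows "schwartz h"
  unfolding schwartz_iff
proof (intro conjI allI)
  have near': "partials is h x = (if is = [] then 1 else 0) - partials is S x" if "norm x < R" for "is" x
    using partials_cong_open[of "ball 0 R" h "\<lambda>x. 1 - S x" x "is"] near that
    by (simp add: partials_const_diff[OF assms(1)])
  have zero: "partials is (\<lambda>x::real^'a. 0::complex) = (\<lambda>x. 0)" for "is"
    using partials_diff[OF schwartz_zero schwartz_zero, of "is"] by simp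
  have opn: "open {x::real^'a. r < norm x}"
    by (intro open_Collect_less continuous_intros)
  have far': "partials is h x = 0" if "r < norm x" for "is" x
    using partials_cong_open[OF opn, of h "\<lambda>x. 0" x "is"] far that by (simp add: zero)
  show "partials is h differentiable (at x)" for "is" x
  proof (cases "r < norm x")
    case True
    show ?thesis
      by (rule differentiable_cong_open[of "\<lambda>x. 0", OF _ opn]) (use True far' in auto)
  next
    case False
    let ?c = "(if is = [] then 1 else 0) :: complex"
    have "(\<lambda>x. ?c - partials is S x) differentiable (at x)"
      by (intro derivative_intros schwartz_differentiable schwartz_partials assms)
    then show ?thesis
      by (rule differentiable_cong_open[of _ _ "ball 0 R"]) (use False near' assms in auto)
  qed
  show "\<exists>C. \<forall>x. (1 + norm x) ^ k * norm (partials is h x) \<le> C" for "is" k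
  proof -
    obtain C where C: "C \<ge> 0" "\<And>x. (1 + norm x) ^ 0 * norm (partials is S x) \<le> C"
      by (rule schwartz_bounded[OF schwartz_partials[OF assms(1)]]) (rule that)
    have "(1 + norm x) ^ k * norm (partials is h x) \<le> (1 + r) ^ k * (1 + C)" for x
    proof (cases "r < norm x")
      case True
      then show ?thesis using far' C assms by simp
    next
      case False
      then have eq: "partials is h x = (if is = [] then 1 else 0) - partials is S x"
        using assms by (intro near') simp
      have "norm (partials is h x) \<le> norm (if is = [] then 1 else 0 :: complex) + norm (partials is S x)"
        unfolding eq by (rule norm_triangle_ineq4)
      also have "\<dots> \<le> 1 + C" using C(2)[of x] by (intro add_mono) auto
      finally show ?thesis using False C(1) assms by (intro mult_mono power_mono) auto
    qed
    then show ?thesis by blast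
  qed
qed

section \<open>Dyadic dilations and their Fourier transforms\<close>

lemma fourier_dyadic_dilation:
  fixes g :: "real^'n::finite \<Rightarrow> complex"
  assumes g: "schwartz g"
  shows "fourier (dyadic_dilation \<nu> g) \<xi> = fourier g ((2 powi (- \<nu>)) *\<^sub>R \<xi>)"
proof -
  define s :: real where "s = 2 powi \<nu>"
  have s: "s > 0" by (simp add: s_def)
  have [measurable]: "g \<in> borel_measurable borel" by (rule schwartz_borel[OF g])
  have inner: "(0 + s *\<^sub>R x) \<bullet> ((2 powi (- \<nu>)) *\<^sub>R \<xi>) = x \<bullet> \<xi>" for x
    using s by (simp add: power_int_minus s_def[symmetric])
  have "fourier g ((2 powi (- \<nu>)) *\<^sub>R \<xi>) = \<bar>s\<bar> ^ DIM(real^'n) *\<^sub>R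
      (LINT x|lborel. exp (- (\<i> * complex_of_real ((0 + s *\<^sub>R x) \<bullet> ((2 powi (- \<nu>)) *\<^sub>R \<xi>)))) * g (0 + s *\<^sub>R x))"
    unfolding fourier_def using s by (intro lborel_integral_affine) auto
  also have "\<dots> = fourier (dyadic_dilation \<nu> g) \<xi>"
    unfolding inner
    unfolding fourier_def dyadic_dilation_def scaleR_conv_of_real[where 'a = complex] integral_mult_right_zero[symmetric] s_def[symmetric]
    using s by (intro Bochner_Integration.integral_cong)
      (auto simp: power_int_mult power_int_minus s_def[symmetric] mult_ac)
  finally show ?thesis ..
qed

lemma dyadic_dilation_eq:
  fixes g :: "real^'n::finite \<Rightarrow> complex"
  shows "dyadic_dilation \<nu> g = (\<lambda>x. complex_of_real ((2 powi \<nu>) ^ CARD('n)) * g ((2 powi \<nu>) *\<^sub>R x + 0))"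
  by (auto simp: dyadic_dilation_def power_int_mult)

lemma schwartz_dyadic_dilation: "schwartz g \<Longrightarrow> schwartz (dyadic_dilation \<nu> g)"
  unfolding dyadic_dilation_eq by (intro schwartz_cmult schwartz_affine) auto

lemma partials_dyadic_dilation:
  fixes g :: "real^'n::finite \<Rightarrow> complex"
  assumes "schwartz g"
  shows "partials is (dyadic_dilation \<nu> g) =
    (\<lambda>x. complex_of_real ((2 powi \<nu>) ^ (CARD('n) + length is)) * partials is g ((2 powi \<nu>) *\<^sub>R x))"
  unfolding dyadic_dilation_eq
  by (subst partials_affine[OF assms]) (auto simp: power_add)

locale dyadic_partition =
  fixes \<phi> :: "real^'n::finite \<Rightarrow> complex" and r R :: real
  assumes r_pos: "0 < r" and schwartz: "schwartz \<phi>"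
    and support: "fourier \<phi> \<xi> \<noteq> 0 \<Longrightarrow> r \<le> norm \<xi> \<and> norm \<xi> \<le> R"
    and partition: "\<xi> \<noteq> 0 \<Longrightarrow> ((\<lambda>\<nu>::int. fourier \<phi> ((2 powi (- \<nu>)) *\<^sub>R \<xi>)) has_sum 1) UNIV"
begin

text \<open>The prescribed Fourier transform of \<open>low_pass \<phi>\<close>, named before that
  function is known to exist.\<close>

definition profile :: "real^'n \<Rightarrow> complex" where
  "profile \<xi> = 1 - (\<Sum>\<nu>. fourier \<phi> ((2 powi (- int \<nu>)) *\<^sub>R \<xi>))"

lemma fourier_large_index:
  assumes "norm \<xi> < 2 ^ M * r" and "M \<le> \<nu>"
  shows "fourier \<phi> ((2 powi (- int \<nu>)) *\<^sub>R \<xi>) = 0"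
proof (rule ccontr)
  assume "fourier \<phi> ((2 powi (- int \<nu>)) *\<^sub>R \<xi>) \<noteq> 0"
  then have "r \<le> norm \<xi> / 2 ^ \<nu>"
    using support by (fastforce simp: power_int_minus divide_inverse mult.commute)
  then have "2 ^ \<nu> * r \<le> norm \<xi>" by (simp add: field_simps)
  moreover have "2 ^ M * r \<le> 2 ^ \<nu> * r"
    using assms(2) r_pos by (intro mult_right_mono power_increasing) auto
  ultimately show False using assms(1) by simp
qed

text \<open>The support annulus stays away from 0, so terms of large index vanish. The number
  \<open>M\<close> of remaining terms is common to a whole ball, which is what smoothness of
  \<open>profile\<close> requires.\<close>

lemma profile_eq:
  assumes "norm \<xi> < 2 ^ M * r"
  shows "profile \<xi> = 1 - (\<Sum>\<nu><M. fourier \<phi> ((2 powi (- int \<nu>)) *\<^sub>R \<xi>))"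
  unfolding profile_def
  by (subst suminf_finite[of "{..<M}"]) (auto simp: fourier_large_index[OF assms])

lemma profile_near_zero: "norm \<xi> < r \<Longrightarrow> profile \<xi> = 1"
  using profile_eq[of \<xi> 0] by simp

lemma exists_scale: "\<exists>M. x < 2 ^ M * r"
proof -
  obtain M where "x / r < 2 ^ M" using real_arch_pow[of 2 "x / r"] by auto
  then show ?thesis using r_pos by (auto simp: field_simps)
qed

text \<open>Beyond radius \<open>R\<close> the terms with negative index leave the support as well,
  so the one-sided sum in \<open>profile\<close> is already the full partition, with sum 1.\<close>

lemma profile_far:
  assumes "R < norm \<xi>"
  shows "profile \<xi> = 0"
proof (cases "\<xi> = 0")
  \<comment> \<open>This occurs only for R < 0, when the transform of \<phi> would vanish
    identically; the partition condition at a nonzero vector excludes it.\<close>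
  case True
  obtain M where "norm \<xi> < 2 ^ M * r" using exists_scale by blast
  have "fourier \<phi> \<eta> = 0" for \<eta>
    by (rule ccontr) (use support[of \<eta>] assms True norm_ge_zero[of \<eta>] in simp)
  moreover have "((\<lambda>\<nu>::int. fourier \<phi> ((2 powi (- \<nu>)) *\<^sub>R axis undefined 1)) has_sum 1) UNIV"
    by (rule partition) (simp add: axis_eq_0_iff)
  ultimately have "((\<lambda>\<nu>::int. 0 :: complex) has_sum 1) UNIV" by simp
  from has_sum_unique[OF this has_sum_0] have "(1 :: complex) = 0" by simp
  then show ?thesis by simp
next
  case False
  obtain M where M: "norm \<xi> < 2 ^ M * r" using exists_scale by blast
  have neg: "fourier \<phi> ((2 powi (- \<nu>)) *\<^sub>R \<xi>) = 0" if "\<nu> < 0" for \<nu> :: int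
  proof (rule ccontr)
    assume "fourier \<phi> ((2 powi (- \<nu>)) *\<^sub>R \<xi>) \<noteq> 0"
    then have "2 powi (- \<nu>) * norm \<xi> \<le> R" using support by fastforce
    moreover have "(1::real) \<le> 2 powi (- \<nu>)"
      using power_int_increasing[of 0 "- \<nu>" "2::real"] that by simp
    then have "1 * norm \<xi> \<le> 2 powi (- \<nu>) * norm \<xi>" by (rule mult_right_mono) simp
    ultimately show False using assms by simp
  qed
  have big: "fourier \<phi> ((2 powi (- \<nu>)) *\<^sub>R \<xi>) = 0" if "int M \<le> \<nu>" for \<nu> :: int
    using fourier_large_index[OF M, of "nat \<nu>"] that by simp
  have "((\<lambda>\<nu>::int. fourier \<phi> ((2 powi (- \<nu>)) *\<^sub>R \<xi>)) has_sum 1) {0..<int M}"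
    using partition[OF False]
    by (subst has_sum_cong_neutral[of UNIV "{0..<int M}"]) (auto simp: neg big)
  then have "(\<Sum>\<nu>\<in>{0..<int M}. fourier \<phi> ((2 powi (- \<nu>)) *\<^sub>R \<xi>)) = 1"
    by (metis finite_atLeastLessThan_int has_sum_finite has_sum_unique)
  moreover have "(\<Sum>\<nu>\<in>{0..<int M}. fourier \<phi> ((2 powi (- \<nu>)) *\<^sub>R \<xi>)) = (\<Sum>\<nu><M. fourier \<phi> ((2 powi (- int \<nu>)) *\<^sub>R \<xi>))"
    by (rule sum.reindex_bij_witness[of _ int nat]) auto
  ultimately show ?thesis using profile_eq[OF M] by simp
qed

lemma schwartz_profile: "schwartz profile"
proof -
  \<comment> \<open>The cutoff needs a positive inner radius, whatever the sign of \<open>R\<close>.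
    \<open>M\<close> makes the finite-sum formula valid on a ball reaching beyond
    \<open>R'\<close>.\<close>
  define R' where "R' = max R 1"
  obtain M where M: "R' < 2 ^ M * r" using exists_scale by blast
  show ?thesis
  proof (rule schwartz_cutoff[where R = "2 ^ M * r" and r = R'])
    show "schwartz (\<lambda>\<xi>. \<Sum>\<nu><M. fourier \<phi> ((2 powi (- int \<nu>)) *\<^sub>R \<xi> + 0))"
      by (intro schwartz_sum schwartz_affine schwartz_fourier schwartz) auto
    show "profile \<xi> = 1 - (\<Sum>\<nu><M. fourier \<phi> ((2 powi (- int \<nu>)) *\<^sub>R \<xi> + 0))" if "norm \<xi> < 2 ^ M * r" for \<xi>
      using profile_eq[OF that] by simp
  qed (use M in \<open>auto simp: R'_def intro: profile_far\<close>)
qed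

text \<open>Existence comes from surjectivity of the Fourier transform on Schwartz functions, and
  its injectivity gives the uniqueness that \<open>THE\<close> demands.\<close>

lemma low_pass: "schwartz (low_pass \<phi>) \<and> (\<forall>\<xi>. fourier (low_pass \<phi>) \<xi> = profile \<xi>)"
proof -
  obtain g where g: "schwartz g" "\<And>\<xi>. fourier g \<xi> = profile \<xi>"
    by (rule fourier_surj[OF schwartz_profile]) (rule that)
  have "\<exists>!g. schwartz g \<and> (\<forall>\<xi>. fourier g \<xi> = profile \<xi>)"
  proof
    show "schwartz g \<and> (\<forall>\<xi>. fourier g \<xi> = profile \<xi>)" using g by blast
    show "g' = g" if "schwartz g' \<and> (\<forall>\<xi>. fourier g' \<xi> = profile \<xi>)" for g'
      using that g by (intro fourier_inject) auto
  qed
  from theI'[OF this] show ?thesis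
    unfolding low_pass_def profile_def .
qed

abbreviation \<Phi> :: "real^'n \<Rightarrow> complex" where "\<Phi> \<equiv> low_pass \<phi>"

lemma schwartz_\<Phi>: "schwartz \<Phi>" using low_pass by blast

lemma fourier_\<Phi>: "fourier \<Phi> \<xi> = profile \<xi>" using low_pass by blast

text \<open>Halving \<xi> shifts the summation index by one, so only the term with \<nu> = 0 is
  left. The sum at \<xi> is taken with one term more than the sum at \<xi> / 2 to make the two
  match.\<close>

lemma profile_diff: "profile ((1 / 2) *\<^sub>R \<xi>) - profile \<xi> = fourier \<phi> \<xi>"
proof -
  obtain M where M: "norm \<xi> < 2 ^ M * r" using exists_scale by blast
  have pos: "0 < 2 ^ M * r" using r_pos by simp
  have "norm \<xi> < 2 * (2 ^ M * r)" using M pos by linarith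
  then have large: "norm \<xi> < 2 ^ Suc M * r" by simp
  have "norm ((1 / 2) *\<^sub>R \<xi>) = norm \<xi> / 2" by simp
  also have "\<dots> < 2 ^ M * r" using M pos by linarith
  finally have "norm ((1 / 2) *\<^sub>R \<xi>) < 2 ^ M * r" .
  from profile_eq[OF this] have "profile ((1 / 2) *\<^sub>R \<xi>) = 1 - (\<Sum>\<nu><M. fourier \<phi> ((2 powi (- int (Suc \<nu>))) *\<^sub>R \<xi>))"
    by (simp add: power_int_minus power_int_diff field_simps)
  moreover have "profile \<xi> = 1 - (\<Sum>\<nu><Suc M. fourier \<phi> ((2 powi (- int \<nu>)) *\<^sub>R \<xi>))"
    by (rule profile_eq[OF large])
  ultimately show ?thesis
    by (simp only: sum.lessThan_Suc_shift) simp
qed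

lemma dyadic_dilation_diff:
  "dyadic_dilation \<nu> \<phi> = (\<lambda>x. dyadic_dilation (\<nu> + 1) \<Phi> x - dyadic_dilation \<nu> \<Phi> x)"
proof (rule fourier_inject)
  show "schwartz (dyadic_dilation \<nu> \<phi>)" by (intro schwartz_dyadic_dilation schwartz)
  show "schwartz (\<lambda>x. dyadic_dilation (\<nu> + 1) \<Phi> x - dyadic_dilation \<nu> \<Phi> x)"
    by (intro schwartz_diff schwartz_dyadic_dilation schwartz_\<Phi>)
  fix \<xi> :: "real^'n"
  have scale: "((2::real) powi (- (\<nu> + 1))) *\<^sub>R \<xi> = (1 / 2) *\<^sub>R ((2 powi (- \<nu>)) *\<^sub>R \<xi>)"
  proof -
    have "(2::real) powi (- (\<nu> + 1)) = 1 / 2 * 2 powi (- \<nu>)"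
      by (simp add: power_int_diff)
    then show ?thesis by (simp only: scaleR_scaleR)
  qed
  show "fourier (dyadic_dilation \<nu> \<phi>) \<xi> = fourier (\<lambda>x. dyadic_dilation (\<nu> + 1) \<Phi> x - dyadic_dilation \<nu> \<Phi> x) \<xi>"
    using profile_diff[of "(2 powi (- \<nu>)) *\<^sub>R \<xi>"]
    by (simp only: fourier_diff schwartz_dyadic_dilation schwartz_\<Phi> schwartz fourier_dyadic_dilation fourier_\<Phi> scale)
qed

text \<open>At each \<xi> the sum has finitely many nonzero terms; after shifting the index by N it
  is the series of \<open>profile\<close> at 2^N \<xi>.\<close>

lemma infsum_fourier:
  "1 - (\<Sum>\<^sub>\<infinity>\<nu>\<in>{- int N..}. fourier (dyadic_dilation \<nu> \<phi>) \<xi>) = fourier (dyadic_dilation (- int N) \<Phi>) \<xi>"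
proof -
  obtain M where M: "norm ((2 ^ N) *\<^sub>R \<xi>) < 2 ^ M * r" using exists_scale by blast
  have shift: "fourier (dyadic_dilation (int k - int N) \<phi>) \<xi> = fourier \<phi> ((2 powi (- int k)) *\<^sub>R ((2 ^ N) *\<^sub>R \<xi>))" for k
    by (simp add: fourier_dyadic_dilation schwartz power_int_diff power_int_minus field_simps)
  have "fourier (dyadic_dilation \<nu> \<phi>) \<xi> = 0" if "\<nu> \<ge> int M - int N" for \<nu>
    using fourier_large_index[OF M, of "nat (\<nu> + int N)"] shift[of "nat (\<nu> + int N)"] that by simp
  then have "(\<Sum>\<^sub>\<infinity>\<nu>\<in>{- int N..}. fourier (dyadic_dilation \<nu> \<phi>) \<xi>) = (\<Sum>\<^sub>\<infinity>\<nu>\<in>{- int N..<int M - int N}. fourier (dyadic_dilation \<nu> \<phi>) \<xi>)"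
    by (intro infsum_cong_neutral) auto
  also have "\<dots> = (\<Sum>\<nu>\<in>{- int N..<int M - int N}. fourier (dyadic_dilation \<nu> \<phi>) \<xi>)"
    by simp
  also have "\<dots> = (\<Sum>k<M. fourier (dyadic_dilation (int k - int N) \<phi>) \<xi>)"
    by (rule sum.reindex_bij_witness[of _ "\<lambda>k. int k - int N" "\<lambda>\<nu>. nat (\<nu> + int N)"]) auto
  finally show ?thesis
    using profile_eq[OF M] by (simp add: shift fourier_dyadic_dilation schwartz_\<Phi> fourier_\<Phi>)
qed

lemma integral_\<Phi>: "(LINT x|lborel. \<Phi> x) = 1"
  using fourier_\<Phi>[of 0] profile_near_zero[of 0] r_pos by (simp add: fourier_def)

end

section \<open>Approximate identity and the telescoped series\<close>

lemma corr_eq_conv_dist':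
  assumes "schwartz g" "schwartz \<psi>"
  shows "corr g \<psi> = conv_dist \<psi> (regular_dist (\<lambda>w. g (0 - w)))"
proof
  fix y
  have [measurable]: "g \<in> borel_measurable borel" "\<psi> \<in> borel_measurable borel"
    by (simp_all add: schwartz_borel assms)
  have "corr g \<psi> y = (LINT x|lborel. g ((y - x) - y) * \<psi> (y - x))"
    unfolding corr_def
    by (rule lborel_integral_reflect[symmetric, of "\<lambda>x. g (x - y) * \<psi> x"]) measurable
  then show "corr g \<psi> y = conv_dist \<psi> (regular_dist (\<lambda>w. g (0 - w))) y"
    by (simp add: conv_dist_def regular_dist_def)
qed

text \<open>The counterpart of \<open>partials_corr\<close> with the derivatives on \<psi>. This
  form is used for dilations of growing index, where derivatives of the dilated \<open>g\<close>
  would blow up.\<close>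

lemma partials_corr':
  assumes "schwartz g" "schwartz \<psi>"
  shows "partials is (corr g \<psi>) = corr g (partials is \<psi>)"
proof -
  have s: "schwartz (\<lambda>w. g (0 - w))" by (rule schwartz_reflect[OF assms(1)])
  obtain K where "tempered_functional (regular_dist (\<lambda>w. g (0 - w))) (2 * CARD('a)) K"
    by (rule tempered_regular_schwartz[OF s])
  then interpret u: tempered_functional "regular_dist (\<lambda>w. g (0 - w))" "2 * CARD('a)" K .
  have "partials is (corr g \<psi>) = conv_dist (partials is \<psi>) (regular_dist (\<lambda>w. g (0 - w)))"
    unfolding corr_eq_conv_dist'[OF assms] by (rule u.partials_conv_dist[OF assms(2)])
  also have "\<dots> = corr g (partials is \<psi>)"
    by (rule corr_eq_conv_dist'[symmetric]) (intro schwartz_partials assms)+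
  finally show ?thesis .
qed

lemma corr_dyadic_dilation:
  fixes g :: "real^'n::finite \<Rightarrow> complex"
  assumes "schwartz g" "schwartz \<psi>"
  shows "corr (dyadic_dilation \<nu> g) \<psi> y = (LINT z|lborel. \<psi> (y + (2 powi (- \<nu>)) *\<^sub>R z) * g z)"
proof -
  define s :: real where "s = 2 powi (- \<nu>)"
  have s: "s > 0" "2 powi \<nu> = 1 / s" by (simp_all add: s_def power_int_minus field_simps)
  have [measurable]: "g \<in> borel_measurable borel" "\<psi> \<in> borel_measurable borel"
    by (simp_all add: schwartz_borel assms)
  have "corr (dyadic_dilation \<nu> g) \<psi> y = \<bar>s\<bar> ^ DIM(real^'n) *\<^sub>R
     (LINT z|lborel. complex_of_real ((1 / s) ^ CARD('n)) * g ((1 / s) *\<^sub>R ((y + s *\<^sub>R z) - y)) * \<psi> (y + s *\<^sub>R z))"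
    unfolding corr_def dyadic_dilation_eq s(2)
    using s(1) by (subst lborel_integral_affine[of _ s y]) auto
  also have "\<dots> = (LINT z|lborel. \<psi> (y + s *\<^sub>R z) * g z)"
  proof -
    have "complex_of_real (s ^ CARD('n)) * complex_of_real ((1 / s) ^ CARD('n)) = 1"
      using s(1) unfolding of_real_mult[symmetric] power_mult_distrib[symmetric] by simp
    moreover have "(LINT z|lborel. complex_of_real ((1 / s) ^ CARD('n)) * g ((1 / s) *\<^sub>R ((y + s *\<^sub>R z) - y)) * \<psi> (y + s *\<^sub>R z)) =
       complex_of_real ((1 / s) ^ CARD('n)) * (LINT z|lborel. \<psi> (y + s *\<^sub>R z) * g z)"
      using s(1) by (simp add: integral_mult_right_zero[symmetric] mult_ac del: integral_mult_right_zero of_real_power)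
    ultimately show ?thesis
      using s(1) by (simp only: scaleR_conv_of_real[where 'a = complex] mult.assoc[symmetric]) simp
  qed
  finally show ?thesis by (simp add: s_def)
qed

context tempered_functional
begin

text \<open>Because \<open>g\<close> has integral 1, the difference of correlation and \<psi> is an
  average of increments of \<psi> with step s z, where s = 2^(N - k). The Lipschitz estimate bounds
  its seminorm by a multiple of s (1 + s)^d; the factor (1 + s)^d is present because s exceeds 1 for
  k < N.\<close>

lemma corr_approx_identity:
  assumes g: "schwartz g" and int: "(LINT x|lborel. g x) = 1" and \<psi>: "schwartz \<psi>"
  shows "(\<lambda>k. u (corr (dyadic_dilation (int k - int N) g) \<psi>)) \<longlonglongrightarrow> u \<psi>"
proof -
  obtain K where K: "K \<ge> 0" "\<And>is z v. length is \<le> d \<Longrightarrow> (1 + norm z) ^ d *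
    norm (partials is \<psi> (z + v) - (\<Sum>j<1. of_real (1 / fact j) * (dir_deriv v ^^ j) (partials is \<psi>) z))
      \<le> K * norm v ^ 1 * (1 + norm v) ^ d"
    by (rule schwartz_taylor_lists[OF \<psi>, where k = d and d = d and p = 1]) (rule that)
  define s :: "nat \<Rightarrow> real" where "s k = 2 powi (- (int k - int N))" for k
  have s: "s k > 0" "s k = 2 ^ N / 2 ^ k" for k
    by (simp_all add: s_def power_int_diff)
  let ?I = "LINT z|lborel. (1 + norm z) ^ Suc d * norm (g z)"
  have sl: "s \<longlonglongrightarrow> 0"
  proof -
    have "(\<lambda>k. 2 ^ N * (1 / 2) ^ k :: real) \<longlonglongrightarrow> 2 ^ N * 0"
      by (intro tendsto_intros LIMSEQ_power_zero) auto
    moreover have "s = (\<lambda>k. 2 ^ N * (1 / 2) ^ k)"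
      by (auto simp: s(2) power_divide)
    ultimately show ?thesis by simp
  qed
  have le: "norm (u (corr (dyadic_dilation (int k - int N) g) \<psi>) - u \<psi>) \<le> c * (K * ?I * (s k * (1 + s k) ^ d))" for k
  proof -
    let ?D = "dyadic_dilation (int k - int N) g"
    have D: "schwartz ?D" by (rule schwartz_dyadic_dilation[OF g])
    have C: "schwartz (corr ?D \<psi>)" by (rule schwartz_corr[OF D \<psi>])
    show ?thesis
      unfolding diff[OF C \<psi>, symmetric]
    proof (rule bounded[OF schwartz_diff[OF C \<psi>]])
      fix "is" :: "'n list" and y assume len: "length is \<le> d"
      let ?\<psi> = "partials is \<psi>"
      have \<psi>': "schwartz ?\<psi>" by (rule schwartz_partials[OF \<psi>])
      have intg: "integrable lborel (\<lambda>z. ?\<psi> (y + s k *\<^sub>R z) * g z)"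
      proof -
        obtain B where B: "\<And>x. (1 + norm x) ^ 0 * norm (?\<psi> x) \<le> B"
          by (rule schwartz_bounded[OF \<psi>']) (rule that)
        have "(\<lambda>z. ?\<psi> (y + s k *\<^sub>R z)) \<in> borel_measurable borel"
          using schwartz_borel[OF \<psi>'] by measurable
        then show ?thesis using B by (intro integrable_poly_mult[of _ B 0] g) auto
      qed
      have "partials is (\<lambda>x. corr ?D \<psi> x - \<psi> x) y = corr ?D ?\<psi> y - ?\<psi> y"
        by (simp add: partials_diff[OF C \<psi>] partials_corr'[OF D \<psi>])
      also have "\<dots> = (LINT z|lborel. ?\<psi> (y + s k *\<^sub>R z) * g z) - ?\<psi> y * (LINT z|lborel. g z)"
        by (simp add: corr_dyadic_dilation[OF g \<psi>'] int s_def)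
      also have "\<dots> = (LINT z|lborel. (?\<psi> (y + s k *\<^sub>R z) - ?\<psi> y) * g z)"
        using intg schwartz_integrable[OF g] by (simp add: left_diff_distrib)
      finally have "(1 + norm y) ^ d * norm (partials is (\<lambda>x. corr ?D \<psi> x - \<psi> x) y) =
          norm (LINT z|lborel. complex_of_real ((1 + norm y) ^ d) * ((?\<psi> (y + s k *\<^sub>R z) - ?\<psi> y) * g z))"
        by (simp only: norm_weight_mult integral_mult_right_zero)
      also have "\<dots> \<le> (LINT z|lborel. (K * (s k * (1 + s k) ^ d)) * ((1 + norm z) ^ Suc d * norm (g z)))"
      proof (rule Bochner_Integration.integral_norm_bound_integral)
        show "integrable lborel (\<lambda>z. complex_of_real ((1 + norm y) ^ d) * ((?\<psi> (y + s k *\<^sub>R z) - ?\<psi> y) * g z))"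
          using intg schwartz_integrable[OF g] by (simp add: left_diff_distrib)
        show "integrable lborel (\<lambda>z. (K * (s k * (1 + s k) ^ d)) * ((1 + norm z) ^ Suc d * norm (g z)))"
          using integrable_weight_mult[OF g] by (rule integrable_mult_right)
        fix z :: "real^'n"
        have "(1 + norm y) ^ d * norm (?\<psi> (y + s k *\<^sub>R z) - ?\<psi> y) \<le> K * norm (s k *\<^sub>R z) * (1 + norm (s k *\<^sub>R z)) ^ d"
          using K(2)[OF len, of y "s k *\<^sub>R z"] by simp
        also have "\<dots> \<le> K * (s k * (1 + norm z)) * ((1 + s k) * (1 + norm z)) ^ d"
        proof (intro mult_mono power_mono K)
          show "norm (s k *\<^sub>R z) \<le> s k * (1 + norm z)" using s(1)[of k] by simp
          show "1 + norm (s k *\<^sub>R z) \<le> (1 + s k) * (1 + norm z)"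
            using s(1)[of k] by (simp add: algebra_simps)
        qed (use s(1)[of k] K(1) in auto)
        finally have "(1 + norm y) ^ d * norm (?\<psi> (y + s k *\<^sub>R z) - ?\<psi> y) * norm (g z) \<le>
            K * (s k * (1 + norm z)) * ((1 + s k) * (1 + norm z)) ^ d * norm (g z)"
          by (rule mult_right_mono) auto
        also have "K * (s k * w) * ((1 + s k) * w) ^ d * n = (K * (s k * (1 + s k) ^ d)) * (w ^ Suc d * n)" for w n
          by (simp add: power_mult_distrib)
        finally show "norm (complex_of_real ((1 + norm y) ^ d) * ((?\<psi> (y + s k *\<^sub>R z) - ?\<psi> y) * g z))
            \<le> (K * (s k * (1 + s k) ^ d)) * ((1 + norm z) ^ Suc d * norm (g z))"
          by (simp only: norm_weight_mult) (simp only: norm_mult mult.assoc)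
      qed
      also have "\<dots> = K * ?I * (s k * (1 + s k) ^ d)"
        by (simp only: integral_mult_right_zero) (simp only: mult_ac)
      finally show "(1 + norm y) ^ d * norm (partials is (\<lambda>x. corr ?D \<psi> x - \<psi> x) y)
          \<le> K * ?I * (s k * (1 + s k) ^ d)" .
    qed
  qed
  have "(\<lambda>k. c * (K * ?I * (s k * (1 + s k) ^ d))) \<longlonglongrightarrow> c * (K * ?I * (0 * (1 + 0) ^ d))"
    by (intro tendsto_intros sl)
  then have "(\<lambda>k. c * (K * ?I * (s k * (1 + s k) ^ d))) \<longlonglongrightarrow> 0" by simp
  with always_eventually[OF allI[OF le]]
  have "(\<lambda>k. u (corr (dyadic_dilation (int k - int N) g) \<psi>) - u \<psi>) \<longlonglongrightarrow> 0"
    by (rule Lim_null_comparison)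
  then show ?thesis by (rule LIM_zero_cancel)
qed

end

lemma corr_diff:
  assumes "schwartz g" "schwartz h" "schwartz \<psi>"
  shows "corr (\<lambda>x. g x - h x) \<psi> = (\<lambda>y. corr g \<psi> y - corr h \<psi> y)"
  unfolding corr_def left_diff_distrib
  by (intro ext Bochner_Integration.integral_diff integrable_shift_mult assms)

locale dyadic_decomposition = dyadic_partition \<phi> r R + tempered_functional u d c
  for \<phi> :: "real^'n::finite \<Rightarrow> complex" and r R and u :: "'n functional" and d c
begin

lemma lp_term_sums:
  assumes \<psi>: "schwartz \<psi>"
  shows "(\<lambda>k. lp_term \<phi> u N k \<psi>) sums (u \<psi> - u (corr (dyadic_dilation (- int N) \<Phi>) \<psi>))"
proof -
  let ?A = "\<lambda>k. u (corr (dyadic_dilation (int k - int N) \<Phi>) \<psi>)"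
  have D: "schwartz (dyadic_dilation \<nu> \<Phi>)" for \<nu>
    by (intro schwartz_dyadic_dilation schwartz_\<Phi>)
  have "lp_term \<phi> u N k \<psi> = ?A (Suc k) - ?A k" for k
  proof -
    have "lp_term \<phi> u N k \<psi> = u (corr (dyadic_dilation (int k - int N) \<phi>) \<psi>)"
      unfolding lp_term_def by (intro integral_conv_dist schwartz_dyadic_dilation schwartz \<psi>)
    also have "\<dots> = u (\<lambda>y. corr (dyadic_dilation (int k - int N + 1) \<Phi>) \<psi> y - corr (dyadic_dilation (int k - int N) \<Phi>) \<psi> y)"
      by (simp only: dyadic_dilation_diff[of "int k - int N"] corr_diff[OF D D \<psi>])
    also have "\<dots> = ?A (Suc k) - ?A k"
      by (subst diff) (auto intro: schwartz_corr D \<psi> simp: algebra_simps)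
    finally show ?thesis .
  qed
  moreover have "(\<lambda>k. ?A (Suc k) - ?A k) sums (u \<psi> - ?A 0)"
    by (intro telescope_sums corr_approx_identity schwartz_\<Phi> integral_\<Phi> \<psi>)
  ultimately show ?thesis by simp
qed

lemma lp_remainder_eq:
  assumes "schwartz \<psi>"
  shows "lp_remainder \<phi> u P N \<psi> = u (corr (dyadic_dilation (- int N) \<Phi>) \<psi>) - regular_dist (P N) \<psi>"
  unfolding lp_remainder_def sums_unique[OF lp_term_sums[OF assms, of N], symmetric] by simp

end

section \<open>Remainder estimates\<close>

text \<open>The summand is the smaller of t / 2^N and its reciprocal: two geometric series on either
  side of the scale 2^N = t. The bound is uniform in t and J.\<close>

lemma dyadic_peak_sum_le:
  fixes t :: real
  assumes "t > 0"
  shows "(\<Sum>N<J. if 1 \<le> t / 2 ^ N then 1 / (t / 2 ^ N) else t / 2 ^ N) \<le> 4"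
proof -
  \<comment> \<open>A potential for telescoping: the increment F (r / 2) - F r equals the summand
    for r < 1 and for r \<ge> 2 and dominates it in between, and F takes values between 0 and 4 on r
    > 0.\<close>
  define F :: "real \<Rightarrow> real" where "F r = (if 1 \<le> r then 1 / r else 4 - 2 * r)" for r
  have step: "(if 1 \<le> r then 1 / r else r) \<le> F (r / 2) - F r" if "r > 0" for r
  proof -
    consider "r < 1" | "1 \<le> r" "r < 2" | "2 \<le> r" by linarith
    then show ?thesis
    proof cases
      case 2
      then have "(r - 1) * (2 - r) \<ge> 0" by simp
      then have "r * (4 - r) \<ge> 2" using 2 by (simp add: algebra_simps)
      then have "4 - r \<ge> 2 / r" using 2 by (simp add: field_simps)
      then show ?thesis using 2 by (simp add: F_def)
    qed (use that in \<open>auto simp: F_def field_simps\<close>)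
  qed
  have "(\<Sum>N<J. if 1 \<le> t / 2 ^ N then 1 / (t / 2 ^ N) else t / 2 ^ N) \<le> (\<Sum>N<J. F (t / 2 ^ Suc N) - F (t / 2 ^ N))"
    using step[of "t / 2 ^ _"] assms by (intro sum_mono) (simp add: mult.commute)
  also have "\<dots> = F (t / 2 ^ J) - F (t / 2 ^ 0)"
    by (rule sum_lessThan_telescope)
  also have "\<dots> \<le> 4"
  proof -
    have "F r \<le> 4" "F r \<ge> 0" if "r > 0" for r
      using that order_trans[of "1 / r" 1 4] by (auto simp: F_def)
    then show ?thesis using assms by (smt (verit) divide_pos_pos zero_less_power)
  qed
  finally show ?thesis .
qed

lemma mi_power_scaleR: "mi_power (s *\<^sub>R x) \<alpha> = s ^ mi_size \<alpha> * mi_power (x::real^'n::finite) \<alpha>"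
  by (simp add: mi_power_def mi_size_def power_mult_distrib prod.distrib power_sum)

lemma mi_power_borel [measurable]: "(\<lambda>x::real^'n::finite. mi_power x \<alpha>) \<in> borel_measurable borel"
  unfolding mi_power_def by (intro borel_measurable_continuous_onI continuous_intros)

lemma integrable_mi_power_mult:
  assumes "schwartz \<psi>"
  shows "integrable lborel (\<lambda>x. complex_of_real (mi_power x \<alpha>) * \<psi> x)"
proof (rule integrable_poly_mult[of _ 1 "mi_size \<alpha>"])
  show "norm (complex_of_real (mi_power x \<alpha>)) \<le> 1 * (1 + norm x) ^ mi_size \<alpha>" for x :: "real^'a"
    using abs_mi_power_le[of x \<alpha>] power_mono[of "norm x" "1 + norm x" "mi_size \<alpha>"] by simp
qed (use assms in auto)

text \<open>The Taylor remainder of x \<mapsto> g (x - y) at x = 0, integrated against \<psi>.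
  Evaluating \<open>u\<close> at it pairs \<psi> with g * u minus the Taylor polynomial of g * u at
  0 with terms of degree below \<open>p\<close>.\<close>

definition taylor_gap :: "nat \<Rightarrow> (real^'n::finite \<Rightarrow> complex) \<Rightarrow> (real^'n \<Rightarrow> complex) \<Rightarrow> real^'n \<Rightarrow> complex" where
  "taylor_gap p \<psi> g y = corr g \<psi> y -
     (\<Sum>\<alpha> | mi_size \<alpha> < p. (of_real (1 / mi_fact \<alpha>) * (LINT x|lborel. of_real (mi_power x \<alpha>) * \<psi> x)) * mi_deriv \<alpha> g (0 - y))"

lemma schwartz_taylor_gap:
  assumes "schwartz g" "schwartz \<psi>"
  shows "schwartz (taylor_gap p \<psi> g)"
  unfolding taylor_gap_def[abs_def]
  by (intro schwartz_diff schwartz_corr schwartz_sum schwartz_cmult schwartz_reflect schwartz_mi_deriv finite_mi_size_less assms)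

lemma mi_deriv_partials:
  assumes "smooth g"
  shows "mi_deriv \<alpha> (partials is g) = partials is (mi_deriv \<alpha> g)"
  using partials_perm[OF assms, of "mi_list \<alpha> @ is" "is @ mi_list \<alpha>"] by (simp add: mi_deriv_eq)

text \<open>Differentiating the gap in y only replaces \<open>g\<close> by its derivative, so a
  pointwise bound for general g controls the whole seminorm.\<close>

lemma partials_taylor_gap:
  assumes g: "schwartz g" and \<psi>: "schwartz \<psi>"
  shows "partials is (taylor_gap p \<psi> g) = (\<lambda>y. (- 1) ^ length is * taylor_gap p \<psi> (partials is g) y)"
proof -
  let ?c = "\<lambda>\<alpha>. of_real (1 / mi_fact \<alpha>) * (LINT x|lborel. of_real (mi_power x \<alpha>) * \<psi> x)"
  let ?S = "\<lambda>y. \<Sum>\<alpha> | mi_size \<alpha> < p. ?c \<alpha> * mi_deriv \<alpha> g (0 - y)"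
  have S: "schwartz ?S"
    by (intro schwartz_sum schwartz_cmult schwartz_reflect schwartz_mi_deriv finite_mi_size_less g)
  have "partials is ?S = (\<lambda>y. \<Sum>\<alpha> | mi_size \<alpha> < p. ?c \<alpha> * partials is (\<lambda>y. mi_deriv \<alpha> g (0 - y)) y)"
    by (intro partials_sum schwartz_reflect schwartz_mi_deriv finite_mi_size_less g)
  also have "\<dots> = (\<lambda>y. (- 1) ^ length is * (\<Sum>\<alpha> | mi_size \<alpha> < p. ?c \<alpha> * mi_deriv \<alpha> (partials is g) (0 - y)))"
    by (simp add: partials_reflect[OF schwartz_mi_deriv[OF g], of "is" _ 0, simplified]
        mi_deriv_partials schwartz_smooth g sum_distrib_left mult_ac)
  finally show ?thesis
    unfolding taylor_gap_def[abs_def]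
    by (simp only: partials_diff[OF schwartz_corr[OF g \<psi>] S] partials_corr[OF g \<psi>] right_diff_distrib)
qed

text \<open>For a dilated function the expansion is that of \<open>G\<close> at base point -s y with
  increment s x. The increment contributes s^p, and \<open>schwartz_taylor\<close> gives decay in
  the base point, that is in s |y|; powers of |x| are absorbed by \<psi>.\<close>

lemma taylor_gap_scaled_bound:
  assumes G: "schwartz G" and \<psi>: "schwartz \<psi>"
  shows "\<exists>C\<ge>0. \<forall>a s y. 0 < s \<and> s \<le> 1 \<longrightarrow>
    norm (taylor_gap p \<psi> (\<lambda>x. a * G (s *\<^sub>R x)) y) \<le> C * (norm a * s ^ p / (1 + norm y * s) ^ k)"
proof -
  obtain C where C: "C \<ge> 0" "\<And>z v. (1 + norm z) ^ k *
    norm (G (z + v) - (\<Sum>j<p. of_real (1 / fact j) * (dir_deriv v ^^ j) G z)) \<le> C * norm v ^ p * (1 + norm v) ^ k"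
    by (rule schwartz_taylor[OF G, where k = k and p = p]) (rule that)
  let ?I = "LINT x|lborel. (1 + norm x) ^ (p + k) * norm (\<psi> x)"
  have "norm (taylor_gap p \<psi> (\<lambda>x. a * G (s *\<^sub>R x)) y) \<le> C * ?I * (norm a * s ^ p / (1 + norm y * s) ^ k)"
    if s: "0 < s" "s \<le> 1" for a s y
  proof -
    let ?g = "\<lambda>x. a * G (s *\<^sub>R x)"
    let ?w = "(1 + norm y * s) ^ k"
    have w: "?w > 0" using s by (intro zero_less_power) (simp add: add_pos_nonneg)
    have g: "schwartz ?g"
      using schwartz_cmult[OF schwartz_affine[OF G, of s 0], of a] s by simp
    have dg: "mi_deriv \<alpha> ?g z = a * of_real s ^ mi_size \<alpha> * mi_deriv \<alpha> G (s *\<^sub>R z)" for \<alpha> z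
      using partials_affine[OF G, of s "mi_list \<alpha>" a 0] s by (simp add: mi_deriv_eq length_mi_list)
    let ?c = "\<lambda>\<alpha> x. complex_of_real (1 / mi_fact \<alpha>) * (of_real (mi_power x \<alpha>) * \<psi> x) * mi_deriv \<alpha> ?g (0 - y)"
    have int: "integrable lborel (?c \<alpha>)" for \<alpha>
      by (intro integrable_mult_left integrable_mult_right integrable_mi_power_mult \<psi>)
    have sumint: "integrable lborel (\<lambda>x. \<Sum>\<alpha> | mi_size \<alpha> < p. ?c \<alpha> x)"
      by (intro Bochner_Integration.integrable_sum int)
    have gint: "integrable lborel (\<lambda>x. ?g (x - y) * \<psi> x)"
      by (rule integrable_shift_mult[OF g \<psi>])
    let ?R = "\<lambda>x. G (s *\<^sub>R (- y) + s *\<^sub>R x) - (\<Sum>j<p. of_real (1 / fact j) * (dir_deriv (s *\<^sub>R x) ^^ j) G (s *\<^sub>R (- y)))"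
    \<comment> \<open>The factors s^|\<alpha>| from differentiating the dilated function combine
      with the monomials in x to monomials in s x.\<close>
    have pt: "?g (x - y) * \<psi> x - (\<Sum>\<alpha> | mi_size \<alpha> < p. ?c \<alpha> x) = a * ?R x * \<psi> x" for x
    proof -
      have "(\<Sum>\<alpha> | mi_size \<alpha> < p. ?c \<alpha> x) = a * (\<Sum>\<alpha> | mi_size \<alpha> < p. of_real (mi_power (s *\<^sub>R x) \<alpha> / mi_fact \<alpha>) * mi_deriv \<alpha> G (s *\<^sub>R (- y))) * \<psi> x"
        unfolding sum_distrib_left sum_distrib_right dg mi_power_scaleR by (intro sum.cong) auto
      then show ?thesis
        unfolding taylor_sum_eq[OF G] by (simp add: algebra_simps)
    qed
    have "taylor_gap p \<psi> ?g y = (LINT x|lborel. ?g (x - y) * \<psi> x - (\<Sum>\<alpha> | mi_size \<alpha> < p. ?c \<alpha> x))"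
      unfolding taylor_gap_def corr_def Bochner_Integration.integral_diff[OF gint sumint]
        Bochner_Integration.integral_sum[OF int] integral_mult_left_zero integral_mult_right_zero ..
    also have "\<dots> = (LINT x|lborel. a * ?R x * \<psi> x)"
      unfolding pt ..
    finally have eq: "taylor_gap p \<psi> ?g y = (LINT x|lborel. a * ?R x * \<psi> x)" .
    have "norm (taylor_gap p \<psi> ?g y) \<le> (LINT x|lborel. (C * (norm a * s ^ p / ?w)) * ((1 + norm x) ^ (p + k) * norm (\<psi> x)))"
      unfolding eq
    proof (rule Bochner_Integration.integral_norm_bound_integral)
      show "integrable lborel (\<lambda>x. a * ?R x * \<psi> x)"
        unfolding pt[symmetric] by (intro Bochner_Integration.integrable_diff gint sumint)
      show "integrable lborel (\<lambda>x. (C * (norm a * s ^ p / ?w)) * ((1 + norm x) ^ (p + k) * norm (\<psi> x)))"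
        using integrable_weight_mult[OF \<psi>] by (rule integrable_mult_right)
      fix x :: "real^'a"
      have "?w * norm (?R x) \<le> C * norm (s *\<^sub>R x) ^ p * (1 + norm (s *\<^sub>R x)) ^ k"
        using C(2)[of "s *\<^sub>R (- y)" "s *\<^sub>R x"] s by (simp add: mult.commute[of s])
      also have "\<dots> \<le> C * (s * (1 + norm x)) ^ p * (1 + norm x) ^ k"
      proof (intro mult_mono power_mono mult_left_mono C)
        show "norm (s *\<^sub>R x) \<le> s * (1 + norm x)" using s by simp
        show "1 + norm (s *\<^sub>R x) \<le> 1 + norm x" using s by (simp add: mult_left_le_one_le)
      qed (use s C in auto)
      also have "\<dots> = C * s ^ p * (1 + norm x) ^ (p + k)"
        by (simp add: power_mult_distrib power_add)
      finally have "norm (?R x) \<le> C * s ^ p * (1 + norm x) ^ (p + k) / ?w"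
        using w by (simp add: pos_le_divide_eq mult.commute)
      then have "norm a * norm (?R x) * norm (\<psi> x) \<le> norm a * (C * s ^ p * (1 + norm x) ^ (p + k) / ?w) * norm (\<psi> x)"
        by (intro mult_right_mono mult_left_mono) auto
      then show "norm (a * ?R x * \<psi> x) \<le> (C * (norm a * s ^ p / ?w)) * ((1 + norm x) ^ (p + k) * norm (\<psi> x))"
        by (simp only: norm_mult) (simp add: mult_ac)
    qed
    also have "\<dots> = C * ?I * (norm a * s ^ p / ?w)"
      by (simp only: integral_mult_right_zero) (simp only: mult_ac)
    finally show ?thesis .
  qed
  moreover have "C * ?I \<ge> 0"
    by (intro mult_nonneg_nonneg C integral_nonneg_AE) auto
  ultimately show ?thesis by blast
qed

lemma smallo_one_iff: "f \<in> o(\<lambda>N. 1) \<longleftrightarrow> f \<longlonglongrightarrow> (0::complex)"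
  for f :: "nat \<Rightarrow> complex"
  using smalloI_tendsto[of f "\<lambda>_. 1" sequentially] smalloD_tendsto[of f sequentially "\<lambda>_. 1"] by auto

lemma regular_dist_mi_poly:
  assumes "schwartz \<psi>"
  shows "regular_dist (mi_poly m c) \<psi> =
    (\<Sum>\<alpha> | int (mi_size \<alpha>) \<le> m. c \<alpha> * (LINT x|lborel. of_real (mi_power x \<alpha>) * \<psi> x))"
proof -
  have "regular_dist (mi_poly m c) \<psi> = (LINT x|lborel. (\<Sum>\<alpha> | int (mi_size \<alpha>) \<le> m. c \<alpha> * (of_real (mi_power x \<alpha>) * \<psi> x)))"
    unfolding regular_dist_def mi_poly_def sum_distrib_right by (simp only: mult.assoc)
  also have "\<dots> = (\<Sum>\<alpha> | int (mi_size \<alpha>) \<le> m. c \<alpha> * (LINT x|lborel. of_real (mi_power x \<alpha>) * \<psi> x))"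
    using integrable_mi_power_mult[OF assms] by (subst Bochner_Integration.integral_sum) auto
  finally show ?thesis .
qed

lemma mi_size_int_le: "m \<ge> -1 \<Longrightarrow> {\<alpha>::'n::finite multi_index. int (mi_size \<alpha>) \<le> m} = {\<alpha>. mi_size \<alpha> < nat (m + 1)}"
  by auto

context dyadic_decomposition
begin

abbreviation scaled_\<Phi> :: "nat \<Rightarrow> real^'n \<Rightarrow> complex" where
  "scaled_\<Phi> N \<equiv> dyadic_dilation (- int N) \<Phi>"

lemma schwartz_scaled_\<Phi>: "schwartz (scaled_\<Phi> N)"
  by (intro schwartz_dyadic_dilation schwartz_\<Phi>)

lemma lp_coeff_eq: "lp_coeff \<phi> u N \<alpha> = 1 / of_nat (mi_fact \<alpha>) * u (\<lambda>y. mi_deriv \<alpha> (scaled_\<Phi> N) (0 - y))"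
  unfolding lp_coeff_def mi_deriv_eq partials_conv_dist[OF schwartz_scaled_\<Phi>] conv_dist_def ..

text \<open>The cutoff \<open>nat (m + 1)\<close> turns degree at most m into degree below p; for m
  = -1 it is 0 and the sum is empty.\<close>

lemma lp_remainder_taylor_gap:
  assumes \<psi>: "schwartz \<psi>" and m: "m \<ge> -1"
  shows "lp_remainder \<phi> u (\<lambda>N. mi_poly m (lp_coeff \<phi> u N)) N \<psi> = u (taylor_gap (nat (m + 1)) \<psi> (scaled_\<Phi> N))"
proof -
  let ?c = "\<lambda>\<alpha>. of_real (1 / mi_fact \<alpha>) * (LINT x|lborel. of_real (mi_power x \<alpha>) * \<psi> x)"
  let ?p = "nat (m + 1)"
  let ?S = "\<lambda>y. \<Sum>\<alpha> | mi_size \<alpha> < ?p. ?c \<alpha> * mi_deriv \<alpha> (scaled_\<Phi> N) (0 - y)"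
  have s: "schwartz (\<lambda>y. mi_deriv \<alpha> (scaled_\<Phi> N) (0 - y))" for \<alpha>
    by (intro schwartz_reflect schwartz_mi_deriv schwartz_scaled_\<Phi>)
  have "u (taylor_gap ?p \<psi> (scaled_\<Phi> N)) = u (corr (scaled_\<Phi> N) \<psi>) - u ?S"
    unfolding taylor_gap_def[abs_def]
    by (intro diff schwartz_corr schwartz_sum schwartz_cmult s schwartz_scaled_\<Phi> \<psi> finite_mi_size_less)
  also have "u ?S = (\<Sum>\<alpha> | mi_size \<alpha> < ?p. ?c \<alpha> * u (\<lambda>y. mi_deriv \<alpha> (scaled_\<Phi> N) (0 - y)))"
    by (intro sum s finite_mi_size_less)
  also have "\<dots> = regular_dist (mi_poly m (lp_coeff \<phi> u N)) \<psi>"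
    unfolding regular_dist_mi_poly[OF \<psi>] mi_size_int_le[OF m] lp_coeff_eq
    by (intro sum.cong) auto
  finally show ?thesis by (simp only: lp_remainder_eq[OF \<psi>])
qed

text \<open>With s = 2^(-N), the dilation contributes s^n and the Taylor remainder s^p; the further
  factor s for each derivative is at most 1 and is dropped. The decay exponent is
  \<open>Suc d\<close>, one more than the weight (1 + |y|)^d uses up: this surplus separates the
  scales in the critical case.\<close>

lemma taylor_gap_bound:
  assumes \<psi>: "schwartz \<psi>"
  obtains C where "C \<ge> 0" and "\<And>N is y. length is \<le> d \<Longrightarrow>
    norm (partials is (taylor_gap p \<psi> (scaled_\<Phi> N)) y) \<le>
      C * ((1 / 2 ^ N) ^ (CARD('n) + p) / (1 + norm y / 2 ^ N) ^ Suc d)"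
proof -
  have "\<exists>C. \<forall>is. C is \<ge> 0 \<and> (\<forall>a s y. 0 < s \<and> s \<le> 1 \<longrightarrow>
    norm (taylor_gap p \<psi> (\<lambda>x. a * partials is \<Phi> (s *\<^sub>R x)) y) \<le> C is * (norm a * s ^ p / (1 + norm y * s) ^ Suc d))"
    by (intro choice allI taylor_gap_scaled_bound[OF schwartz_partials[OF schwartz_\<Phi>] \<psi>, unfolded Bex_def])
  then obtain C where C: "\<And>is. C is \<ge> 0" "\<And>is a s y. 0 < s \<Longrightarrow> s \<le> 1 \<Longrightarrow>
    norm (taylor_gap p \<psi> (\<lambda>x. a * partials is \<Phi> (s *\<^sub>R x)) y) \<le> C is * (norm a * s ^ p / (1 + norm y * s) ^ Suc d)"
    by blast
  let ?C = "\<Sum>is\<in>{is::'n list. length is \<le> d}. C is"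
  have "norm (partials is (taylor_gap p \<psi> (scaled_\<Phi> N)) y) \<le>
      ?C * ((1 / 2 ^ N) ^ (CARD('n) + p) / (1 + norm y / 2 ^ N) ^ Suc d)" if len: "length is \<le> d" for N "is" y
  proof -
    define s :: real where "s = 1 / 2 ^ N"
    have s: "0 < s" "s \<le> 1" "2 powi (- int N) = s"
      by (auto simp: s_def power_int_minus field_simps)
    let ?n = "CARD('n)"
    let ?a = "complex_of_real (s ^ (?n + length is))"
    have "partials is (taylor_gap p \<psi> (scaled_\<Phi> N)) y =
       (- 1) ^ length is * taylor_gap p \<psi> (\<lambda>x. ?a * partials is \<Phi> (s *\<^sub>R x)) y"
      unfolding partials_taylor_gap[OF schwartz_scaled_\<Phi> \<psi>]
        partials_dyadic_dilation[OF schwartz_\<Phi>] s(3) ..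
    then have "norm (partials is (taylor_gap p \<psi> (scaled_\<Phi> N)) y) =
       norm (taylor_gap p \<psi> (\<lambda>x. ?a * partials is \<Phi> (s *\<^sub>R x)) y)"
      by (simp only: norm_mult norm_power norm_minus_cancel norm_one power_one mult_1)
    also have "\<dots> \<le> C is * (norm ?a * s ^ p / (1 + norm y * s) ^ Suc d)"
      by (rule C(2)[OF s(1,2)])
    also have "norm ?a = s ^ (?n + length is)"
      using s(1) by (simp only: norm_of_real abs_of_nonneg zero_le_power less_imp_le)
    also have "C is * (s ^ (?n + length is) * s ^ p / (1 + norm y * s) ^ Suc d) \<le> ?C * (s ^ ?n * s ^ p / (1 + norm y * s) ^ Suc d)"
    proof (rule mult_mono)
      show "C is \<le> ?C"
        using len C(1) by (intro member_le_sum finite_lists_le) auto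
      have "s ^ (?n + length is) \<le> s ^ ?n"
        using s by (intro power_decreasing) auto
      then show "s ^ (?n + length is) * s ^ p / (1 + norm y * s) ^ Suc d \<le> s ^ ?n * s ^ p / (1 + norm y * s) ^ Suc d"
        using s by (intro divide_right_mono mult_right_mono zero_le_power) (auto intro: add_nonneg_nonneg)
    qed (use s C(1) in \<open>auto intro!: sum_nonneg divide_nonneg_nonneg mult_nonneg_nonneg zero_le_power add_nonneg_nonneg\<close>)
    finally show ?thesis by (simp add: s_def power_add)
  qed
  moreover have "?C \<ge> 0" using C(1) by (intro sum_nonneg) auto
  ultimately show thesis using that by blast
qed

lemma taylor_gap_order:
  assumes \<psi>: "schwartz \<psi>"
  obtains C where "\<And>N. norm (u (taylor_gap p \<psi> (scaled_\<Phi> N))) \<le> C * 2 powr (- real N * (real CARD('n) + real p - real d))"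
proof -
  let ?T = "\<lambda>N. taylor_gap p \<psi> (scaled_\<Phi> N)"
  obtain C where C: "C \<ge> 0" "\<And>N is y. length is \<le> d \<Longrightarrow>
    norm (partials is (?T N) y) \<le>
      C * ((1 / 2 ^ N) ^ (CARD('n) + p) / (1 + norm y / 2 ^ N) ^ Suc d)"
    by (rule taylor_gap_bound[OF \<psi>, of p]) (rule that)
  have "norm (u (?T N)) \<le> c * (C * ((1 / 2 ^ N) ^ (CARD('n) + p) * (2 ^ N) ^ d))" for N
  proof (rule bounded[OF schwartz_taylor_gap[OF schwartz_scaled_\<Phi> \<psi>]])
    fix "is" :: "'n list" and y :: "real^'n" assume len: "length is \<le> d"
    let ?w = "1 + norm y / 2 ^ N"
    have w: "?w \<ge> 1" by simp
    have "1 + norm y \<le> 2 ^ N * ?w"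
      by (simp add: distrib_left)
    then have "(1 + norm y) ^ d * norm (partials is (?T N) y) \<le>
        (2 ^ N * ?w) ^ d * (C * ((1 / 2 ^ N) ^ (CARD('n) + p) / ?w ^ Suc d))"
      by (intro mult_mono power_mono C(2) len) auto
    also have "\<dots> = C * ((1 / 2 ^ N) ^ (CARD('n) + p) * (2 ^ N) ^ d) * (1 / ?w)"
    proof -
      have "(A * W) ^ d * (C * (B / W ^ Suc d)) = C * (B * A ^ d) * (1 / W)" if "W > 0" for A B W :: real
        using that by (simp add: power_mult_distrib)
      from this[of ?w] show ?thesis using w by simp
    qed
    also have "\<dots> \<le> C * ((1 / 2 ^ N) ^ (CARD('n) + p) * (2 ^ N) ^ d) * 1"
    proof (intro mult_left_mono)
      have "1 / W \<le> 1" if "W \<ge> 1" for W :: real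
        using that by simp
      from this[OF w] show "1 / ?w \<le> 1" .
    qed (use C(1) in auto)
    finally show "(1 + norm y) ^ d * norm (partials is (?T N) y) \<le>
      C * ((1 / 2 ^ N) ^ (CARD('n) + p) * (2 ^ N) ^ d)" by simp
  qed
  moreover have "(1 / 2 ^ N) ^ (CARD('n) + p) * (2 ^ N) ^ d = 2 powr (- real N * (real CARD('n) + real p - real d))" for N
  proof -
    have "2 powr (- real N * (real CARD('n) + real p - real d)) = 2 powr (real (N * d)) / 2 powr (real (N * (CARD('n) + p)))"
      unfolding powr_diff[symmetric] by (simp add: algebra_simps)
    also have "\<dots> = 2 ^ (N * d) / 2 ^ (N * (CARD('n) + p))"
      by (simp only: powr_realpow zero_less_numeral)
    finally show ?thesis
      by (simp add: power_mult power_divide)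
  qed
  ultimately show thesis using that[of "c * C"] by (simp add: mult.assoc)
qed

text \<open>
  In the critical case the bound alone only gives boundedness. The functions are however
  concentrated on disjoint dyadic scales, so that arbitrary unimodular combinations stay bounded
  in the seminorm; hence the pairings are absolutely summable.
\<close>

lemma taylor_gap_critical:
  assumes \<psi>: "schwartz \<psi>" and crit: "CARD('n) + p = d"
  shows "(\<lambda>N. u (taylor_gap p \<psi> (scaled_\<Phi> N))) \<longlonglongrightarrow> 0"
proof -
  obtain C where C: "C \<ge> 0" "\<And>N is y. length is \<le> d \<Longrightarrow>
    norm (partials is (taylor_gap p \<psi> (scaled_\<Phi> N)) y) \<le>
      C * ((1 / 2 ^ N) ^ (CARD('n) + p) / (1 + norm y / 2 ^ N) ^ Suc d)"
    by (rule taylor_gap_bound[OF \<psi>, of p]) (rule that)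
  have d: "d \<ge> 1" using crit by (metis One_nat_def Suc_leI add_gr_0 zero_less_card_finite)
  let ?T = "\<lambda>N. taylor_gap p \<psi> (scaled_\<Phi> N)"
  have T: "schwartz (?T N)" for N by (intro schwartz_taylor_gap schwartz_scaled_\<Phi> \<psi>)
  \<comment> \<open>Unimodular factors that rotate each nonzero pairing to its absolute value; if
    the pairing is 0, so is the factor.\<close>
  define w where "w N = cnj (sgn (u (?T N)))" for N
  have w: "w N * u (?T N) = of_real (norm (u (?T N)))" "norm (w N) \<le> 1" for N
  proof -
    show "norm (w N) \<le> 1" by (simp add: w_def norm_sgn)
    show "w N * u (?T N) = of_real (norm (u (?T N)))"
      by (simp add: w_def sgn_eq mult.commute complex_norm_square[symmetric] power2_eq_square)
  qed
  have "(\<Sum>N<J. norm (u (?T N))) \<le> c * (C * 4)" for J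
  proof -
    let ?V = "\<lambda>y. \<Sum>N<J. w N * ?T N y"
    have V: "schwartz ?V" by (intro schwartz_sum schwartz_cmult T) auto
    have "norm (u ?V) \<le> c * (C * 4)"
    proof (rule bounded[OF V])
      fix "is" :: "'n list" and y :: "real^'n" assume len: "length is \<le> d"
      \<comment> \<open>\<open>?t N\<close> locates y relative to the scale 2^N. For
        \<open>?t N \<ge> 1\<close> the surplus power of the denominator leaves 1 /
        \<open>?t N\<close>; below 1 the denominator is at least 1, and
        \<open>?t N ^ d \<le> ?t N\<close> because d \<ge> n \<ge> 1.\<close>
      let ?t = "\<lambda>N. (1 + norm y) / 2 ^ N"
      have piece: "(1 + norm y) ^ d * norm (partials is (?T N) y) \<le> C * (if 1 \<le> ?t N then 1 / ?t N else ?t N)" for N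
      proof -
        have t: "?t N > 0" by (simp add: add_pos_nonneg)
        have tw: "?t N \<le> 1 + norm y / 2 ^ N" by (simp add: add_divide_distrib)
        have "(1 + norm y) ^ d * norm (partials is (?T N) y) \<le> (1 + norm y) ^ d * (C * ((1 / 2 ^ N) ^ d / (1 + norm y / 2 ^ N) ^ Suc d))"
          using C(2)[OF len, of N y] unfolding crit by (intro mult_left_mono) auto
        also have "\<dots> = C * (?t N ^ d / (1 + norm y / 2 ^ N) ^ Suc d)"
          by (simp add: power_divide)
        also have "\<dots> \<le> C * (if 1 \<le> ?t N then 1 / ?t N else ?t N)"
        proof (intro mult_left_mono C)
          show "?t N ^ d / (1 + norm y / 2 ^ N) ^ Suc d \<le> (if 1 \<le> ?t N then 1 / ?t N else ?t N)"
          proof (cases "1 \<le> ?t N")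
            case True
            have "?t N ^ d / (1 + norm y / 2 ^ N) ^ Suc d \<le> ?t N ^ d / ?t N ^ Suc d"
              using t tw by (intro divide_left_mono power_mono mult_pos_pos zero_less_power) auto
            also have "\<dots> = 1 / ?t N" using t by simp
            finally show ?thesis using True by simp
          next
            case False
            have "?t N ^ d / (1 + norm y / 2 ^ N) ^ Suc d \<le> ?t N ^ d / 1"
            proof (rule divide_left_mono)
              show one: "1 \<le> (1 + norm y / 2 ^ N) ^ Suc d" by (rule one_le_power) simp
              show "0 < (1 + norm y / 2 ^ N) ^ Suc d * 1"
                using less_le_trans[OF zero_less_one one] by simp
            qed (use t in simp)
            also have "\<dots> \<le> ?t N ^ 1"
              using False t d by (simp only: div_by_1) (intro power_decreasing, auto)
            finally show ?thesis using False by simp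
          qed
        qed
        finally show ?thesis .
      qed
      have "partials is ?V y = (\<Sum>N<J. w N * partials is (?T N) y)"
        using partials_sum[of "{..<J}" ?T "is" w] T by simp
      then have "(1 + norm y) ^ d * norm (partials is ?V y) \<le> (1 + norm y) ^ d * (\<Sum>N<J. norm (partials is (?T N) y))"
        using w(2) by (auto intro!: mult_left_mono sum_norm_le simp: norm_mult mult_left_le_one_le)
      also have "\<dots> \<le> (\<Sum>N<J. C * (if 1 \<le> ?t N then 1 / ?t N else ?t N))"
        unfolding sum_distrib_left by (intro sum_mono piece)
      also have "\<dots> = C * (\<Sum>N<J. if 1 \<le> ?t N then 1 / ?t N else ?t N)"
        by (simp only: sum_distrib_left)
      also have "\<dots> \<le> C * 4"
        by (intro mult_left_mono dyadic_peak_sum_le C) (simp add: add_pos_nonneg)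
      finally show "(1 + norm y) ^ d * norm (partials is ?V y) \<le> C * 4" .
    qed
    moreover have "u ?V = of_real (\<Sum>N<J. norm (u (?T N)))"
      by (subst sum) (auto simp: T w(1))
    ultimately have "norm (complex_of_real (\<Sum>N<J. norm (u (?T N)))) \<le> c * (C * 4)"
      by (simp only:)
    then show ?thesis
      unfolding norm_of_real by (rule order_trans[OF abs_ge_self])
  qed
  then have "summable (\<lambda>N. norm (u (?T N)))"
    by (intro summableI_nonneg_bounded) auto
  then show ?thesis
    by (rule summable_LIMSEQ_zero[OF summable_norm_cancel])
qed

end

section \<open>Determination of the coefficients\<close>

lemma mi_induct [case_names zero upd]:
  fixes \<alpha> :: "'n::finite multi_index"
  assumes "P zero_mi" and "\<And>\<alpha> i. P \<alpha> \<Longrightarrow> P (\<alpha>(i := Suc (\<alpha> i)))"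
  shows "P \<alpha>"
proof (induction "mi_size \<alpha>" arbitrary: \<alpha>)
  case 0
  then show ?case using assms(1) by (simp add: mi_size_0_iff)
next
  case (Suc k)
  then obtain i where i: "\<alpha> i > 0"
    by (metis gr0I mi_size_0_iff nat.distinct(1) zero_mi_def ext)
  let ?\<beta> = "\<alpha>(i := \<alpha> i - 1)"
  have \<alpha>: "\<alpha> = ?\<beta>(i := Suc (?\<beta> i))" using i by auto
  then have "mi_size \<alpha> = Suc (mi_size ?\<beta>)" using mi_size_upd[of ?\<beta> i] by simp
  then have "P ?\<beta>" using Suc by simp
  then show ?case using assms(2) \<alpha> by metis
qed

lemma schwartz_mi_power_mult:
  assumes "schwartz g"
  shows "schwartz (\<lambda>x. of_real (mi_power x \<beta>) * g x)"
proof (induction \<beta> rule: mi_induct)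
  case (upd \<beta> i)
  from schwartz_nth_mult(1)[OF this, of i] show ?case
    by (simp only: mi_power_upd of_real_mult mult.assoc)
qed (simp add: assms)

text \<open>For \<open>\<beta> j = 0\<close> the truncated difference \<open>\<beta> j - 1\<close>
  leaves the index as it is, but the coefficient of that term is 0.\<close>

lemma partial_deriv_mi_power_mult:
  assumes g: "schwartz g"
  shows "partial_deriv j (\<lambda>x. of_real (mi_power x \<beta>) * g x) =
    (\<lambda>x. of_nat (\<beta> j) * (of_real (mi_power x (\<beta>(j := \<beta> j - 1))) * g x) + of_real (mi_power x \<beta>) * partial_deriv j g x)"
proof (induction \<beta> rule: mi_induct)
  case zero
  then show ?case by (simp add: zero_mi_def mi_power_def)
next
  case (upd \<beta> i)
  let ?G = "\<lambda>x. of_real (mi_power x \<beta>) * g x"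
  have "partial_deriv j (\<lambda>x. of_real (x $ i) * ?G x) =
      (\<lambda>x. of_real (x $ i) * partial_deriv j ?G x + (if i = j then ?G x else 0))"
    by (rule schwartz_nth_mult(2)[OF schwartz_mi_power_mult[OF g]])
  then have *: "partial_deriv j (\<lambda>x. of_real (mi_power x (\<beta>(i := Suc (\<beta> i)))) * g x) =
      (\<lambda>x. of_real (x $ i) * partial_deriv j ?G x + (if i = j then ?G x else 0))"
    by (simp only: mi_power_upd of_real_mult mult.assoc)
  show ?case
  proof (cases "i = j")
    case True
    have "of_nat (\<beta> j) * (of_real (x $ j) * of_real (mi_power x (\<beta>(j := \<beta> j - 1)))) = of_nat (\<beta> j) * complex_of_real (mi_power x \<beta>)" for x
    proof (cases "\<beta> j = 0")
      case False
      then have "(\<beta>(j := \<beta> j - 1))(j := Suc ((\<beta>(j := \<beta> j - 1)) j)) = \<beta>" by auto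
      then have "mi_power x \<beta> = x $ j * mi_power x (\<beta>(j := \<beta> j - 1))"
        using mi_power_upd[of x "\<beta>(j := \<beta> j - 1)" j] by simp
      then show ?thesis by simp
    qed simp
    then have **: "of_real (x $ j) * (of_nat (\<beta> j) * (of_real (mi_power x (\<beta>(j := \<beta> j - 1))) * g x)) = of_nat (\<beta> j) * (complex_of_real (mi_power x \<beta>) * g x)" for x
      by (simp only: mult.assoc[symmetric]) (simp only: mult_ac)
    have e: "(\<beta>(j := Suc (\<beta> j))) j = Suc (\<beta> j)" "(\<beta>(j := Suc (\<beta> j)))(j := Suc (\<beta> j) - 1) = \<beta>"
      by auto
    show ?thesis
      unfolding *
      unfolding upd True e mi_power_upd of_real_mult
      by (rule ext) (simp only: if_True simp_thms distrib_left ** of_nat_Suc distrib_right mult_1, simp only: add_ac mult_ac)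
  next
    case False
    have "(\<beta>(i := Suc (\<beta> i)))(j := \<beta> j - 1) = (\<beta>(j := \<beta> j - 1))(i := Suc ((\<beta>(j := \<beta> j - 1)) i))"
      using False by auto
    then have "mi_power x ((\<beta>(i := Suc (\<beta> i)))(j := \<beta> j - 1)) = x $ i * mi_power x (\<beta>(j := \<beta> j - 1))" for x :: "real^'a"
      by (simp only: mi_power_upd)
    moreover have "(\<beta>(i := Suc (\<beta> i))) j = \<beta> j" using False by simp
    ultimately show ?thesis
      unfolding * upd using False
      by (simp only: mi_power_upd of_real_mult if_False distrib_left add_0_right) (simp only: mult_ac)
  qed
qed

lemma prod_list_mi_list:
  fixes z :: "'a::comm_ring_1 ^ 'n::finite"
  shows "(\<Prod>i\<leftarrow>mi_list \<alpha>. z $ i) = mi_power z \<alpha>"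
proof -
  have "(\<Prod>i\<leftarrow>is. z $ i) = mi_power z (count_list is)" for "is"
  proof (induction "is")
    case (Cons i "is")
    have "count_list (i # is) = (count_list is)(i := Suc (count_list is i))" by auto
    then show ?case using Cons by (simp only: mi_power_upd) simp
  qed (simp add: mi_power_def)
  moreover have "count_list (mi_list \<alpha>) = \<alpha>" by (auto simp: count_mi_list)
  ultimately show ?thesis by metis
qed

context dyadic_partition
begin

text \<open>Multiplication by a coordinate becomes, up to a constant, differentiation of the
  transform, and the transform of \<open>\<Phi>\<close> is constant near 0. The claim is made on a
  ball rather than at 0 alone so that the induction can differentiate it.\<close>

lemma fourier_moment_near_zero:
  assumes "norm \<xi> < r"
  shows "fourier (\<lambda>x. of_real (mi_power x \<beta>) * \<Phi> x) \<xi> = (if \<beta> = zero_mi then 1 else 0)"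
  using assms
proof (induction \<beta> arbitrary: \<xi> rule: mi_induct)
  case zero
  then show ?case by (simp add: fourier_\<Phi> profile_near_zero)
next
  case (upd \<beta> i)
  let ?G = "\<lambda>x. of_real (mi_power x \<beta>) * \<Phi> x"
  let ?c = "(if \<beta> = zero_mi then 1 else 0) :: complex"
  have "partials [i] (fourier ?G) \<xi> = partials [i] (\<lambda>_. ?c) \<xi>"
    by (rule partials_cong_open[of "ball 0 r"]) (use upd in auto)
  also have "\<dots> = 0"
    using partial_derivI[of "\<lambda>_. ?c" "\<lambda>_. 0" \<xi> i] by simp
  finally have "fourier (\<lambda>x. (- \<i>) * (of_real (x $ i) * ?G x)) \<xi> = 0"
    by (simp add: fourier_derivative(2)[OF schwartz_mi_power_mult[OF schwartz_\<Phi>]])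
  then have "fourier (\<lambda>x. of_real (x $ i) * ?G x) \<xi> = 0"
    by (simp only: fourier_cmult) simp
  moreover have "\<beta>(i := Suc (\<beta> i)) \<noteq> zero_mi"
    by (metis fun_upd_same nat.distinct(1) zero_mi_def)
  ultimately show ?case
    by (simp only: mi_power_upd of_real_mult mult.assoc if_False)
qed

lemma moment_\<Phi>: "(LINT x|lborel. of_real (mi_power x \<beta>) * \<Phi> x) = (if \<beta> = zero_mi then 1 else 0)"
  using fourier_moment_near_zero[of 0 \<beta>] r_pos by (simp add: fourier_def)

text \<open>Integration by parts: each derivative lowers the matching exponent of the monomial, with
  a sign and a factor, until a moment of \<open>\<Phi>\<close> itself is left. Such a moment
  vanishes unless the monomial has been used up exactly.\<close>

lemma moment_partials:
  "(LINT x|lborel. of_real (mi_power x \<beta>) * partials is \<Phi> x) =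
    (if count_list is = \<beta> then (- 1) ^ length is * of_nat (mi_fact \<beta>) else 0)"
proof (induction "is" arbitrary: \<beta>)
  case Nil
  have eq: "count_list [] = (zero_mi :: 'n multi_index)" by (auto simp: zero_mi_def)
  show ?case
    unfolding foldr.simps id_apply eq moment_\<Phi> by (cases "\<beta> = zero_mi") auto
next
  case (Cons i "is")
  let ?g = "partials is \<Phi>"
  have g: "schwartz ?g" by (rule schwartz_partials[OF schwartz_\<Phi>])
  let ?\<gamma> = "\<beta>(i := \<beta> i - 1)"
  have s: "schwartz (\<lambda>x. of_real (mi_power x \<beta>) * ?g x)" by (rule schwartz_mi_power_mult[OF g])
  \<comment> \<open>The integral of a derivative is its Fourier transform at frequency 0, where the
    factor \<xi>_i vanishes.\<close>
  have "0 = fourier (partial_deriv i (\<lambda>x. of_real (mi_power x \<beta>) * ?g x)) 0"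
    by (simp add: fourier_partial_deriv[OF s])
  also have "\<dots> = (LINT x|lborel. of_nat (\<beta> i) * (of_real (mi_power x ?\<gamma>) * ?g x) + of_real (mi_power x \<beta>) * partial_deriv i ?g x)"
    unfolding partial_deriv_mi_power_mult[OF g] by (simp add: fourier_def)
  also have "\<dots> = of_nat (\<beta> i) * (LINT x|lborel. of_real (mi_power x ?\<gamma>) * ?g x) + (LINT x|lborel. of_real (mi_power x \<beta>) * partial_deriv i ?g x)"
    using integrable_mi_power_mult[OF g] integrable_mi_power_mult[OF schwartz_partial_deriv[OF g]] by simp
  finally have eq: "(LINT x|lborel. of_real (mi_power x \<beta>) * partial_deriv i ?g x) =
      - of_nat (\<beta> i) * (if count_list is = ?\<gamma> then (- 1) ^ length is * of_nat (mi_fact ?\<gamma>) else 0)"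
    unfolding Cons.IH[of ?\<gamma>] by (simp add: eq_neg_iff_add_eq_0 add.commute)
  have cnt: "count_list (i # is) = (count_list is)(i := Suc (count_list is i))" by auto
  show ?case
  proof (cases "\<beta> i = 0")
    case True
    then have ne: "count_list (i # is) \<noteq> \<beta>" unfolding cnt by auto
    show ?thesis unfolding if_not_P[OF ne] using eq True by simp
  next
    case False
    then have \<beta>: "\<beta> = ?\<gamma>(i := Suc (?\<gamma> i))" by auto
    have iff: "count_list (i # is) = \<beta> \<longleftrightarrow> count_list is = ?\<gamma>"
      unfolding cnt using False by (auto simp: fun_eq_iff split: if_splits)
    have "mi_fact \<beta> = mi_fact (?\<gamma>(i := Suc (?\<gamma> i)))"
      using \<beta> by (rule arg_cong)
    also have "\<dots> = \<beta> i * mi_fact ?\<gamma>"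
      unfolding mi_fact_upd using False by simp
    finally have fact: "mi_fact \<beta> = \<beta> i * mi_fact ?\<gamma>" .
    have "partials (i # is) \<Phi> = partial_deriv i ?g" by simp
    then show ?thesis
      unfolding iff fact using eq by (cases "count_list is = ?\<gamma>") simp_all
  qed
qed

lemma moment_mi_deriv:
  "(LINT x|lborel. of_real (mi_power x \<beta>) * mi_deriv \<alpha> \<Phi> x) =
    (if \<beta> = \<alpha> then (- 1) ^ mi_size \<alpha> * of_nat (mi_fact \<alpha>) else 0)"
proof -
  have "count_list (mi_list \<alpha>) = \<alpha>" by (auto simp: count_mi_list)
  then show ?thesis
    unfolding mi_deriv_eq moment_partials by (auto simp: length_mi_list)
qed

text \<open>The test function \<open>mi_deriv \<alpha> \<Phi>\<close> annihilates all monomials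
  except the one with index \<alpha>, so pairing with it extracts that coefficient up to a nonzero
  constant.\<close>

lemma mi_poly_coefficients_tendsto_0:
  fixes q :: "nat \<Rightarrow> 'n multi_index \<Rightarrow> complex"
  assumes conv: "\<And>\<psi>. schwartz \<psi> \<Longrightarrow> (\<lambda>N. regular_dist (mi_poly m (q N)) \<psi>) \<longlonglongrightarrow> 0"
    and \<alpha>: "int (mi_size \<alpha>) \<le> m"
  shows "(\<lambda>N. q N \<alpha>) \<longlonglongrightarrow> 0"
proof -
  let ?K = "(- 1) ^ mi_size \<alpha> * of_nat (mi_fact \<alpha>) :: complex"
  have s: "schwartz (mi_deriv \<alpha> \<Phi>)" by (rule schwartz_mi_deriv[OF schwartz_\<Phi>])
  have m: "{\<alpha>::'n multi_index. int (mi_size \<alpha>) \<le> m} = {\<alpha>. mi_size \<alpha> \<le> nat m}" using \<alpha> by auto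
  have "regular_dist (mi_poly m (q N)) (mi_deriv \<alpha> \<Phi>) = q N \<alpha> * ?K" for N
  proof -
    have "regular_dist (mi_poly m (q N)) (mi_deriv \<alpha> \<Phi>) = (\<Sum>\<beta> | int (mi_size \<beta>) \<le> m. if \<beta> = \<alpha> then q N \<alpha> * ?K else 0)"
      unfolding regular_dist_mi_poly[OF s] moment_mi_deriv by (intro sum.cong) auto
    moreover have "finite {\<beta>::'n multi_index. int (mi_size \<beta>) \<le> m}"
      unfolding m by (rule finite_mi_size_le)
    ultimately show ?thesis using \<alpha> by simp
  qed
  then have "(\<lambda>N. q N \<alpha> * ?K) \<longlonglongrightarrow> 0"
    using conv[OF s] by simp
  then have "(\<lambda>N. q N \<alpha> * ?K * (1 / ?K)) \<longlonglongrightarrow> 0 * (1 / ?K)"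
    by (intro tendsto_mult tendsto_const)
  then show ?thesis by simp
qed

end

section \<open>Size of the remainder and comparison of coefficients\<close>

context dyadic_decomposition
begin

lemma lp_remainder_bigo:
  assumes m: "m \<ge> -1"
  shows "dist_bigo (lp_remainder \<phi> u (\<lambda>N. mi_poly m (lp_coeff \<phi> u N))) (real_of_int (int CARD('n) + m + 1 - int d))"
  unfolding dist_bigo_def
proof (intro allI impI)
  fix \<psi> :: "real^'n \<Rightarrow> complex" assume \<psi>: "schwartz \<psi>"
  have e: "real CARD('n) + real (nat (m + 1)) - real d = real_of_int (int CARD('n) + m + 1 - int d)"
    using m by simp
  obtain C where "\<And>N. norm (u (taylor_gap (nat (m + 1)) \<psi> (scaled_\<Phi> N))) \<le> C * 2 powr (- real N * real_of_int (int CARD('n) + m + 1 - int d))"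
    by (rule taylor_gap_order[OF \<psi>, of "nat (m + 1)", unfolded e]) (rule that)
  then show "(\<lambda>N. lp_remainder \<phi> u (\<lambda>N. mi_poly m (lp_coeff \<phi> u N)) N \<psi>)
      \<in> O(\<lambda>N. complex_of_real (2 powr (- real N * real_of_int (int CARD('n) + m + 1 - int d))))"
    unfolding lp_remainder_taylor_gap[OF \<psi> m] by (intro bigoI[where c = C] always_eventually) simp
qed

lemma lp_remainder_tendsto_0:
  assumes m: "m \<ge> -1" and order: "int CARD('n) + m + 1 - int d \<ge> 0" and \<psi>: "schwartz \<psi>"
  shows "(\<lambda>N. lp_remainder \<phi> u (\<lambda>N. mi_poly m (lp_coeff \<phi> u N)) N \<psi>) \<longlonglongrightarrow> 0"
proof (cases "int CARD('n) + m + 1 - int d = 0")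
  case True
  then have "CARD('n) + nat (m + 1) = d" using m by linarith
  from taylor_gap_critical[OF \<psi> this] show ?thesis
    unfolding lp_remainder_taylor_gap[OF \<psi> m] .
next
  case False
  let ?r = "real_of_int (int CARD('n) + m + 1 - int d)"
  have r: "?r > 0" using order False by linarith
  have e: "real CARD('n) + real (nat (m + 1)) - real d = ?r"
    using m by simp
  obtain C where C: "\<And>N. norm (u (taylor_gap (nat (m + 1)) \<psi> (scaled_\<Phi> N))) \<le> C * 2 powr (- real N * ?r)"
    by (rule taylor_gap_order[OF \<psi>, of "nat (m + 1)", unfolded e]) (rule that)
  have "(\<lambda>N. (2 powr (- ?r)) ^ N) \<longlonglongrightarrow> 0"
    using r by (intro LIMSEQ_power_zero) (simp add: powr_less_one)
  moreover have pow: "(2 powr (- t)) ^ N = 2 powr (- real N * t)" for N and t :: real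
    by (simp add: powr_realpow[symmetric] powr_powr mult.commute)
  ultimately have "(\<lambda>N. 2 powr (- real N * ?r)) \<longlonglongrightarrow> 0"
    by (simp only: pow)
  then have "(\<lambda>N. C * 2 powr (- real N * ?r)) \<longlonglongrightarrow> 0"
    by (rule tendsto_mult_right_zero)
  with always_eventually[OF allI[OF C]]
  have "(\<lambda>N. u (taylor_gap (nat (m + 1)) \<psi> (scaled_\<Phi> N))) \<longlonglongrightarrow> 0"
    by (rule Lim_null_comparison)
  then show ?thesis unfolding lp_remainder_taylor_gap[OF \<psi> m] .
qed

text \<open>
  The expansion of a higher degree \<open>m'\<close> always has a vanishing remainder, so that the coefficients
  can be compared for every \<open>m\<close>, also when the remainder of degree \<open>m\<close> is not known to be small.
\<close>

lemma lp_coeff_unique: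
  assumes m: "m \<ge> -1" and small: "dist_smallo_1 (lp_remainder \<phi> u (\<lambda>N. mi_poly m (c' N)))"
    and \<alpha>: "int (mi_size \<alpha>) \<le> m"
  shows "(\<lambda>N. c' N \<alpha> - lp_coeff \<phi> u N \<alpha>) \<in> o(\<lambda>N. 1)"
proof -
  \<comment> \<open>With m' \<ge> d the exponent n + m' + 1 - d is positive, so the expansion of
    degree m' has an o(1) remainder.\<close>
  define m' where "m' = max m (int d)"
  have m': "m' \<ge> -1" "int CARD('n) + m' + 1 - int d \<ge> 0" "m \<le> m'"
    using m by (auto simp: m'_def)
  \<comment> \<open>The given coefficients are extended by 0 to degrees between m and m'. The
    resulting polynomial is the difference of two remainders that both tend to 0; its coefficients
    of degree at most m are the differences sought.\<close>
  define q where "q N \<beta> = (if int (mi_size \<beta>) \<le> m then c' N \<beta> else 0) - lp_coeff \<phi> u N \<beta>" for N \<beta>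
  have fin: "finite {\<beta>::'n multi_index. int (mi_size \<beta>) \<le> m'}"
    unfolding mi_size_int_le[OF m'(1)] by (rule finite_mi_size_less)
  have "(\<lambda>N. regular_dist (mi_poly m' (q N)) \<psi>) \<longlonglongrightarrow> 0" if \<psi>: "schwartz \<psi>" for \<psi>
  proof -
    let ?M = "\<lambda>\<beta>. LINT x|lborel. of_real (mi_power x \<beta>) * \<psi> x"
    have "regular_dist (mi_poly m' (q N)) \<psi> =
        lp_remainder \<phi> u (\<lambda>N. mi_poly m' (lp_coeff \<phi> u N)) N \<psi> - lp_remainder \<phi> u (\<lambda>N. mi_poly m (c' N)) N \<psi>" for N
    proof -
      have "(\<Sum>\<beta> | int (mi_size \<beta>) \<le> m. c' N \<beta> * ?M \<beta>) = (\<Sum>\<beta> | int (mi_size \<beta>) \<le> m'. (if int (mi_size \<beta>) \<le> m then c' N \<beta> else 0) * ?M \<beta>)"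
        using fin m'(3) by (intro sum.mono_neutral_cong_left) auto
      then show ?thesis
        by (simp add: lp_remainder_eq[OF \<psi>] regular_dist_mi_poly[OF \<psi>] q_def left_diff_distrib sum_subtractf)
    qed
    moreover have "(\<lambda>N. lp_remainder \<phi> u (\<lambda>N. mi_poly m (c' N)) N \<psi>) \<longlonglongrightarrow> 0"
      using small \<psi> by (auto simp: dist_smallo_1_def smallo_one_iff)
    ultimately show ?thesis
      using tendsto_diff[OF lp_remainder_tendsto_0[OF m'(1,2) \<psi>]] by fastforce
  qed
  from mi_poly_coefficients_tendsto_0[OF this, of \<alpha>] show ?thesis
    using \<alpha> m'(3) by (simp add: smallo_one_iff q_def)
qed

text \<open>Changing finitely many coefficients by o(1) changes the pairing with a fixed \<psi> by
  o(1), since the moments of \<psi> are constants. The exponent condition makes the remainder for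
  \<open>lp_coeff\<close> itself tend to 0.\<close>

lemma lp_remainder_smallo:
  assumes m: "m \<ge> -1" and order: "int CARD('n) + m + 1 - int d \<ge> 0"
    and coeff: "\<And>\<alpha>. int (mi_size \<alpha>) \<le> m \<Longrightarrow> (\<lambda>N. c' N \<alpha> - lp_coeff \<phi> u N \<alpha>) \<in> o(\<lambda>N. 1)"
  shows "dist_smallo_1 (lp_remainder \<phi> u (\<lambda>N. mi_poly m (c' N)))"
  unfolding dist_smallo_1_def smallo_one_iff
proof (intro allI impI)
  fix \<psi> :: "real^'n \<Rightarrow> complex" assume \<psi>: "schwartz \<psi>"
  let ?M = "\<lambda>\<beta>. LINT x|lborel. of_real (mi_power x \<beta>) * \<psi> x"
  have "lp_remainder \<phi> u (\<lambda>N. mi_poly m (c' N)) N \<psi> = lp_remainder \<phi> u (\<lambda>N. mi_poly m (lp_coeff \<phi> u N)) N \<psi>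
      - (\<Sum>\<beta> | int (mi_size \<beta>) \<le> m. (c' N \<beta> - lp_coeff \<phi> u N \<beta>) * ?M \<beta>)" for N
    by (simp add: lp_remainder_eq[OF \<psi>] regular_dist_mi_poly[OF \<psi>] left_diff_distrib sum_subtractf)
  moreover have "(\<lambda>N. \<Sum>\<beta> | int (mi_size \<beta>) \<le> m. (c' N \<beta> - lp_coeff \<phi> u N \<beta>) * ?M \<beta>) \<longlonglongrightarrow> (\<Sum>\<beta> | int (mi_size \<beta>) \<le> m. 0 * ?M \<beta>)"
    using coeff by (intro tendsto_sum tendsto_mult tendsto_const) (auto simp: smallo_one_iff)
  ultimately show "(\<lambda>N. lp_remainder \<phi> u (\<lambda>N. mi_poly m (c' N)) N \<psi>) \<longlonglongrightarrow> 0"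
    using tendsto_diff[OF lp_remainder_tendsto_0[OF m order \<psi>]] by fastforce
qed

text \<open>The tested expression is the Fourier transform of a derivative of the dilated
  \<open>\<Phi>\<close>, divided by the factorial. Transforming it once more, as the pairing with
  the transform of \<open>u\<close> demands, gives (2 pi)^n times the reflected derivative, which is
  the function that \<open>lp_coeff_eq\<close> evaluates.\<close>

lemma lp_coeff_fourier:
  "lp_coeff \<phi> u N \<alpha> = complex_of_real (1 / (2 * pi) ^ CARD('n)) *
     fourier_dist u (\<lambda>\<xi>. mi_power (\<chi> i. \<i> * complex_of_real (\<xi> $ i)) \<alpha> / of_nat (mi_fact \<alpha>) *
       (1 - (\<Sum>\<^sub>\<infinity>\<nu>\<in>{- int N..}. fourier (dyadic_dilation \<nu> \<phi>) \<xi>)))"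
proof -
  let ?G = "mi_deriv \<alpha> (scaled_\<Phi> N)"
  have G: "schwartz ?G" by (rule schwartz_mi_deriv[OF schwartz_scaled_\<Phi>])
  let ?a = "1 / of_nat (mi_fact \<alpha>) :: complex" and ?P = "complex_of_real ((2 * pi) ^ CARD('n))"
  have "mi_power (\<chi> i. \<i> * complex_of_real (\<xi> $ i)) \<alpha> / of_nat (mi_fact \<alpha>) *
       (1 - (\<Sum>\<^sub>\<infinity>\<nu>\<in>{- int N..}. fourier (dyadic_dilation \<nu> \<phi>) \<xi>)) = ?a * fourier ?G \<xi>" for \<xi>
    unfolding infsum_fourier mi_deriv_eq fourier_partials[OF schwartz_scaled_\<Phi>]
    using prod_list_mi_list[of "\<chi> i. \<i> * complex_of_real (\<xi> $ i)" \<alpha>] by simp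
  then have "fourier_dist u (\<lambda>\<xi>. mi_power (\<chi> i. \<i> * complex_of_real (\<xi> $ i)) \<alpha> / of_nat (mi_fact \<alpha>) *
       (1 - (\<Sum>\<^sub>\<infinity>\<nu>\<in>{- int N..}. fourier (dyadic_dilation \<nu> \<phi>) \<xi>))) = u (fourier (\<lambda>\<xi>. ?a * fourier ?G \<xi>))"
    by (simp add: fourier_dist_def)
  also have "fourier (\<lambda>\<xi>. ?a * fourier ?G \<xi>) = (\<lambda>y. (?a * ?P) * ?G (0 - y))"
    by (rule ext) (simp only: fourier_cmult fourier_inversion[OF G] mult.assoc diff_0)
  also have "u \<dots> = (?a * ?P) * u (\<lambda>y. ?G (0 - y))"
    by (intro cmult schwartz_reflect G)
  finally show ?thesis
    unfolding lp_coeff_eq by simp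
qed

end

section \<open>From the temperate order to the seminorm estimate\<close>

lemma schwartz_seminorm_le:
  assumes "\<And>is x. length is \<le> d \<Longrightarrow> (1 + norm x) ^ d * norm (partials is \<psi> x) \<le> B"
  shows "schwartz_seminorm d \<psi> \<le> B"
  unfolding schwartz_seminorm_def
proof (intro cSUP_least)
  have "zero_mi \<in> {\<alpha>::'a multi_index. mi_size \<alpha> \<le> d}" by simp
  then show "{\<alpha>::'a multi_index. mi_size \<alpha> \<le> d} \<noteq> {}" by blast
  show "(1 + norm x) ^ d * norm (mi_D \<alpha> \<psi> x) \<le> B" if "\<alpha> \<in> {\<alpha>. mi_size \<alpha> \<le> d}" for \<alpha> x
    using assms[of "mi_list \<alpha>" x] that by (simp add: norm_mi_D mi_deriv_eq length_mi_list)
qed auto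

lemma schwartz_seminorm_nonneg:
  assumes "schwartz \<psi>"
  shows "schwartz_seminorm d \<psi> \<ge> 0"
proof -
  have bdd: "bdd_above (range (\<lambda>x. (1 + norm x) ^ d * norm (mi_D \<alpha> \<psi> x)))" for \<alpha>
    using assms by (simp add: schwartz_def)
  have "0 \<le> (1 + norm (0::real^'a)) ^ d * norm (mi_D zero_mi \<psi> 0)" by simp
  also have "\<dots> \<le> (SUP x. (1 + norm x) ^ d * norm (mi_D zero_mi \<psi> x))"
    by (rule cSUP_upper[OF _ bdd]) simp
  also have "\<dots> \<le> schwartz_seminorm d \<psi>"
    unfolding schwartz_seminorm_def
    by (rule cSUP_upper) (auto intro!: bdd_above_finite finite_imageI finite_mi_size_le)
  finally show ?thesis .
qed

lemma tempered_functionalI: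
  assumes "tempered_distribution u" and "temperate_order_le u d"
  obtains c where "tempered_functional u d c"
proof -
  obtain c where c: "\<And>\<psi>. schwartz \<psi> \<Longrightarrow> norm (u \<psi>) \<le> c * schwartz_seminorm d \<psi>"
    using assms(2) by (auto simp: temperate_order_le_def)
  \<comment> \<open>The constant in \<open>temperate_order_le\<close> carries no sign condition; its
    absolute value also works because the seminorm is nonnegative.\<close>
  have "tempered_functional u d \<bar>c\<bar>"
  proof
    show "u (\<lambda>x. a * \<psi> x + b * \<theta> x) = a * u \<psi> + b * u \<theta>" if "schwartz \<psi>" "schwartz \<theta>" for \<psi> \<theta> a b
      using assms(1) that by (simp add: tempered_distribution_def)
    show "norm (u \<psi>) \<le> \<bar>c\<bar> * B" if "schwartz \<psi>"
      and "\<And>is x. length is \<le> d \<Longrightarrow> (1 + norm x) ^ d * norm (partials is \<psi> x) \<le> B" for \<psi> B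
    proof -
      have "norm (u \<psi>) \<le> \<bar>c\<bar> * schwartz_seminorm d \<psi>"
        using c[OF that(1)] mult_right_mono[OF abs_ge_self schwartz_seminorm_nonneg[OF that(1)], of c d] by linarith
      also have "\<dots> \<le> \<bar>c\<bar> * B"
        by (intro mult_left_mono schwartz_seminorm_le that) auto
      finally show ?thesis .
    qed
  qed simp
  then show thesis using that by blast
qed

text \<open>Convergence of the series is asserted separately because \<open>suminf\<close> in
  \<open>lp_remainder\<close> has a value even for a divergent series. Necessity of the coefficient
  condition is stated for every m, and the equivalence for n + m + 1 \<ge> d, where the polynomials
  built from \<open>lp_coeff\<close> have an o(1) remainder.\<close>

theorem propositionC5:
  fixes \<phi> :: "real^'n::finite \<Rightarrow> complex"
    and f :: "'n functional"
    and K0 K1 L1 L0 :: real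
    and d :: nat and m :: int
  assumes "0 < K0" and "K0 < K1" and "K1 < 1" and "1 < L1" and "L1 < L0"
    and "2 * K1 < L1" and "L0 < pi"
    and "admissible K0 K1 L1 L0 \<phi>"
    and "\<And>\<xi>. \<xi> \<noteq> 0 \<Longrightarrow> ((\<lambda>\<nu>::int. fourier \<phi> ((2 powi (- \<nu>)) *\<^sub>R \<xi>)) has_sum 1) UNIV"
    and "tempered_distribution f" and "temperate_order f d"
    and "m \<ge> -1"
  shows "(\<forall>N \<psi>. schwartz \<psi> \<longrightarrow> summable (\<lambda>k. lp_term \<phi> f N k \<psi>)) \<and>
    (dist_bigo (lp_remainder \<phi> f (\<lambda>N. mi_poly m (lp_coeff \<phi> f N)))
           (real_of_int (int CARD('n) + m + 1 - int d))) \<and>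
    (\<forall>c. dist_smallo_1 (lp_remainder \<phi> f (\<lambda>N. mi_poly m (c N))) \<longrightarrow>
           (\<forall>\<alpha>. int (mi_size \<alpha>) \<le> m \<longrightarrow> (\<lambda>N. c N \<alpha> - lp_coeff \<phi> f N \<alpha>) \<in> o(\<lambda>N. 1))) \<and>
    (int CARD('n) + m + 1 - int d \<ge> 0 \<longrightarrow>
         (\<forall>c. dist_smallo_1 (lp_remainder \<phi> f (\<lambda>N. mi_poly m (c N))) \<longleftrightarrow>
           (\<forall>\<alpha>. int (mi_size \<alpha>) \<le> m \<longrightarrow> (\<lambda>N. c N \<alpha> - lp_coeff \<phi> f N \<alpha>) \<in> o(\<lambda>N. 1)))) \<and>
    (\<forall>\<alpha> N. int (mi_size \<alpha>) \<le> m \<longrightarrow>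
           lp_coeff \<phi> f N \<alpha> =
             complex_of_real (1 / (2 * pi) ^ CARD('n)) *
             fourier_dist f (\<lambda>\<xi>.
               mi_power (\<chi> i. \<i> * complex_of_real (\<xi> $ i)) \<alpha> / of_nat (mi_fact \<alpha>) *
               (1 - (\<Sum>\<^sub>\<infinity>\<nu>\<in>{- int N..}. fourier (dyadic_dilation \<nu> \<phi>) \<xi>))))"
proof -
  obtain C where "tempered_functional f d C"
    using tempered_functionalI assms(10,11) unfolding temperate_order_def by blast
  moreover have "dyadic_partition \<phi> K0 L0"
  proof
    show "0 < K0" "schwartz \<phi>" using assms(1,8) by (simp_all add: admissible_def)
    show "K0 \<le> norm \<xi> \<and> norm \<xi> \<le> L0" if "fourier \<phi> \<xi> \<noteq> 0" for \<xi>
      using assms(8) that closure_subset[of "{\<xi>. fourier \<phi> \<xi> \<noteq> 0}"] unfolding admissible_def by blast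
  qed (rule assms(9))
  ultimately interpret dyadic_decomposition \<phi> K0 L0 f d C
    unfolding dyadic_decomposition_def by blast
  show ?thesis
  proof (intro conjI allI impI iffI)
    show "summable (\<lambda>k. lp_term \<phi> f N k \<psi>)" if "schwartz \<psi>" for N \<psi>
      using lp_term_sums[OF that] by (rule sums_summable)
    show "dist_bigo (lp_remainder \<phi> f (\<lambda>N. mi_poly m (lp_coeff \<phi> f N))) (real_of_int (int CARD('n) + m + 1 - int d))"
      by (rule lp_remainder_bigo[OF assms(12)])
    show "(\<lambda>N. c N \<alpha> - lp_coeff \<phi> f N \<alpha>) \<in> o(\<lambda>N. 1)"
      if "dist_smallo_1 (lp_remainder \<phi> f (\<lambda>N. mi_poly m (c N)))" "int (mi_size \<alpha>) \<le> m" for c \<alpha>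
      by (rule lp_coeff_unique[OF assms(12) that])
    \<comment> \<open>The same implication once more, now as one half of the equivalence.\<close>
    show "(\<lambda>N. c N \<alpha> - lp_coeff \<phi> f N \<alpha>) \<in> o(\<lambda>N. 1)"
      if "dist_smallo_1 (lp_remainder \<phi> f (\<lambda>N. mi_poly m (c N)))" "int (mi_size \<alpha>) \<le> m" for c \<alpha>
      by (rule lp_coeff_unique[OF assms(12) that])
    show "dist_smallo_1 (lp_remainder \<phi> f (\<lambda>N. mi_poly m (c N)))"
      if "int CARD('n) + m + 1 - int d \<ge> 0"
        "\<forall>\<alpha>. int (mi_size \<alpha>) \<le> m \<longrightarrow> (\<lambda>N. c N \<alpha> - lp_coeff \<phi> f N \<alpha>) \<in> o(\<lambda>N. 1)" for c
      using that by (intro lp_remainder_smallo assms(12)) auto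
  qed (rule lp_coeff_fourier)
qed

end
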